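(* Let $\mu$ be a partition of the integer $k$ with $\ell(\mu)$ parts, and let $(S_1,S_2)$ be a fixed couple of pair-partitions of $[2k]$ of type $\mu$. Let $\mathbf{p}=(p_1,\dots,p_m)$ and $\mathbf{q}=(q_1,\dots,q_m)$ be sequences of positive integers with $q_1\ge\cdots\ge q_m$, and let $\mathbf{p}\times\mathbf{q}$ be the partition consisting of $q_1$ repeated $p_1$ times, then $q_2$ repeated $p_2$ times, etc. Then $$\Sigma^{(2)}_\mu(\mathbf{p}\times\mathbf{q})=\frac{(-1)^k}{2^{\ell(\mu)}}\sum_{S_0}\Bigg[\sum_{\varphi:\mathcal{L}(S_0,S_2)\to\mathbb{N}^\star}\ \prod_{l\in\mathcal{L}(S_0,S_2)}p_{\varphi(l)}\cdot\prod_{l'\in\mathcal{L}(S_0,S_1)}\big(-2q_{\psi(l')}\big)\Bigg],$$ where $S_0$ runs over pair-partitions of $[2k]$, $p_i=q_i=0$ for $i>m$, and $\psi(l')=\max_l\varphi(l)$ with $l$ running over the loops of $\mathcal{L}(S_0,S_2)$ having at least one element in common with $l'$.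
   Context: A pair-partition of $[2k]$ is a set of pairwise disjoint two-element subsets with union $[2k]$, identified with the fixed-point-free involution sending each element to its partner. For pair-partitions $A,B$ of $[2k]$, $\mathcal{L}(A,B)$ is the bipartite graph with a black vertex for each pair of $A$, a white vertex for each pair of $B$, and for each $i\in[2k]$ an edge labeled $i$ joining the pair of $A$ containing $i$ to the pair of $B$ containing $i$; it is a disjoint union of loops of lengths $2\ell_1\ge2\ell_2\ge\cdots$, each loop viewed as the set of labels of its edges; $(\ell_1,\ell_2,\dots)$ is the type of $(A,B)$. Zonal characters: write the zonal polynomial (Jack polynomial $J^{(2)}_\lambda$, Macdonald normalization) as $Z_\lambda=\sum_{|\rho|=|\lambda|}\theta^{(2)}_\rho(\lambda)p_\rho$. For $|\lambda|\ge|\mu|$, $\Sigma^{(2)}_\mu(\lambda)=\binom{|\lambda|-|\mu|+m_1(\mu)}{m_1(\mu)}z_\mu\theta^{(2)}_{\mu\cup1^{|\lambda|-|\mu|}}(\lambda)$, and $0$ if $|\lambda|<|\mu|$, where $m_i(\mu)$ is the multiplicity of $i$ in $\mu$ and $z_\mu=\prod_i i^{m_i(\mu)}m_i(\mu)!$. *)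

theory Defs
  imports "HOL-Analysis.Analysis" "HOL-Library.FuncSet" "HOL-Library.Multiset"
begin

section \<open>Integer partitions (weakly decreasing lists of positive integers)\<close>

definition partitions :: "nat \<Rightarrow> nat list set" where
  "partitions n = {la. sorted_wrt (\<ge>) la \<and> (\<forall>x\<in>set la. 0 < x) \<and> sum_list la = n}"

definition zee :: "nat list \<Rightarrow> nat" where
  "zee rho = (\<Prod>i\<in>set rho. i ^ count_list rho i * fact (count_list rho i))"

definition dominated :: "nat list \<Rightarrow> nat list \<Rightarrow> bool" where
  "dominated nu la \<longleftrightarrow> sum_list nu = sum_list la \<and>
     (\<forall>i. sum_list (take i nu) \<le> sum_list (take i la))"

section \<open>Symmetric functions of degree n in power-sum coordinates\<close>

text \<open>A homogeneous symmetric function of degree n is represented by its coefficient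
  vector c in the power-sum basis p_rho (rho a partition of n).
  mono_coeff rho nu is the coefficient of x^nu (equivalently of m_nu) in p_rho.\<close>

definition mono_coeff :: "nat list \<Rightarrow> nat list \<Rightarrow> nat" where
  "mono_coeff rho nu = card {f \<in> {..<length rho} \<rightarrow>\<^sub>E {..<length nu}.
      \<forall>i<length nu. (\<Sum>j\<in>{j. j < length rho \<and> f j = i}. rho ! j) = nu ! i}"

definition mcoeff :: "nat \<Rightarrow> (nat list \<Rightarrow> real) \<Rightarrow> nat list \<Rightarrow> real" where
  "mcoeff n c nu = (\<Sum>rho\<in>partitions n. c rho * real (mono_coeff rho nu))"

text \<open>Jack scalar product: <p_rho, p_sigma> = delta z_rho alpha^(length rho).\<close>
definition jack_inner :: "real \<Rightarrow> nat \<Rightarrow> (nat list \<Rightarrow> real) \<Rightarrow> (nat list \<Rightarrow> real) \<Rightarrow> real" where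
  "jack_inner alpha n c d = (\<Sum>rho\<in>partitions n. c rho * d rho * real (zee rho) * alpha ^ length rho)"

text \<open>Jack polynomial J^(alpha)_la (Macdonald normalization), in power-sum coordinates:
  unitriangular (up to scalar) w.r.t. monomials in dominance order, orthogonal to everything
  spanned by monomials strictly dominated by la, and coefficient of m_(1^n) equal to n!.\<close>
definition jack :: "real \<Rightarrow> nat list \<Rightarrow> (nat list \<Rightarrow> real)" where
  "jack alpha la = (let n = sum_list la in
     THE c. (\<forall>rho. rho \<notin> partitions n \<longrightarrow> c rho = 0)
       \<and> (\<forall>nu\<in>partitions n. mcoeff n c nu \<noteq> 0 \<longrightarrow> dominated nu la)
       \<and> mcoeff n c (replicate n 1) = fact n
       \<and> (\<forall>d. (\<forall>rho. rho \<notin> partitions n \<longrightarrow> d rho = 0) \<longrightarrow>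
              (\<forall>nu\<in>partitions n. mcoeff n d nu \<noteq> 0 \<longrightarrow> dominated nu la \<and> nu \<noteq> la) \<longrightarrow>
              jack_inner alpha n c d = 0))"

text \<open>theta^(2)_rho(la): coefficient of p_rho in the zonal polynomial Z_la = J^(2)_la.\<close>
definition theta2 :: "nat list \<Rightarrow> nat list \<Rightarrow> real" where
  "theta2 rho la = jack 2 la rho"

definition Sigma2 :: "nat list \<Rightarrow> nat list \<Rightarrow> real" where
  "Sigma2 mu la = (if sum_list la \<ge> sum_list mu then
      real ((sum_list la - sum_list mu + count_list mu 1) choose (count_list mu 1))
      * real (zee mu) * theta2 (mu @ replicate (sum_list la - sum_list mu) 1) la
    else 0)"

section \<open>Pair-partitions and loops\<close>

definition pair_partitions :: "nat \<Rightarrow> (nat \<Rightarrow> nat) set" where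
  "pair_partitions k = {f. (\<forall>i\<in>{1..2*k}. f i \<in> {1..2*k} \<and> f i \<noteq> i \<and> f (f i) = i)
                          \<and> (\<forall>i. i \<notin> {1..2*k} \<longrightarrow> f i = i)}"

text \<open>Loops of L(A,B), each as the set of its edge labels: the classes of [2k] under the
  equivalence generated by i ~ A i and i ~ B i.\<close>
definition loops :: "nat \<Rightarrow> (nat \<Rightarrow> nat) \<Rightarrow> (nat \<Rightarrow> nat) \<Rightarrow> nat set set" where
  "loops k A B = {1..2*k} // (({(i, A i) | i. i \<in> {1..2*k}} \<union> {(i, B i) | i. i \<in> {1..2*k}})\<^sup>*)"

text \<open>Type of (A,B) as a multiset of half loop-lengths.\<close>
definition pp_type :: "nat \<Rightarrow> (nat \<Rightarrow> nat) \<Rightarrow> (nat \<Rightarrow> nat) \<Rightarrow> nat multiset" where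
  "pp_type k A B = image_mset (\<lambda>l. card l div 2) (mset_set (loops k A B))"

section \<open>Sequences p, q and the partition p x q\<close>

definition seqv :: "nat list \<Rightarrow> nat \<Rightarrow> nat" where
  "seqv xs i = (if 1 \<le> i \<and> i \<le> length xs then xs ! (i - 1) else 0)"

definition ptimesq :: "nat list \<Rightarrow> nat list \<Rightarrow> nat list" where
  "ptimesq ps qs = concat (map (\<lambda>(a, b). replicate a b) (zip ps qs))"

definition psi :: "nat \<Rightarrow> (nat \<Rightarrow> nat) \<Rightarrow> (nat \<Rightarrow> nat) \<Rightarrow> (nat \<Rightarrow> nat) \<Rightarrow> (nat set \<Rightarrow> nat) \<Rightarrow> nat set \<Rightarrow> nat" where
  "psi k S0 S2 S1 phi l' = Max {phi l | l. l \<in> loops k S0 S2 \<and> l \<inter> l' \<noteq> {}}"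

end

(*
  Let D be the diagram of la = p x q. Label the points of [2k] by half-boxes of D so that S1 respects
  columns and swaps left and right halves, S2 respects rows, and S0 joins the two halves of a box;
  weight such a labelling by the sign (-1)^(k - |L(S0,S1)|). For fixed S0 the labellings are counted
  by the inner sum of the theorem: rows are constant on the loops of L(S0,S2), columns on those of
  L(S0,S1), and each of the latter loops allows two choices of sides. So the right-hand side is the
  total signed count, divided by 2^l(mu).

  Exchanging two points on the same side changes the parity of the number of loops. Hence the
  labellings that are not injective cancel, and the injective ones behave well when a common pair is
  added to S1 and S2: this reduces the statement to k = |la|.

  For k = |la| the signed count depends only on the type of (S1,S2) and, divided by 2^l z, defines a
  symmetric function. The same exchange shows that it is triangular with respect to dominance, and
  that these functions are mutually orthogonal (using that (S1,S2) and (S2,S1) have the same type).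
  Orthogonality and triangularity make them span, and so they are the zonal polynomials.
*)

theory Submission
  imports Defs "HOL-Combinatorics.Cycles" "HOL-Combinatorics.Orbits" "HOL-Combinatorics.List_Permutation"
begin

section \<open>Loops of two fixed-point-free involutions\<close>

text \<open>The sides make the parity argument possible: exchanging two arbitrary points in a
  matching can leave the number of loops unchanged modulo 2. If both matchings swap sides, their
  product preserves each side and has there exactly one cycle per loop. The parity of the number of
  loops is then, up to a fixed sign, the sign of a permutation, and an exchange within one side
  composes it with a transposition. Only \<open>L(S0,S1)\<close> carries the sign, so side swapping
  is asked of \<open>S0\<close> and \<open>S1\<close> alone.

  Triangularity and orthogonality share one pigeonhole: if a colouring invariant under
  \<open>S1\<close> has more than \<open>2 * (la_1 + ... + la_j)\<close> points of the first
  \<open>j\<close> colours, two points of one colour share a column and a side, and exchanging them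
  in \<open>S1\<close> cancels the sum. The colouring comes from a monomial in one case, and in the
  other from the rows of a labelling by the second diagram; there the two pair-partitions trade
  roles in one factor.

  No leading coefficient is computed. It is nonzero by orthogonality, positivity of the scalar
  product and the coefficient \<open>n!\<close>.\<close>

definition matching_on :: "'a set \<Rightarrow> ('a \<Rightarrow> 'a) \<Rightarrow> bool" where
  "matching_on X A \<longleftrightarrow> (\<forall>x\<in>X. A x \<in> X \<and> A x \<noteq> x \<and> A (A x) = x)"

definition loop_rel :: "'a set \<Rightarrow> ('a \<Rightarrow> 'a) \<Rightarrow> ('a \<Rightarrow> 'a) \<Rightarrow> ('a \<times> 'a) set" where
  "loop_rel X A B = {(i, A i) | i. i \<in> X} \<union> {(i, B i) | i. i \<in> X}"

definition loop_of :: "'a set \<Rightarrow> ('a \<Rightarrow> 'a) \<Rightarrow> ('a \<Rightarrow> 'a) \<Rightarrow> 'a \<Rightarrow> 'a set" where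
  "loop_of X A B x = (loop_rel X A B)\<^sup>* `` {x}"

definition loops_on :: "'a set \<Rightarrow> ('a \<Rightarrow> 'a) \<Rightarrow> ('a \<Rightarrow> 'a) \<Rightarrow> 'a set set" where
  "loops_on X A B = loop_of X A B ` X"

lemma loops_eq: "loops k A B = loops_on {1..2*k} A B"
  unfolding loops_def loops_on_def loop_of_def loop_rel_def quotient_def by blast

lemma loop_rel_commute: "loop_rel X A B = loop_rel X B A"
  by (auto simp: loop_rel_def)

lemma loop_of_commute: "loop_of X A B = loop_of X B A"
  by (rule ext) (simp add: loop_of_def loop_rel_commute)

lemma loops_on_commute: "loops_on X A B = loops_on X B A"
  by (simp add: loops_on_def loop_of_commute)

lemma finite_loops_on: "finite X \<Longrightarrow> finite (loops_on X A B)"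
  by (simp add: loops_on_def)

lemma matching_onD:
  assumes "matching_on X A" "x \<in> X"
  shows "A x \<in> X" "A x \<noteq> x" "A (A x) = x"
  using assms by (auto simp: matching_on_def)

lemma matching_on_bij: "matching_on X A \<Longrightarrow> bij_betw A X X"
  by (rule bij_betw_byWitness[of _ A]) (auto simp: matching_on_def)

section \<open>The shape of a single loop\<close>

locale two_matchings =
  fixes X :: "'a set" and A B :: "'a \<Rightarrow> 'a"
  assumes fin: "finite X" and matA: "matching_on X A" and matB: "matching_on X B"
begin

lemma flip: "two_matchings X B A"
  using fin matA matB by unfold_locales

lemma sym_loop_rel: "sym (loop_rel X A B)"
  by (rule symI) (auto simp: loop_rel_def dest: matching_onD[OF matA] matching_onD[OF matB])

text \<open>The closure is reflexive everywhere, hence the carrier \<open>UNIV\<close>: an element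
  outside \<open>X\<close> is a class of its own, and \<open>loops_on\<close> takes only the classes
  of elements of \<open>X\<close>.\<close>

lemma equiv_loop_rel: "equiv UNIV ((loop_rel X A B)\<^sup>*)"
  by (intro equivI refl_rtrancl trans_rtrancl sym_rtrancl sym_loop_rel) auto

lemma loop_of_self: "x \<in> loop_of X A B x"
  by (simp add: loop_of_def)

lemma loop_of_eqI: "y \<in> loop_of X A B x \<Longrightarrow> loop_of X A B y = loop_of X A B x"
  using equiv_class_eq[OF equiv_loop_rel] unfolding loop_of_def by blast

lemma loop_of_subset: assumes "x \<in> X" shows "loop_of X A B x \<subseteq> X"
proof
  fix y assume "y \<in> loop_of X A B x"
  then have "(x, y) \<in> (loop_rel X A B)\<^sup>*" by (simp add: loop_of_def)
  then show "y \<in> X"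
    by (induction rule: rtrancl_induct)
       (use assms matching_onD[OF matA] matching_onD[OF matB] in \<open>auto simp: loop_rel_def\<close>)
qed

lemma loop_of_A: "x \<in> X \<Longrightarrow> y \<in> loop_of X A B x \<Longrightarrow> A y \<in> loop_of X A B x"
  using loop_of_subset unfolding loop_of_def
  by (auto intro!: rtrancl_into_rtrancl[where b = y] simp: loop_rel_def)

lemma loop_of_B: "x \<in> X \<Longrightarrow> y \<in> loop_of X A B x \<Longrightarrow> B y \<in> loop_of X A B x"
  using two_matchings.loop_of_A[OF flip] by (simp add: loop_of_commute[of X B A])

lemma loop_of_induct [consumes 2, case_names base A B]:
  assumes "x \<in> X" "y \<in> loop_of X A B x"
    and "P x"
    and "\<And>z. z \<in> loop_of X A B x \<Longrightarrow> P z \<Longrightarrow> P (A z)"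
    and "\<And>z. z \<in> loop_of X A B x \<Longrightarrow> P z \<Longrightarrow> P (B z)"
  shows "P y"
proof -
  have "(x, y) \<in> (loop_rel X A B)\<^sup>*" using assms(2) by (simp add: loop_of_def)
  then show ?thesis
  proof (induction rule: rtrancl_induct)
    case base then show ?case by fact
  next
    case (step y z)
    then have "y \<in> loop_of X A B x" by (simp add: loop_of_def)
    with step assms show ?case by (auto simp: loop_rel_def)
  qed
qed

lemma loop_of_const:
  assumes "x \<in> X" "y \<in> loop_of X A B x"
    and "\<And>z. z \<in> X \<Longrightarrow> u (A z) = u z" "\<And>z. z \<in> X \<Longrightarrow> u (B z) = u z"
  shows "u y = u x"
  using assms(1,2)
proof (induction rule: loop_of_induct)
  case base then show ?case by simp
qed (use assms loop_of_subset[OF assms(1)] in auto)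

lemma loops_onE:
  assumes "l \<in> loops_on X A B" "x \<in> l"
  shows "l = loop_of X A B x" "x \<in> X"
  using assms loop_of_eqI loop_of_subset unfolding loops_on_def by blast+

lemma loop_of_in: "x \<in> X \<Longrightarrow> loop_of X A B x \<in> loops_on X A B"
  by (simp add: loops_on_def)

lemma loops_on_subset: "l \<in> loops_on X A B \<Longrightarrow> l \<subseteq> X"
  using loop_of_subset unfolding loops_on_def by blast

lemma loops_on_nonempty: "l \<in> loops_on X A B \<Longrightarrow> l \<noteq> {}"
  using loop_of_self unfolding loops_on_def by blast

lemma Union_loops_on: "\<Union>(loops_on X A B) = X"
  using loop_of_subset loop_of_self unfolding loops_on_def by blast

lemma disjoint_loops_on:
  "l \<in> loops_on X A B \<Longrightarrow> l' \<in> loops_on X A B \<Longrightarrow> l \<inter> l' \<noteq> {} \<Longrightarrow> l = l'"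
  using loops_onE(1) by blast

lemma funpow_in: "x \<in> X \<Longrightarrow> ((B \<circ> A) ^^ j) x \<in> X"
  by (induction j) (auto simp: matching_onD[OF matA] matching_onD[OF matB])

text \<open>Conjugating by powers of \<open>B \<circ> A\<close> turns the equation \<open>(B \<circ> A)^j x = A x\<close> into a fixed
  point of \<open>A\<close> or of \<open>B\<close>, according to the parity of \<open>j\<close>.\<close>
lemma funpow_neq_A: "x \<in> X \<Longrightarrow> ((B \<circ> A) ^^ j) x \<noteq> A x"
proof (induction j arbitrary: x rule: less_induct)
  case (less j)
  consider "j = 0" | "j = 1" | i where "j = Suc (Suc i)"
    by (metis One_nat_def not0_implies_Suc)
  then show ?case
  proof cases
    case 1 then show ?thesis using less.prems matching_onD(2)[OF matA, of x] by auto
  next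
    case 2 then show ?thesis
      using less.prems matching_onD(2)[OF matB, of "A x"] matching_onD(1)[OF matA, of x] by auto
  next
    case (3 i)
    let ?y = "B (A x)"
    have y: "?y \<in> X" using less.prems by (simp add: matching_onD[OF matA] matching_onD[OF matB])
    show ?thesis
    proof
      assume "((B \<circ> A) ^^ j) x = A x"
      then have "B (A (((B \<circ> A) ^^ i) ?y)) = A x"
        unfolding 3 by (metis comp_apply funpow.simps(2) funpow_swap1)
      then have "A (((B \<circ> A) ^^ i) ?y) = ?y"
        using funpow_in[OF y, of i] matching_onD[OF matA] matching_onD[OF matB] by metis
      then have "((B \<circ> A) ^^ i) ?y = A ?y"
        using funpow_in[OF y, of i] matching_onD(3)[OF matA] by metis
      moreover have "i < j" using 3 by simp
      ultimately show False using less.IH[OF _ y] by blast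
    qed
  qed
qed

lemma period:
  assumes "x \<in> X"
  obtains p where "p > 0" "\<And>i j. ((B \<circ> A) ^^ i) x = ((B \<circ> A) ^^ j) x \<longleftrightarrow> i mod p = j mod p"
proof -
  \<comment> \<open>\<open>B \<circ> A\<close> is arbitrary outside \<open>X\<close>; the identity
    there makes it a permutation, to which \<open>least_power\<close> applies.\<close>
  define q where "q z = (if z \<in> X then (B \<circ> A) z else z)" for z
  have bij: "bij_betw (B \<circ> A) X X"
    using bij_betw_trans[OF matching_on_bij[OF matA] matching_on_bij[OF matB]] .
  have "bij_betw q X X" using bij by (subst bij_betw_cong[of _ _ "B \<circ> A"]) (auto simp: q_def)
  then have "q permutes X" by (rule bij_imp_permutes) (simp add: q_def)
  then have perm: "permutation q" using fin permutation_permutes by blast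
  have q: "(q ^^ i) x = ((B \<circ> A) ^^ i) x" for i
  proof (induction i)
    case (Suc i) then show ?case using funpow_in[OF assms, of i]
      by (simp only: funpow.simps comp_apply[of q] q_def[of "((B \<circ> A) ^^ i) x"]) simp
  qed simp
  define p where "p = least_power q x"
  have "p > 0" using least_power_of_permutation(2)[OF perm] by (simp add: p_def)
  have le: "(q ^^ i) x = (q ^^ j) x \<longleftrightarrow> i mod p = j mod p" if "i \<le> j" for i j
  proof -
    have "(q ^^ i) x = (q ^^ j) x \<longleftrightarrow> (q ^^ (j - i)) x = x"
    proof -
      have "(q ^^ j) x = (q ^^ i) ((q ^^ (j - i)) x)"
        using that by (metis comp_apply funpow_add le_add_diff_inverse)
      moreover have "inj (q ^^ i)" using \<open>q permutes X\<close> by (meson permutes_funpow permutes_inj)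
      ultimately show ?thesis by (metis injD)
    qed
    also have "\<dots> \<longleftrightarrow> p dvd (j - i)" by (simp add: p_def least_power_dvd[OF perm])
    also have "\<dots> \<longleftrightarrow> i mod p = j mod p" using that by (metis mod_eq_dvd_iff_nat)
    finally show ?thesis .
  qed
  have "(q ^^ i) x = (q ^^ j) x \<longleftrightarrow> i mod p = j mod p" for i j
    using le[of i j] le[of j i] by (metis nat_le_linear)
  with \<open>p > 0\<close> q that show thesis by metis
qed

lemma loop_of_eq:
  assumes "x \<in> X"
  shows "loop_of X A B x = range (\<lambda>j. ((B \<circ> A) ^^ j) x) \<union> range (\<lambda>j. A (((B \<circ> A) ^^ j) x))"
    (is "_ = ?R")
proof (rule antisym)
  obtain p where p: "p > 0" "\<And>i j. ((B \<circ> A) ^^ i) x = ((B \<circ> A) ^^ j) x \<longleftrightarrow> i mod p = j mod p"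
    using period[OF assms] by blast
  note inX = funpow_in[OF assms]
  show "loop_of X A B x \<subseteq> ?R"
  proof
    fix y assume "y \<in> loop_of X A B x"
    with assms show "y \<in> ?R"
    proof (induction rule: loop_of_induct)
      case base
      have "x = ((B \<circ> A) ^^ 0) x" by simp
      then show ?case by blast
    next
      case (A z)
      then show ?case using inX matching_onD(3)[OF matA] by fastforce
    next
      case (B z)
      from B(2) consider j where "z = ((B \<circ> A) ^^ j) x" | j where "z = A (((B \<circ> A) ^^ j) x)" by blast
      then show ?case
      proof cases
        case 1
        \<comment> \<open>\<open>B\<close> undoes the last application of
          \<open>B \<circ> A\<close>; adding a period guarantees that there is one, even for
          \<open>j = 0\<close>.\<close>
        have "((B \<circ> A) ^^ (j + p)) x = z" using p(2)[of j "j + p"] 1 by simp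
        then have "z = B (A (((B \<circ> A) ^^ (j + p - 1)) x))"
          using p(1) by (metis One_nat_def Suc_pred add_gr_0 comp_apply funpow.simps(2))
        then have "B z = A (((B \<circ> A) ^^ (j + p - 1)) x)"
          using inX matching_onD[OF matA] matching_onD(3)[OF matB] by metis
        then show ?thesis by blast
      next
        case 2
        then have "B z = ((B \<circ> A) ^^ Suc j) x" by simp
        then show ?thesis by blast
      qed
    qed
  qed
  have "((B \<circ> A) ^^ j) x \<in> loop_of X A B x" for j
  proof (induction j)
    case 0 then show ?case by (simp add: loop_of_self)
  next
    case (Suc j) then show ?case using loop_of_A loop_of_B assms by auto
  qed
  then show "?R \<subseteq> loop_of X A B x" using loop_of_A assms by auto
qed

lemma loop_of_disjoint_halves:
  assumes "x \<in> X"
  shows "A (((B \<circ> A) ^^ j) x) \<noteq> ((B \<circ> A) ^^ i) x"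
proof
  assume eq: "A (((B \<circ> A) ^^ j) x) = ((B \<circ> A) ^^ i) x"
  obtain p where p: "p > 0" "\<And>i j. ((B \<circ> A) ^^ i) x = ((B \<circ> A) ^^ j) x \<longleftrightarrow> i mod p = j mod p"
    using period[OF assms] by blast
  let ?y = "((B \<circ> A) ^^ j) x"
  \<comment> \<open>From \<open>?y\<close> to \<open>((B \<circ> A) ^^ i) x\<close> it takes
    \<open>i - j\<close> steps; the multiple \<open>j * p\<close> of the period keeps the exponent
    natural.\<close>
  have "((B \<circ> A) ^^ (i + j * p - j)) ?y = ((B \<circ> A) ^^ (i + j * p - j + j)) x"
    by (simp add: funpow_add)
  also have "i + j * p - j + j = i + j * p" using p(1) by (cases p) auto
  also have "((B \<circ> A) ^^ (i + j * p)) x = ((B \<circ> A) ^^ i) x" using p(2) by simp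
  finally show False using funpow_neq_A[OF funpow_in[OF assms, of j]] eq by metis
qed

text \<open>The loop is the orbit of \<open>x\<close> under \<open>B \<circ> A\<close> together with
  its disjoint image under \<open>A\<close>. Each has the period as its size, whence the factor
  2.\<close>

lemma loop_of_card:
  assumes "x \<in> X"
  obtains p where "p > 0" "card (loop_of X A B x) = 2 * p"
    "\<And>i j. ((B \<circ> A) ^^ i) x = ((B \<circ> A) ^^ j) x \<longleftrightarrow> i mod p = j mod p"
proof -
  obtain p where p: "p > 0" "\<And>i j. ((B \<circ> A) ^^ i) x = ((B \<circ> A) ^^ j) x \<longleftrightarrow> i mod p = j mod p"
    using period[OF assms] by blast
  let ?O = "range (\<lambda>j. ((B \<circ> A) ^^ j) x)"
  have O: "?O = (\<lambda>j. ((B \<circ> A) ^^ j) x) ` {..<p}"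
  proof -
    have "((B \<circ> A) ^^ j) x \<in> (\<lambda>j. ((B \<circ> A) ^^ j) x) ` {..<p}" for j
      by (rule image_eqI[of _ _ "j mod p"]) (use p in simp_all)
    then show ?thesis by blast
  qed
  have cO: "card ?O = p"
    unfolding O by (subst card_image) (auto simp: inj_on_def p(2))
  have fO: "finite ?O" unfolding O by simp
  have OX: "?O \<subseteq> X" using funpow_in[OF assms] by blast
  have "card (A ` ?O) = p"
    using cO card_image[OF inj_on_subset[OF bij_betw_imp_inj_on[OF matching_on_bij[OF matA]] OX]] by simp
  moreover have "?O \<inter> A ` ?O = {}"
    unfolding image_image
  proof (intro Int_emptyI, elim rangeE)
    fix z i j assume "z = ((B \<circ> A) ^^ i) x" "z = A (((B \<circ> A) ^^ j) x)"
    then show False using loop_of_disjoint_halves[OF assms, of j i] by simp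
  qed
  moreover have "loop_of X A B x = ?O \<union> A ` ?O"
    unfolding loop_of_eq[OF assms] by (simp add: image_image)
  ultimately have "card (loop_of X A B x) = 2 * p"
    using cO fO by (simp add: card_Un_disjoint)
  with p that show thesis by blast
qed

end

subsection \<open>Isomorphisms of pairs of matchings\<close>

definition loop_type :: "'a set \<Rightarrow> ('a \<Rightarrow> 'a) \<Rightarrow> ('a \<Rightarrow> 'a) \<Rightarrow> nat multiset" where
  "loop_type X A B = image_mset (\<lambda>l. card l div 2) (mset_set (loops_on X A B))"

lemma pp_type_eq: "pp_type k A B = loop_type {1..2*k} A B"
  by (simp add: pp_type_def loop_type_def loops_eq)

lemma loop_type_commute: "loop_type X A B = loop_type X B A"
  by (simp add: loop_type_def loops_on_commute)

text \<open>Extensional functions, so that isomorphisms can be counted. Their number plays the part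
  of a stabilizer order in \<open>card_pairs_of_type\<close>.\<close>

definition isos :: "'a set \<Rightarrow> ('a \<Rightarrow> 'a) \<Rightarrow> ('a \<Rightarrow> 'a) \<Rightarrow> 'b set \<Rightarrow> ('b \<Rightarrow> 'b) \<Rightarrow> ('b \<Rightarrow> 'b) \<Rightarrow> ('a \<Rightarrow> 'b) set" where
  "isos X A B Y A' B' = {\<pi> \<in> X \<rightarrow>\<^sub>E Y. bij_betw \<pi> X Y \<and> (\<forall>x\<in>X. \<pi> (A x) = A' (\<pi> x) \<and> \<pi> (B x) = B' (\<pi> x))}"

text \<open>The constant z of a partition read off a multiset, because \<open>card_isos\<close>
  removes loops one at a time in no particular order.\<close>

definition zmset :: "nat multiset \<Rightarrow> nat" where
  "zmset M = (\<Prod>i\<in>set_mset M. i ^ count M i * fact (count M i))"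

lemma zee_eq_zmset: "zee rho = zmset (mset rho)"
  by (simp add: zee_def zmset_def count_mset)

lemma zmset_superset:
  assumes "finite S" "set_mset M \<subseteq> S"
  shows "zmset M = (\<Prod>i\<in>S. i ^ count M i * fact (count M i))"
  unfolding zmset_def
  by (rule prod.mono_neutral_left) (use assms in \<open>auto simp: not_in_iff\<close>)

text \<open>Twice the factor \<open>i * Suc (count N i)\<close> is the number of possible images of
  a point on a loop of half-length \<open>i\<close>; this drives the induction in
  \<open>card_isos\<close>.\<close>

lemma zmset_add_mset: "zmset (add_mset i N) = i * Suc (count N i) * zmset N"
proof -
  let ?S = "insert i (set_mset N)"
  have "zmset (add_mset i N) = (\<Prod>j\<in>?S. j ^ count (add_mset i N) j * fact (count (add_mset i N) j))"
    by (rule zmset_superset) auto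
  also have "\<dots> = i ^ Suc (count N i) * fact (Suc (count N i)) *
      (\<Prod>j\<in>?S - {i}. j ^ count (add_mset i N) j * fact (count (add_mset i N) j))"
    by (subst prod.remove[of _ i]) auto
  also have "(\<Prod>j\<in>?S - {i}. j ^ count (add_mset i N) j * fact (count (add_mset i N) j)) =
      (\<Prod>j\<in>?S - {i}. j ^ count N j * fact (count N j))"
    by (rule prod.cong) auto
  also have "i ^ Suc (count N i) * fact (Suc (count N i)) * \<dots> =
      i * Suc (count N i) * (\<Prod>j\<in>?S. j ^ count N j * fact (count N j))"
    by (subst (2) prod.remove[of _ i]) (auto simp: algebra_simps)
  also have "(\<Prod>j\<in>?S. j ^ count N j * fact (count N j)) = zmset N"
    by (rule zmset_superset[symmetric]) auto
  finally show ?thesis .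
qed

lemma count_image_mset_set:
  assumes "finite S"
  shows "count (image_mset f (mset_set S)) i = card {l\<in>S. f l = i}"
proof -
  have "f -` {i} \<inter> S = {l\<in>S. f l = i}" by auto
  then have "count (image_mset f (mset_set S)) i = (\<Sum>l\<in>{l\<in>S. f l = i}. count (mset_set S) l)"
    using assms by (simp add: count_image_mset)
  also have "\<dots> = (\<Sum>l\<in>{l\<in>S. f l = i}. 1)" by (rule sum.cong) (use assms in auto)
  finally show ?thesis by simp
qed

text \<open>A subset closed under both matchings is a union of loops, so restricting the relation to
  it removes no step of a loop starting there.\<close>

lemma two_matchings_subset_loop_of:
  assumes "two_matchings X A B" "two_matchings Z A B" "Z \<subseteq> X" "z \<in> Z"
  shows "loop_of Z A B z = loop_of X A B z"
proof
  interpret Z: two_matchings Z A B by fact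
  interpret X: two_matchings X A B by fact
  show "loop_of Z A B z \<subseteq> loop_of X A B z"
    unfolding loop_of_def by (rule Image_mono[OF rtrancl_mono]) (use assms(3) in \<open>auto simp: loop_rel_def\<close>)
  show "loop_of X A B z \<subseteq> loop_of Z A B z"
  proof
    fix y assume y: "y \<in> loop_of X A B z"
    have "z \<in> X" using assms by blast
    then show "y \<in> loop_of Z A B z" using y
      by (induction rule: X.loop_of_induct) (use assms Z.loop_of_self Z.loop_of_A Z.loop_of_B in auto)
  qed
qed

context two_matchings
begin

lemma Diff_loop_of:
  assumes "x \<in> X"
  shows "two_matchings (X - loop_of X A B x) A B"
proof
  show "finite (X - loop_of X A B x)" using fin by simp
  have nA: "A z \<notin> loop_of X A B x" if "z \<in> X" "z \<notin> loop_of X A B x" for z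
    using loop_of_A[OF assms, of "A z"] that matching_onD(3)[OF matA] by auto
  have nB: "B z \<notin> loop_of X A B x" if "z \<in> X" "z \<notin> loop_of X A B x" for z
    using loop_of_B[OF assms, of "B z"] that matching_onD(3)[OF matB] by auto
  show "matching_on (X - loop_of X A B x) A" "matching_on (X - loop_of X A B x) B"
    using matA matB nA nB by (auto simp: matching_on_def)
qed

lemma loops_on_Diff:
  assumes "x \<in> X"
  shows "loops_on (X - loop_of X A B x) A B = loops_on X A B - {loop_of X A B x}"
proof -
  let ?L = "loop_of X A B x"
  have "loop_of (X - ?L) A B z = loop_of X A B z" if "z \<in> X - ?L" for z
    using two_matchings_subset_loop_of[OF two_matchings_axioms Diff_loop_of[OF assms] Diff_subset that] .
  then have "loops_on (X - ?L) A B = loop_of X A B ` (X - ?L)"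
    unfolding loops_on_def by (rule image_cong[OF refl])
  also have "\<dots> = loops_on X A B - {?L}"
    using loop_of_eqI loop_of_self unfolding loops_on_def by blast
  finally show ?thesis .
qed

lemma loop_type_Diff:
  assumes "x \<in> X"
  shows "loop_type X A B = add_mset (card (loop_of X A B x) div 2) (loop_type (X - loop_of X A B x) A B)"
  unfolding loop_type_def loops_on_Diff[OF assms]
  using mset_set.remove[OF finite_loops_on[OF fin] loop_of_in[OF assms]] by simp

lemma even_card_loop: "l \<in> loops_on X A B \<Longrightarrow> even (card l)"
  unfolding loops_on_def by (metis dvd_triv_left imageE loop_of_card)

lemma card_loop_pos: "l \<in> loops_on X A B \<Longrightarrow> 0 < card l div 2"
  unfolding loops_on_def by (elim imageE) (metis loop_of_card nonzero_mult_div_cancel_left zero_neq_numeral)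

lemma B_funpow_Suc: "x \<in> X \<Longrightarrow> B (((B \<circ> A) ^^ Suc j) x) = A (((B \<circ> A) ^^ j) x)"
  using funpow_in[of x j] by (simp add: matching_onD[OF matA] matching_onD[OF matB])

end

text \<open>Both loops are traversed from their base points: the \<open>j\<close>-th orbit point of
  one goes to the \<open>j\<close>-th orbit point of the other, and likewise for the images under
  \<open>A\<close>. Equal lengths mean equal periods, so this is well defined.\<close>

lemma loop_iso_exists:
  assumes "two_matchings X A B" "two_matchings Y A' B'" "x \<in> X" "y \<in> Y"
    and card: "card (loop_of X A B x) = card (loop_of Y A' B' y)"
  obtains \<phi> where "bij_betw \<phi> (loop_of X A B x) (loop_of Y A' B' y)" "\<phi> x = y"
    "\<And>z. z \<in> loop_of X A B x \<Longrightarrow> \<phi> (A z) = A' (\<phi> z) \<and> \<phi> (B z) = B' (\<phi> z)"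
proof -
  interpret X: two_matchings X A B by fact
  interpret Y: two_matchings Y A' B' by fact
  define c d where "c j = ((B \<circ> A) ^^ j) x" and "d j = ((B' \<circ> A') ^^ j) y" for j
  have "\<exists>p>0. card (loop_of X A B x) = 2 * p \<and> (\<forall>i j. c i = c j \<longleftrightarrow> i mod p = j mod p)"
    unfolding c_def by (rule X.loop_of_card[OF assms(3)]) (intro exI conjI allI)
  then obtain p where p: "p > 0" "card (loop_of X A B x) = 2 * p" "\<And>i j. c i = c j \<longleftrightarrow> i mod p = j mod p"
    by auto
  have "\<exists>p>0. card (loop_of Y A' B' y) = 2 * p \<and> (\<forall>i j. d i = d j \<longleftrightarrow> i mod p = j mod p)"
    unfolding d_def by (rule Y.loop_of_card[OF assms(4)]) (intro exI conjI allI)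
  then obtain p' where "p' > 0" and p': "card (loop_of Y A' B' y) = 2 * p'"
    and "\<And>i j. d i = d j \<longleftrightarrow> i mod p' = j mod p'"
    by auto
  moreover have "p' = p" using card p(2) p' by simp
  ultimately have cd: "d i = d j" if "c i = c j" for i j using that p(3) by simp
  have inX: "c j \<in> X" for j unfolding c_def by (rule X.funpow_in[OF assms(3)])
  have inY: "d j \<in> Y" for j unfolding d_def by (rule Y.funpow_in[OF assms(4)])
  have loopX: "loop_of X A B x = range c \<union> range (\<lambda>j. A (c j))"
    unfolding c_def by (rule X.loop_of_eq[OF assms(3)])
  have loopY: "loop_of Y A' B' y = range d \<union> range (\<lambda>j. A' (d j))"
    unfolding d_def by (rule Y.loop_of_eq[OF assms(4)])
  have disj: "A (c j) \<noteq> c i" for i j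
    unfolding c_def by (rule X.loop_of_disjoint_halves[OF assms(3)])
  have Bc: "B (c (Suc i)) = A (c i)" for i unfolding c_def by (rule X.B_funpow_Suc[OF assms(3)])
  have Bd: "B' (d (Suc i)) = A' (d i)" for i unfolding d_def by (rule Y.B_funpow_Suc[OF assms(4)])
  have BAc: "B (A (c i)) = c (Suc i)" for i by (simp add: c_def)
  have BAd: "B' (A' (d i)) = d (Suc i)" for i by (simp add: d_def)
  \<comment> \<open>A point of the second half is sent through its partner \<open>A z\<close>, which
    lies on the orbit. \<open>inv c\<close> picks some index, and by \<open>cd\<close> the value
    does not depend on it.\<close>
  define \<phi> where "\<phi> z = (if z \<in> range c then d (inv c z) else A' (d (inv c (A z))))" for z
  have \<phi>1: "\<phi> (c j) = d j" for j
    using cd[of "inv c (c j)" j] by (simp add: \<phi>_def f_inv_into_f)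
  have \<phi>2: "\<phi> (A (c j)) = A' (d j)" for j
  proof -
    have "A (c j) \<notin> range c" using disj by blast
    moreover have "A (A (c j)) = c j" using inX matching_onD(3)[OF X.matA] by simp
    ultimately show ?thesis using cd[of "inv c (c j)" j] by (simp add: \<phi>_def f_inv_into_f)
  qed
  have img: "\<phi> ` loop_of X A B x = loop_of Y A' B' y"
    unfolding loopX loopY image_Un image_image \<phi>1 \<phi>2 ..
  moreover have "inj_on \<phi> (loop_of X A B x)"
    using img card finite_subset[OF X.loop_of_subset[OF assms(3)] X.fin]
    by (intro eq_card_imp_inj_on) auto
  ultimately have 1: "bij_betw \<phi> (loop_of X A B x) (loop_of Y A' B' y)"
    by (simp add: bij_betw_def)
  have 2: "\<phi> x = y" using \<phi>1[of 0] by (simp add: c_def d_def)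
  have 3: "\<phi> (A z) = A' (\<phi> z) \<and> \<phi> (B z) = B' (\<phi> z)" if "z \<in> loop_of X A B x" for z
  proof -
    from that loopX consider j where "z = c j" | j where "z = A (c j)" by blast
    then show ?thesis
    proof cases
      case 1
      \<comment> \<open>The step back with \<open>B\<close> needs a predecessor index, which exists
        after a shift by one period.\<close>
      obtain i where i: "j + p = Suc i" using p(1) by (metis Suc_pred add_gr_0)
      have zi: "c j = c (Suc i)" unfolding p(3) i[symmetric] by simp
      have "B z = A (c i)" unfolding 1 zi by (rule Bc)
      moreover have "B' (d j) = A' (d i)" unfolding cd[OF zi] by (rule Bd)
      ultimately show ?thesis using 1 \<phi>1 \<phi>2 by simp
    next
      case 2
      have "A z = c j" using 2 inX matching_onD(3)[OF X.matA] by simp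
      moreover have "A' (A' (d j)) = d j" using inY matching_onD(3)[OF Y.matA] by simp
      ultimately show ?thesis using 2 BAc BAd \<phi>1 \<phi>2 by simp
    qed
  qed
  from that[OF 1 2 3] show thesis .
qed

lemma isos_loop_of:
  assumes "two_matchings X A B" "two_matchings Y A' B'" "\<pi> \<in> isos X A B Y A' B'" "x \<in> X"
  shows "loop_of Y A' B' (\<pi> x) = \<pi> ` loop_of X A B x"
proof
  interpret X: two_matchings X A B by fact
  interpret Y: two_matchings Y A' B' by fact
  have Y: "\<pi> x \<in> Y" using assms by (auto simp: isos_def)
  have com: "\<pi> (A z) = A' (\<pi> z)" "\<pi> (B z) = B' (\<pi> z)" if "z \<in> X" for z
    using assms(3) that by (auto simp: isos_def)
  have sub: "loop_of X A B x \<subseteq> X" by (rule X.loop_of_subset[OF assms(4)])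
  show "loop_of Y A' B' (\<pi> x) \<subseteq> \<pi> ` loop_of X A B x"
  proof
    fix w assume "w \<in> loop_of Y A' B' (\<pi> x)"
    with Y show "w \<in> \<pi> ` loop_of X A B x"
    proof (induction rule: Y.loop_of_induct)
      case base show ?case using X.loop_of_self by blast
    next
      case (A w)
      then obtain z where z: "z \<in> loop_of X A B x" "w = \<pi> z" by blast
      have "A' w = \<pi> (A z)" using z sub com(1)[of z] by auto
      then show ?case using X.loop_of_A[OF assms(4) z(1)] by simp
    next
      case (B w)
      then obtain z where z: "z \<in> loop_of X A B x" "w = \<pi> z" by blast
      have "B' w = \<pi> (B z)" using z sub com(2)[of z] by auto
      then show ?case using X.loop_of_B[OF assms(4) z(1)] by simp
    qed
  qed
  show "\<pi> ` loop_of X A B x \<subseteq> loop_of Y A' B' (\<pi> x)"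
  proof (rule image_subsetI)
    fix z assume z: "z \<in> loop_of X A B x"
    from assms(4) z show "\<pi> z \<in> loop_of Y A' B' (\<pi> x)"
    proof (induction rule: X.loop_of_induct)
      case base show ?case by (rule Y.loop_of_self)
    next
      case (A z) then show ?case using com(1)[of z] sub Y.loop_of_A[OF Y, of "\<pi> z"] by auto
    next
      case (B z) then show ?case using com(2)[of z] sub Y.loop_of_B[OF Y, of "\<pi> z"] by auto
    qed
  qed
qed

text \<open>Once the image of \<open>x\<close> is chosen, commuting with the matchings fixes the
  isomorphism on the whole loop of \<open>x\<close>. What remains is an arbitrary isomorphism of the
  complements.\<close>

lemma card_isos_at:
  assumes "two_matchings X A B" "two_matchings Y A' B'" "x \<in> X" "y \<in> Y"
    and card: "card (loop_of X A B x) = card (loop_of Y A' B' y)"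
  shows "card {\<pi> \<in> isos X A B Y A' B'. \<pi> x = y} =
    card (isos (X - loop_of X A B x) A B (Y - loop_of Y A' B' y) A' B')"
proof -
  interpret X: two_matchings X A B by fact
  interpret Y: two_matchings Y A' B' by fact
  let ?L = "loop_of X A B x" and ?L' = "loop_of Y A' B' y"
  have LX: "?L \<subseteq> X" using X.loop_of_subset assms by blast
  have LY: "?L' \<subseteq> Y" using Y.loop_of_subset assms by blast
  obtain \<phi> where \<phi>: "bij_betw \<phi> ?L ?L'" "\<phi> x = y"
    "\<And>z. z \<in> ?L \<Longrightarrow> \<phi> (A z) = A' (\<phi> z) \<and> \<phi> (B z) = B' (\<phi> z)"
    using loop_iso_exists[OF assms] by blast
  interpret XL: two_matchings "X - ?L" A B by (rule X.Diff_loop_of) fact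
  have "bij_betw (\<lambda>\<pi>. restrict \<pi> (X - ?L)) {\<pi> \<in> isos X A B Y A' B'. \<pi> x = y}
      (isos (X - ?L) A B (Y - ?L') A' B')" (is "bij_betw ?r ?I ?J")
  proof (rule bij_betwI')
    fix \<pi> \<rho> assume \<pi>: "\<pi> \<in> ?I" and \<rho>: "\<rho> \<in> ?I"
    show "?r \<pi> = ?r \<rho> \<longleftrightarrow> \<pi> = \<rho>"
    proof
      assume eq: "?r \<pi> = ?r \<rho>"
      show "\<pi> = \<rho>"
      proof (rule PiE_ext)
        show "\<pi> \<in> X \<rightarrow>\<^sub>E Y" "\<rho> \<in> X \<rightarrow>\<^sub>E Y" using \<pi> \<rho> by (auto simp: isos_def)
        fix z assume z: "z \<in> X"
        show "\<pi> z = \<rho> z"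
        proof (cases "z \<in> ?L")
          case False
          then show ?thesis using eq z by (metis Diff_iff restrict_apply')
        next
          case True
          with \<open>x \<in> X\<close> show ?thesis
          proof (induction rule: X.loop_of_induct)
            case base show ?case using \<pi> \<rho> by simp
          qed (use \<pi> \<rho> LX in \<open>auto simp: isos_def\<close>)
        qed
      qed
    qed simp
  next
    fix \<pi> assume \<pi>: "\<pi> \<in> ?I"
    have L: "\<pi> ` ?L = ?L'" using isos_loop_of[OF assms(1,2) _ assms(3), of \<pi>] \<pi> by auto
    have b: "bij_betw \<pi> X Y" using \<pi> by (auto simp: isos_def)
    have "\<pi> ` (X - ?L) = Y - ?L'"
      using inj_on_image_set_diff[of \<pi> X X ?L] b LX L by (simp add: bij_betw_def)
    then have "bij_betw \<pi> (X - ?L) (Y - ?L')"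
      by (rule bij_betw_subset[OF b Diff_subset])
    then have bL: "bij_betw (?r \<pi>) (X - ?L) (Y - ?L')"
      by (subst bij_betw_cong[of _ _ \<pi>]) auto
    have "?r \<pi> \<in> (X - ?L) \<rightarrow>\<^sub>E (Y - ?L')"
      using bij_betw_imp_funcset[OF bL] by (intro PiE_I) (auto simp: Pi_def split: if_splits)
    moreover note bL
    moreover have "?r \<pi> (A z) = A' (?r \<pi> z) \<and> ?r \<pi> (B z) = B' (?r \<pi> z)" if "z \<in> X - ?L" for z
      using that \<pi> matching_onD(1)[OF XL.matA that] matching_onD(1)[OF XL.matB that] by (auto simp: isos_def)
    ultimately show "?r \<pi> \<in> ?J" unfolding isos_def by blast
  next
    fix \<rho> assume \<rho>: "\<rho> \<in> ?J"
    define \<pi> where "\<pi> z = (if z \<in> ?L then \<phi> z else \<rho> z)" for z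
    have b\<rho>: "bij_betw \<rho> (X - ?L) (Y - ?L')" using \<rho> by (simp add: isos_def)
    have "bij_betw (\<lambda>z. if z \<in> ?L then \<phi> z else \<rho> z) (?L \<union> (X - ?L)) (?L' \<union> (Y - ?L'))"
      using \<phi>(1) b\<rho> by (rule bij_betw_disjoint_Un) auto
    moreover have "?L \<union> (X - ?L) = X" "?L' \<union> (Y - ?L') = Y" using LX LY by auto
    ultimately have bij: "bij_betw \<pi> X Y" unfolding \<pi>_def by simp
    have com: "\<pi> (A z) = A' (\<pi> z) \<and> \<pi> (B z) = B' (\<pi> z)" if z: "z \<in> X" for z
    proof (cases "z \<in> ?L")
      case True
      then show ?thesis using \<phi>(3) X.loop_of_A X.loop_of_B assms(3) by (simp add: \<pi>_def)
    next
      case False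
      then have "A z \<notin> ?L" "B z \<notin> ?L"
        using z matching_onD(1)[OF XL.matA, of z] matching_onD(1)[OF XL.matB, of z] by auto
      then show ?thesis using \<rho> z False by (simp add: isos_def \<pi>_def)
    qed
    have und: "\<pi> z = undefined" if "z \<notin> X" for z
    proof -
      have "z \<notin> ?L" "z \<notin> X - ?L" using that LX by auto
      then show ?thesis using \<rho> PiE_arb[of \<rho> "X - ?L"] by (auto simp: isos_def \<pi>_def)
    qed
    have "\<pi> \<in> X \<rightarrow>\<^sub>E Y" using bij_betw_apply[OF bij] und by (intro PiE_I)
    then have "\<pi> \<in> isos X A B Y A' B'" using bij com unfolding isos_def by blast
    moreover have "\<pi> x = y" using \<phi>(2) X.loop_of_self by (simp add: \<pi>_def)
    moreover have "\<rho> = ?r \<pi>"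
    proof
      fix z
      have "\<rho> \<in> (X - ?L) \<rightarrow>\<^sub>E (Y - ?L')" using \<rho> by (simp add: isos_def)
      then have "\<rho> z = undefined" if "z \<notin> X - ?L" using that by (rule PiE_arb)
      then show "\<rho> z = ?r \<pi> z" by (simp add: \<pi>_def restrict_def)
    qed
    ultimately show "\<exists>\<pi>\<in>?I. \<rho> = ?r \<pi>" by (intro bexI[of _ \<pi>] CollectI conjI)
  qed
  then show ?thesis by (rule bij_betw_same_card)
qed

text \<open>A point \<open>x\<close> can go to any point on a loop of the same length, that is to
  \<open>2 * i * count M i\<close> points; the complement of its loop is treated by induction.
  Positivity of this number later supplies conjugating permutations.\<close>

theorem card_isos:
  assumes "two_matchings X A B" "two_matchings Y A' B'" "loop_type X A B = M" "loop_type Y A' B' = M"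
  shows "card (isos X A B Y A' B') = 2 ^ size M * zmset M"
  using assms
proof (induction "card X" arbitrary: X Y M rule: less_induct)
  case less
  interpret X: two_matchings X A B by fact
  interpret Y: two_matchings Y A' B' by fact
  show ?case
  proof (cases "X = {}")
    case True
    then have "M = {#}" using less.prems(3) by (simp add: loop_type_def loops_on_def)
    then have "loops_on Y A' B' = {}"
      using less.prems(4) finite_loops_on[OF Y.fin] by (simp add: loop_type_def mset_set_empty_iff)
    then have "Y = {}" by (simp add: loops_on_def)
    have "isos X A B Y A' B' = {\<lambda>x. undefined}"
      using True \<open>Y = {}\<close> by (auto simp: isos_def bij_betw_def)
    then show ?thesis using \<open>M = {#}\<close> by (simp add: zmset_def)
  next
    case False
    then obtain x where x: "x \<in> X" by blast
    let ?L = "loop_of X A B x"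
    define i where "i = card ?L div 2"
    define N where "N = loop_type (X - ?L) A B"
    have M: "M = add_mset i N" using X.loop_type_Diff[OF x] less.prems(3) by (simp add: i_def N_def)
    have card_L: "card ?L = 2 * i" using X.even_card_loop[OF X.loop_of_in[OF x]] by (simp add: i_def)
    define Y0 where "Y0 = {y\<in>Y. card (loop_of Y A' B' y) = card ?L}"
    have fin_isos: "finite (isos X A B Y A' B')"
      unfolding isos_def by (rule finite_subset[OF _ finite_PiE[OF X.fin]]) (use Y.fin in auto)
    have "isos X A B Y A' B' = (\<Union>y\<in>Y0. {\<pi> \<in> isos X A B Y A' B'. \<pi> x = y})"
    proof -
      have "\<pi> x \<in> Y0" if "\<pi> \<in> isos X A B Y A' B'" for \<pi>
      proof -
        have "inj_on \<pi> ?L" using that X.loop_of_subset[OF x]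
          by (auto simp: isos_def bij_betw_def intro: inj_on_subset)
        then have "card (loop_of Y A' B' (\<pi> x)) = card ?L"
          using isos_loop_of[OF less.prems(1,2) that x] by (simp add: card_image)
        then show ?thesis using that x by (auto simp: Y0_def isos_def)
      qed
      then show ?thesis by blast
    qed
    also have "card \<dots> = (\<Sum>y\<in>Y0. card {\<pi> \<in> isos X A B Y A' B'. \<pi> x = y})"
      by (rule card_UN_disjoint) (use fin_isos Y.fin in \<open>auto simp: Y0_def\<close>)
    also have "\<dots> = (\<Sum>y\<in>Y0. 2 ^ size N * zmset N)"
    proof (rule sum.cong)
      fix y assume "y \<in> Y0"
      then have y: "y \<in> Y" "card ?L = card (loop_of Y A' B' y)" by (auto simp: Y0_def)
      have "card (X - ?L) < card X"
        using x X.loop_of_self X.fin by (intro psubset_card_mono) auto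
      moreover have "loop_type (Y - loop_of Y A' B' y) A' B' = N"
        using Y.loop_type_Diff[OF y(1)] less.prems(4) M y(2) by (simp add: i_def)
      ultimately have "card (isos (X - ?L) A B (Y - loop_of Y A' B' y) A' B') = 2 ^ size N * zmset N"
        by (intro less.hyps X.Diff_loop_of[OF x] Y.Diff_loop_of[OF y(1)]) (simp_all add: N_def)
      then show "card {\<pi> \<in> isos X A B Y A' B'. \<pi> x = y} = 2 ^ size N * zmset N"
        using card_isos_at[OF less.prems(1,2) x y] by simp
    qed simp
    also have "\<dots> = card Y0 * (2 ^ size N * zmset N)" by simp
    also have "card Y0 = count M i * (2 * i)"
    proof -
      let ?S = "{l \<in> loops_on Y A' B'. card l div 2 = i}"
      have S: "card l = 2 * i" if "l \<in> ?S" for l using Y.even_card_loop[of l] that by auto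
      have "Y0 = \<Union>?S"
      proof (intro equalityI subsetI)
        fix y assume "y \<in> Y0"
        then show "y \<in> \<Union>?S" using Y.loop_of_self[of y] Y.loop_of_in[of y] card_L
          by (auto simp: Y0_def intro!: bexI[of _ "loop_of Y A' B' y"])
      next
        fix y assume "y \<in> \<Union>?S"
        then obtain l where l: "l \<in> ?S" "y \<in> l" by blast
        then have "l = loop_of Y A' B' y" "y \<in> Y" using Y.loops_onE[of l y] by auto
        then show "y \<in> Y0" using S[OF l(1)] card_L by (simp add: Y0_def)
      qed
      also have "card (\<Union>?S) = (\<Sum>l\<in>?S. card l)"
        using Y.disjoint_loops_on Y.loops_on_subset finite_subset[OF _ Y.fin]
        by (intro card_Union_disjoint) (auto simp: pairwise_def disjnt_def)
      also have "\<dots> = (\<Sum>l\<in>?S. 2 * i)" by (rule sum.cong[OF refl S])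
      also have "\<dots> = card ?S * (2 * i)" by simp
      also have "card ?S = count M i"
        using less.prems(4) finite_loops_on[OF Y.fin]
        by (auto simp: loop_type_def count_image_mset_set)
      finally show ?thesis .
    qed
    finally show ?thesis using M by (simp add: zmset_add_mset algebra_simps)
  qed
qed

lemma isos_loop_type:
  assumes "two_matchings X A B" "two_matchings Y A' B'" "\<pi> \<in> isos X A B Y A' B'"
  shows "loop_type Y A' B' = loop_type X A B"
proof -
  interpret X: two_matchings X A B by fact
  interpret Y: two_matchings Y A' B' by fact
  have bij: "bij_betw \<pi> X Y" using assms(3) by (simp add: isos_def)
  have "Y = \<pi> ` X" using bij by (simp add: bij_betw_def)
  then have loops: "loops_on Y A' B' = (`) \<pi> ` loops_on X A B"
    using isos_loop_of[OF assms] unfolding loops_on_def by (simp add: image_image)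
  have inj: "inj_on ((`) \<pi>) (loops_on X A B)"
    using bij by (intro inj_on_image) (simp add: X.Union_loops_on bij_betw_def)
  have "card (\<pi> ` l) = card l" if "l \<in> loops_on X A B" for l
    using bij X.loops_on_subset[OF that] by (metis bij_betw_def card_image inj_on_subset)
  then have eq: "image_mset (\<lambda>l. card (\<pi> ` l) div 2) (mset_set (loops_on X A B)) =
      image_mset (\<lambda>l. card l div 2) (mset_set (loops_on X A B))"
    using finite_loops_on[OF X.fin] by (intro image_mset_cong) simp
  have "loop_type Y A' B' =
      image_mset (\<lambda>l. card l div 2) (image_mset ((`) \<pi>) (mset_set (loops_on X A B)))"
    by (simp only: loop_type_def loops image_mset_mset_set[OF inj])
  also have "\<dots> = image_mset (\<lambda>l. card (\<pi> ` l) div 2) (mset_set (loops_on X A B))"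
    by (simp only: multiset.map_comp comp_def)
  finally show ?thesis using eq by (simp only: loop_type_def)
qed

subsection \<open>Parity of the number of loops\<close>

lemma cyclic_on_cycle_of_list:
  assumes "distinct cs" "cs \<noteq> []"
  shows "cyclic_on (cycle_of_list cs) (set cs)"
proof (rule cyclic_on_singleI)
  show hd: "hd cs \<in> set cs" using assms by simp
  let ?c = "cycle_of_list cs"
  have c: "(?c ^^ n) (cs ! 0) = cs ! n" if "n < length cs" for n
  proof -
    have "map (?c ^^ n) cs ! 0 = rotate n cs ! 0" by (simp only: cyclic_rotation[OF assms(1)])
    then show ?thesis using that assms(2) by (simp add: nth_rotate)
  qed
  have "orbit ?c (hd cs) = {(?c ^^ n) (hd cs) | n. True}"
    by (rule orbit_altdef_permutation[OF permutation_of_cycle])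
  moreover have "set cs \<subseteq> {(?c ^^ n) (hd cs) | n. True}"
    using c assms(2) by (auto simp: in_set_conv_nth hd_conv_nth) metis
  moreover have "orbit ?c (hd cs) \<subseteq> set cs" using hd by (rule permutes_orbit_subset[OF cycle_permutes])
  ultimately show "set cs = orbit ?c (hd cs)" by blast
qed

lemma sign_cycle_of_list:
  "distinct cs \<Longrightarrow> cs \<noteq> [] \<Longrightarrow> sign (cycle_of_list cs) = (-1) ^ (length cs - 1)"
proof (induction cs rule: cycle_of_list.induct)
  case (1 i j cs)
  have "sign (Transposition.transpose i j \<circ> cycle_of_list (j # cs)) = sign (Transposition.transpose i j) * sign (cycle_of_list (j # cs))"
    by (intro sign_compose permutation_swap_id permutation_of_cycle)
  then show ?case using 1 by (simp add: sign_swap_id comp_def)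
qed auto

text \<open>A cycle of length m has sign \<open>(-1) ^ (m - 1)\<close> and contributes m points and
  one orbit, so both sides change by the same factor. Fixed points are cycles of length one.\<close>

lemma sign_cycle_decomp:
  assumes "cycle_decomp I p"
  shows "finite I \<and> p permutes I \<and> sign p = (-1) ^ (card I + card (orbit p ` I))"
  using assms
proof (induction rule: cycle_decomp.induct)
  case empty
  show ?case by (simp add: fun_eq_iff)
next
  case (comp I p cs)
  show ?case
  proof (cases "cs = []")
    \<comment> \<open>\<open>cycle_decomp\<close> admits the empty cycle, which is the identity and
      adds neither points nor orbits.\<close>
    case True
    then show ?thesis using comp by simp
  next
    case False
    let ?c = "cycle_of_list cs" and ?q = "cycle_of_list cs \<circ> p"
    have fin: "finite I" and perm: "p permutes I" using comp by auto
    have cp: "?c permutes set cs" by (rule cycle_permutes)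
    have pI: "p x = x" if "x \<in> set cs" for x
      using that comp.hyps(3) by (intro permutes_not_in[OF perm]) auto
    have cI: "?c x = x" if "x \<in> I" for x
      using that comp.hyps(3) by (intro permutes_not_in[OF cp]) auto
    have o1: "orbit ?q x = orbit p x" if "x \<in> I" for x
      by (rule orbit_cong0[of _ I, symmetric])
        (use that cI permutes_in_image[OF perm] in auto)
    have o2: "orbit ?q x = set cs" if "x \<in> set cs" for x
    proof -
      have "orbit ?c x = orbit ?q x"
        by (rule orbit_cong0[of _ "set cs"])
          (use that pI permutes_in_image[OF cp] in auto)
      then show ?thesis
        using orbit_cyclic_eq3[OF cyclic_on_cycle_of_list[OF comp.hyps(2) False] that] by simp
    qed
    have img: "orbit ?q ` (set cs \<union> I) = insert (set cs) (orbit p ` I)"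
    proof -
      have "orbit ?q ` set cs = {set cs}" 
        using image_cong[OF refl o2, of "set cs"] False by (simp add: image_constant_conv)
      moreover have "orbit ?q ` I = orbit p ` I" using o1 by (rule image_cong[OF refl])
      ultimately show ?thesis by (simp add: image_Un)
    qed
    have notin: "set cs \<notin> orbit p ` I"
    proof
      assume "set cs \<in> orbit p ` I"
      then obtain x where "x \<in> I" "set cs = orbit p x" by blast
      then have "set cs \<subseteq> I" using permutes_orbit_subset[OF perm] by simp
      then show False using comp.hyps(3) False by (simp add: Int_absorb2)
    qed
    have "finite (orbit p ` I)" using fin by simp
    then have c1: "card (orbit ?q ` (set cs \<union> I)) = Suc (card (orbit p ` I))"
      unfolding img using notin by simp
    have c2: "card (set cs \<union> I) = length cs + card I"
      using comp.hyps fin by (simp add: card_Un_disjoint distinct_card)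
    have "permutation p" using perm fin permutation_permutes by blast
    then have "sign ?q = sign ?c * sign p" by (intro sign_compose permutation_of_cycle)
    also have "\<dots> = (-1) ^ (length cs - 1) * (-1) ^ (card I + card (orbit p ` I))"
      using sign_cycle_of_list[OF comp.hyps(2) False] comp.IH by simp
    also have "\<dots> = (-1) ^ (card (set cs \<union> I) + card (orbit ?q ` (set cs \<union> I)))"
      unfolding c1 c2 using False by (cases cs) (simp_all add: power_add)
    finally have "sign ?q = (-1) ^ (card (set cs \<union> I) + card (orbit ?q ` (set cs \<union> I)))" .
    moreover have "?q permutes set cs \<union> I"
      using perm cp by (intro permutes_compose) (auto intro: permutes_subset)
    ultimately show ?thesis using fin by (intro conjI finite_UnI finite_set)
  qed
qed

lemma sign_eq_card_orbits:
  assumes "p permutes I" "finite I"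
  shows "sign p = (-1) ^ (card I + card (orbit p ` I))"
  using sign_cycle_decomp cycle_decomposition[OF assms] by blast

text \<open>A two-colouring of the labels; in the labellings below it is the side of a
  half-box.\<close>

definition alternating :: "'a set \<Rightarrow> ('a \<Rightarrow> 'a) \<Rightarrow> ('a \<Rightarrow> bool) \<Rightarrow> bool" where
  "alternating X A h \<longleftrightarrow> (\<forall>x\<in>X. h (A x) = (\<not> h x))"

definition half_perm :: "'a set \<Rightarrow> ('a \<Rightarrow> 'a) \<Rightarrow> ('a \<Rightarrow> 'a) \<Rightarrow> 'a \<Rightarrow> 'a" where
  "half_perm F A B x = (if x \<in> F then B (A x) else x)"

context two_matchings
begin

text \<open>\<open>B \<circ> A\<close> preserves colours, and each loop meets \<open>F\<close> in
  exactly one of its orbits, since the other half of the loop is the image under \<open>A\<close>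
  and has the other colour. Loops thus become cycles, and the sign counts them modulo 2.\<close>

lemma sign_half_perm:
  fixes c :: bool
  assumes h: "alternating X A h" "alternating X B h"
  defines "F \<equiv> {x\<in>X. h x = c}"
  shows "half_perm F A B permutes F"
    and "sign (half_perm F A B) = (-1) ^ (card F + card (loops_on X A B))"
proof -
  let ?q = "half_perm F A B"
  have FX: "F \<subseteq> X" "finite F" using fin by (auto simp: F_def)
  have BA: "B (A x) \<in> F" if "x \<in> F" for x
    using that h matching_onD[OF matA] matching_onD[OF matB] by (auto simp: F_def alternating_def)
  have nA: "A x \<notin> F" if "x \<in> F" for x
    using that h by (auto simp: F_def alternating_def)
  have "inj_on ?q F"
  proof (rule inj_onI)
    fix x y assume "x \<in> F" "y \<in> F" "?q x = ?q y"
    then have "B (A x) = B (A y)" "x \<in> X" "y \<in> X" using FX by (auto simp: half_perm_def)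
    then show "x = y" using matching_onD[OF matA] matching_onD[OF matB] by metis
  qed
  moreover have "?q ` F \<subseteq> F" using BA by (auto simp: half_perm_def)
  ultimately have "bij_betw ?q F F" using FX(2) by (simp add: bij_betw_def endo_inj_surj)
  then show perm: "?q permutes F" by (rule bij_imp_permutes) (simp add: half_perm_def)
  then have "permutation ?q" using FX(2) permutation_permutes by blast
  have orb: "orbit ?q x = loop_of X A B x \<inter> F" if x: "x \<in> F" for x
  proof -
    have xX: "x \<in> X" using x FX by blast
    have q: "(?q ^^ j) x = ((B \<circ> A) ^^ j) x \<and> ((B \<circ> A) ^^ j) x \<in> F" for j
      by (induction j) (use x BA in \<open>auto simp: half_perm_def\<close>)
    have "orbit ?q x = range (\<lambda>j. ((B \<circ> A) ^^ j) x)"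
      unfolding orbit_altdef_permutation[OF \<open>permutation ?q\<close>] using q by auto
    also have "\<dots> = loop_of X A B x \<inter> F"
      unfolding loop_of_eq[OF xX] using q nA by blast
    finally show ?thesis .
  qed
  have loops: "loops_on X A B = loop_of X A B ` F"
  proof -
    have "loop_of X A B x \<in> loop_of X A B ` F" if x: "x \<in> X" for x
    proof (cases "x \<in> F")
      case False
      then have "A x \<in> F" using x h matching_onD(1)[OF matA] by (auto simp: F_def alternating_def)
      moreover have "loop_of X A B (A x) = loop_of X A B x"
        by (intro loop_of_eqI loop_of_A loop_of_self x)
      ultimately show ?thesis by (metis imageI)
    qed simp
    then show ?thesis using FX unfolding loops_on_def by blast
  qed
  have "orbit ?q ` F = (\<lambda>l. l \<inter> F) ` loops_on X A B"
    unfolding loops image_image using orb by (rule image_cong[OF refl])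
  moreover have "inj_on (\<lambda>l. l \<inter> F) (loops_on X A B)"
  proof (rule inj_onI)
    fix l l' assume l: "l \<in> loops_on X A B" "l' \<in> loops_on X A B" "l \<inter> F = l' \<inter> F"
    then obtain x where "x \<in> F" "l = loop_of X A B x" unfolding loops by blast
    then have "x \<in> l \<inter> l'" using loop_of_self l(3) by blast
    then show "l = l'" using disjoint_loops_on[OF l(1,2)] by blast
  qed
  ultimately have "card (orbit ?q ` F) = card (loops_on X A B)" by (simp add: card_image)
  then show "sign ?q = (-1) ^ (card F + card (loops_on X A B))"
    using sign_eq_card_orbits[OF perm FX(2)] by simp
qed

end

section \<open>Exchanging two points in one of the matchings\<close>

definition conj_swap :: "'a \<Rightarrow> 'a \<Rightarrow> ('a \<Rightarrow> 'a) \<Rightarrow> 'a \<Rightarrow> 'a" where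
  "conj_swap x y A = Transposition.transpose x y \<circ> A \<circ> Transposition.transpose x y"

lemma conj_swap_conj_swap: "conj_swap x y (conj_swap x y A) = A"
  by (simp add: conj_swap_def fun_eq_iff)

lemma transpose_in: "x \<in> X \<Longrightarrow> y \<in> X \<Longrightarrow> z \<in> X \<Longrightarrow> Transposition.transpose x y z \<in> X"
  by (simp add: Transposition.transpose_def)

lemma matching_on_conj_swap:
  assumes "matching_on X A" "x \<in> X" "y \<in> X"
  shows "matching_on X (conj_swap x y A)"
proof -
  have "conj_swap x y A z \<in> X \<and> conj_swap x y A z \<noteq> z \<and> conj_swap x y A (conj_swap x y A z) = z"
    if "z \<in> X" for z
  proof -
    let ?w = "Transposition.transpose x y z"
    have "?w \<in> X" using assms that by (simp add: transpose_in)
    then show ?thesis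
      using matching_onD[OF assms(1), of ?w] assms(2,3)
      by (simp add: conj_swap_def transpose_in) (metis Transposition.transpose_involutory)
  qed
  then show ?thesis by (simp add: matching_on_def)
qed

text \<open>For \<open>x\<close> and \<open>y\<close> of one colour, conjugating \<open>A\<close>
  amounts to a one-sided multiplication of \<open>half_perm\<close> by a transposition, which flips
  its sign.\<close>

lemma loops_parity_swap:
  assumes "two_matchings X A B" "alternating X A h" "alternating X B h"
    and xy: "x \<in> X" "y \<in> X" "x \<noteq> y" "h x = h y"
  shows "(-1::int) ^ card (loops_on X (conj_swap x y A) B) = - ((-1) ^ card (loops_on X A B))"
proof -
  interpret two_matchings X A B by fact
  define F where "F = {z\<in>X. h z = h x}"
  let ?t = "Transposition.transpose x y" and ?A = "conj_swap x y A"
  have t: "h (?t z) = h z" for z using xy(4) by (simp add: Transposition.transpose_def)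
  have tX: "?t z \<in> X" if "z \<in> X" for z using that xy by (simp add: transpose_in)
  interpret S: two_matchings X ?A B
    using fin matB matching_on_conj_swap[OF matA xy(1,2)] by unfold_locales
  have alt: "alternating X ?A h"
    using assms(2) t tX by (simp add: alternating_def conj_swap_def)
  have eq: "half_perm F ?A B = half_perm F A B \<circ> ?t"
  proof
    fix z
    show "half_perm F ?A B z = (half_perm F A B \<circ> ?t) z"
    proof (cases "z \<in> F")
      case True
      then have "?t z \<in> F" using t tX by (simp add: F_def)
      \<comment> \<open>\<open>A (?t z)\<close> has the colour opposite to that of \<open>x\<close>
        and \<open>y\<close>, so the outer transposition of \<open>conj_swap\<close> fixes it and
        only the inner one survives.\<close>
      then have "h (A (?t z)) \<noteq> h x" using assms(2) by (auto simp: F_def alternating_def)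
      then have "A (?t z) \<noteq> x" "A (?t z) \<noteq> y" using xy(4) by auto
      then show ?thesis using True \<open>?t z \<in> F\<close> by (simp add: half_perm_def conj_swap_def)
    next
      case False
      moreover have "x \<in> F" "y \<in> F" using xy by (auto simp: F_def)
      ultimately have "?t z = z" by (metis transpose_apply_other)
      then show ?thesis using False by (simp add: half_perm_def)
    qed
  qed
  have "half_perm F A B permutes F"
    using sign_half_perm(1)[OF assms(2,3), of "h x"] by (simp add: F_def)
  moreover have "finite F" using fin by (simp add: F_def)
  ultimately have "permutation (half_perm F A B)" using permutation_permutes by blast
  then have "sign (half_perm F ?A B) = - sign (half_perm F A B)"
    unfolding eq using xy(3) by (simp add: sign_compose permutation_swap_id sign_swap_id)
  then have "(-1::int) ^ (card F + card (loops_on X ?A B)) = - ((-1) ^ (card F + card (loops_on X A B)))"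
    using sign_half_perm(2)[OF assms(2,3), of "h x"] S.sign_half_perm(2)[OF alt assms(3), of "h x"]
    by (simp add: F_def)
  then have "(-1::int) ^ card F * (-1) ^ card (loops_on X ?A B) =
      (-1) ^ card F * - ((-1) ^ card (loops_on X A B))"
    by (simp add: power_add)
  then show ?thesis by (subst (asm) mult_left_cancel) auto
qed

text \<open>The swap permutes the family and negates every term, so the sum equals its own
  negative.\<close>

lemma sum_loops_parity_zero:
  assumes "finite \<Q>" "\<And>A. A \<in> \<Q> \<Longrightarrow> two_matchings X A B \<and> alternating X A h"
    and "alternating X B h" "x \<in> X" "y \<in> X" "x \<noteq> y" "h x = h y"
    and closed: "\<And>A. A \<in> \<Q> \<Longrightarrow> conj_swap x y A \<in> \<Q>"
  shows "(\<Sum>A\<in>\<Q>. (-1::real) ^ card (loops_on X A B)) = 0"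
proof -
  have "(-1::real) ^ card (loops_on X (conj_swap x y A) B) = - ((-1) ^ card (loops_on X A B))"
    if "A \<in> \<Q>" for A
  proof -
    have "real_of_int ((-1) ^ card (loops_on X (conj_swap x y A) B)) =
        real_of_int (- ((-1) ^ card (loops_on X A B)))"
      using loops_parity_swap[of X A B h x y] assms that by metis
    then show ?thesis by simp
  qed
  then have "(\<Sum>A\<in>\<Q>. (-1::real) ^ card (loops_on X (conj_swap x y A) B)) =
      - (\<Sum>A\<in>\<Q>. (-1::real) ^ card (loops_on X A B))"
    by (simp add: sum_negf)
  moreover have "(\<Sum>A\<in>\<Q>. (-1::real) ^ card (loops_on X (conj_swap x y A) B)) =
      (\<Sum>A\<in>\<Q>. (-1::real) ^ card (loops_on X A B))"
    by (rule sum.reindex_bij_witness[of _ "conj_swap x y" "conj_swap x y"])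
      (use closed in \<open>auto simp: conj_swap_conj_swap\<close>)
  ultimately show ?thesis by simp
qed

section \<open>Signed labellings by half-boxes\<close>

definition pts :: "nat \<Rightarrow> nat set" where
  "pts k = {1..2*k}"

lemma finite_pts [simp]: "finite (pts k)"
  by (simp add: pts_def)

lemma card_pts [simp]: "card (pts k) = 2 * k"
  by (simp add: pts_def)

lemma loops_pts: "loops k A B = loops_on (pts k) A B"
  by (simp add: loops_eq pts_def)

lemma pp_type_pts: "pp_type k A B = loop_type (pts k) A B"
  by (simp add: pp_type_eq pts_def)

lemma pair_partitions_matching: "S \<in> pair_partitions k \<Longrightarrow> matching_on (pts k) S"
  unfolding pair_partitions_def matching_on_def pts_def by blast

lemma pair_partitions_outside: "S \<in> pair_partitions k \<Longrightarrow> x \<notin> pts k \<Longrightarrow> S x = x"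
  unfolding pair_partitions_def pts_def by blast

lemma pair_partitionsI:
  "matching_on (pts k) S \<Longrightarrow> (\<And>x. x \<notin> pts k \<Longrightarrow> S x = x) \<Longrightarrow> S \<in> pair_partitions k"
  unfolding pair_partitions_def matching_on_def pts_def by blast

lemma two_matchings_pts:
  "S \<in> pair_partitions k \<Longrightarrow> S' \<in> pair_partitions k \<Longrightarrow> two_matchings (pts k) S S'"
  by unfold_locales (simp_all add: pair_partitions_matching)

lemma pair_partitions_permutes: "S \<in> pair_partitions k \<Longrightarrow> S permutes (pts k)"
  by (rule bij_imp_permutes[OF matching_on_bij[OF pair_partitions_matching] pair_partitions_outside])

lemma finite_pair_partitions: "finite (pair_partitions k)"
  by (rule finite_subset[OF _ finite_permutations[of "pts k"]])
    (auto intro: pair_partitions_permutes)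

text \<open>A point of \<open>[2k]\<close> is sent to a box, given by its row and column, together with one of the
  two halves of that box.\<close>
type_synonym labelling = "nat \<Rightarrow> (nat \<times> nat) \<times> bool"

definition box_compat :: "nat \<Rightarrow> (nat \<Rightarrow> nat) \<Rightarrow> labelling \<Rightarrow> bool" where
  "box_compat k S g \<longleftrightarrow> (\<forall>x\<in>pts k. fst (g (S x)) = fst (g x) \<and> snd (g (S x)) = (\<not> snd (g x)))"

definition col_compat :: "nat \<Rightarrow> (nat \<Rightarrow> nat) \<Rightarrow> labelling \<Rightarrow> bool" where
  "col_compat k S g \<longleftrightarrow>
     (\<forall>x\<in>pts k. snd (fst (g (S x))) = snd (fst (g x)) \<and> snd (g (S x)) = (\<not> snd (g x)))"

text \<open>Unlike in \<open>col_compat\<close>, sides are left free: alternation is needed only for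
  the two pair-partitions whose loops carry the sign.\<close>

definition row_compat :: "nat \<Rightarrow> (nat \<Rightarrow> nat) \<Rightarrow> labelling \<Rightarrow> bool" where
  "row_compat k S g \<longleftrightarrow> (\<forall>x\<in>pts k. fst (fst (g (S x))) = fst (fst (g x)))"

definition labellings :: "nat \<Rightarrow> (nat \<times> nat) set \<Rightarrow> (nat \<Rightarrow> nat) \<Rightarrow> (nat \<Rightarrow> nat) \<Rightarrow> labelling set" where
  "labellings k D S1 S2 = {g \<in> pts k \<rightarrow>\<^sub>E D \<times> UNIV. col_compat k S1 g \<and> row_compat k S2 g}"

definition box_pairings :: "nat \<Rightarrow> labelling \<Rightarrow> (nat \<Rightarrow> nat) set" where
  "box_pairings k g = {S0 \<in> pair_partitions k. box_compat k S0 g}"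

text \<open>\<open>k + card\<close> has the parity of \<open>k - card\<close> and avoids subtraction
  of natural numbers.\<close>

definition loop_sign :: "nat \<Rightarrow> (nat \<Rightarrow> nat) \<Rightarrow> (nat \<Rightarrow> nat) \<Rightarrow> real" where
  "loop_sign k S S' = (-1) ^ (k + card (loops k S S'))"

definition signed_count :: "nat \<Rightarrow> (nat \<times> nat) set \<Rightarrow> (nat \<Rightarrow> nat) \<Rightarrow> (nat \<Rightarrow> nat) \<Rightarrow> real" where
  "signed_count k D S1 S2 =
     (\<Sum>g\<in>labellings k D S1 S2. \<Sum>S0\<in>box_pairings k g. loop_sign k S0 S1)"

lemma finite_labellings: "finite D \<Longrightarrow> finite (labellings k D S1 S2)"
  unfolding labellings_def by (intro finite_Collect_conjI disjI1) (auto intro!: finite_PiE simp: finite_PiE)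

lemma finite_box_pairings: "finite (box_pairings k g)"
  unfolding box_pairings_def using finite_pair_partitions by simp

lemma conj_swap_pair_partitions:
  assumes "S \<in> pair_partitions k" "x \<in> pts k" "y \<in> pts k"
  shows "conj_swap x y S \<in> pair_partitions k"
proof (rule pair_partitionsI)
  show "matching_on (pts k) (conj_swap x y S)"
    by (rule matching_on_conj_swap[OF pair_partitions_matching[OF assms(1)] assms(2,3)])
  fix z assume z: "z \<notin> pts k"
  then have "z \<noteq> x" "z \<noteq> y" using assms by auto
  then show "conj_swap x y S z = z"
    using pair_partitions_outside[OF assms(1) z] by (simp add: conj_swap_def Transposition.transpose_def)
qed

lemma transpose_invariant: "u x = u y \<Longrightarrow> u (Transposition.transpose x y z) = u z"
  by (simp add: Transposition.transpose_def)

text \<open>The labelling is fixed and \<open>S0\<close> varies: if \<open>g x = g y\<close>, then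
  \<open>g\<close> does not notice the swap of \<open>x\<close> and \<open>y\<close>, and
  \<open>S0\<close> stays compatible with the boxes.\<close>

lemma sum_box_pairings_zero:
  assumes "S1 \<in> pair_partitions k" "col_compat k S1 g" "\<not> inj_on g (pts k)"
  shows "(\<Sum>S0\<in>box_pairings k g. loop_sign k S0 S1) = 0"
proof -
  from assms(3) obtain x y where xy: "x \<in> pts k" "y \<in> pts k" "x \<noteq> y" "g x = g y"
    by (auto simp: inj_on_def)
  have "(\<Sum>S0\<in>box_pairings k g. (-1::real) ^ card (loops_on (pts k) S0 S1)) = 0"
  proof (rule sum_loops_parity_zero[where h = "\<lambda>z. snd (g z)", OF finite_box_pairings])
    show "x \<in> pts k" "y \<in> pts k" "x \<noteq> y" by fact+
    show "snd (g x) = snd (g y)" using xy by simp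
    show "alternating (pts k) S1 (\<lambda>z. snd (g z))"
      using assms(2) by (auto simp: alternating_def col_compat_def)
    fix S0 assume S0: "S0 \<in> box_pairings k g"
    then show "two_matchings (pts k) S0 S1 \<and> alternating (pts k) S0 (\<lambda>z. snd (g z))"
      using assms(1) by (auto simp: box_pairings_def two_matchings_pts alternating_def box_compat_def)
    have gt: "g (Transposition.transpose x y z) = g z" for z
      by (rule transpose_invariant) (rule xy)
    have "box_compat k (conj_swap x y S0) g"
      unfolding box_compat_def
    proof
      fix z assume "z \<in> pts k"
      then have "Transposition.transpose x y z \<in> pts k" using xy by (intro transpose_in)
      then show "fst (g (conj_swap x y S0 z)) = fst (g z) \<and> snd (g (conj_swap x y S0 z)) = (\<not> snd (g z))"
        using S0 gt by (simp add: conj_swap_def box_pairings_def box_compat_def)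
    qed
    then show "conj_swap x y S0 \<in> box_pairings k g"
      using S0 xy conj_swap_pair_partitions by (simp add: box_pairings_def)
  qed
  then have "(\<Sum>S0\<in>box_pairings k g. (-1::real) ^ k * (-1) ^ card (loops_on (pts k) S0 S1)) = 0"
    by (simp only: sum_distrib_left[symmetric] mult_zero_right)
  then show ?thesis by (simp add: loop_sign_def power_add loops_pts)
qed

lemma signed_count_inj:
  assumes "finite D" "S1 \<in> pair_partitions k"
  shows "signed_count k D S1 S2 =
    (\<Sum>g\<in>{g \<in> labellings k D S1 S2. inj_on g (pts k)}. \<Sum>S0\<in>box_pairings k g. loop_sign k S0 S1)"
  unfolding signed_count_def
  by (rule sum.mono_neutral_right)
    (use assms finite_labellings sum_box_pairings_zero in \<open>auto simp: labellings_def\<close>)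

text \<open>The companion cancellation, with \<open>S0\<close> fixed and \<open>S1\<close> varying.
  The two points need to agree only in column and side, and in the value of a further colouring
  \<open>u\<close> that \<open>S1\<close> has to preserve.\<close>

lemma sum_column_pairings_zero:
  fixes g :: labelling
  assumes "S0 \<in> box_pairings k g" "x \<in> pts k" "y \<in> pts k" "x \<noteq> y"
    and "snd (fst (g x)) = snd (fst (g y))" "snd (g x) = snd (g y)" "u x = u y"
  shows "(\<Sum>S1\<in>{S1 \<in> pair_partitions k. col_compat k S1 g \<and> (\<forall>z\<in>pts k. u (S1 z) = u z)}. loop_sign k S0 S1) = 0"
proof -
  let ?Q = "{S1 \<in> pair_partitions k. col_compat k S1 g \<and> (\<forall>z\<in>pts k. u (S1 z) = u z)}"
  have "(\<Sum>S1\<in>?Q. (-1::real) ^ card (loops_on (pts k) S1 S0)) = 0"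
  proof (rule sum_loops_parity_zero[where h = "\<lambda>z. snd (g z)"])
    show "finite ?Q" using finite_pair_partitions by simp
    show "x \<in> pts k" "y \<in> pts k" "x \<noteq> y" "snd (g x) = snd (g y)" by fact+
    show "alternating (pts k) S0 (\<lambda>z. snd (g z))"
      using assms(1) by (auto simp: alternating_def box_pairings_def box_compat_def)
    fix S1 assume S1: "S1 \<in> ?Q"
    then show "two_matchings (pts k) S1 S0 \<and> alternating (pts k) S1 (\<lambda>z. snd (g z))"
      using assms(1) by (auto simp: box_pairings_def two_matchings_pts alternating_def col_compat_def)
    let ?t = "Transposition.transpose x y"
    have t: "snd (fst (g (?t z))) = snd (fst (g z))" "snd (g (?t z)) = snd (g z)" "u (?t z) = u z" for z
      using assms(5,6,7) by (simp_all add: Transposition.transpose_def)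
    have tX: "?t z \<in> pts k" if "z \<in> pts k" for z using assms that by (intro transpose_in)
    have "col_compat k (conj_swap x y S1) g"
      unfolding col_compat_def
    proof
      fix z assume "z \<in> pts k"
      from tX[OF this] show "snd (fst (g (conj_swap x y S1 z))) = snd (fst (g z)) \<and>
          snd (g (conj_swap x y S1 z)) = (\<not> snd (g z))"
        using S1 t by (simp add: conj_swap_def col_compat_def)
    qed
    moreover have "\<forall>z\<in>pts k. u (conj_swap x y S1 z) = u z"
      using S1 t tX by (simp add: conj_swap_def)
    ultimately show "conj_swap x y S1 \<in> ?Q"
      using S1 assms conj_swap_pair_partitions by simp
  qed
  then have "(\<Sum>S1\<in>?Q. (-1::real) ^ k * (-1) ^ card (loops_on (pts k) S1 S0)) = 0"
    by (simp only: sum_distrib_left[symmetric] mult_zero_right)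
  then show ?thesis by (simp add: loop_sign_def power_add loops_pts loops_on_commute[of _ S0])
qed

section \<open>Diagrams and the bound on points of small colour\<close>

definition diagram :: "nat list \<Rightarrow> (nat \<times> nat) set" where
  "diagram la = {(r, c). r < length la \<and> c < la ! r}"

lemma diagram_Sigma: "diagram la = Sigma {..<length la} (\<lambda>r. {..<la ! r})"
  by (auto simp: diagram_def)

lemma finite_diagram: "finite (diagram la)"
  by (simp add: diagram_Sigma)

lemma card_diagram_rows: "card {p \<in> diagram la. fst p < i} = sum_list (take i la)"
proof -
  have "{p \<in> diagram la. fst p < i} = Sigma {..<min i (length la)} (\<lambda>r. {..<la ! r})"
    by (auto simp: diagram_def)
  then have "card {p \<in> diagram la. fst p < i} = (\<Sum>r<min i (length la). la ! r)" by simp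
  also have "\<dots> = sum_list (take i la)"
    by (simp add: sum_list_sum_nth atLeast0LessThan min.commute)
  finally show ?thesis .
qed

lemma card_diagram: "card (diagram la) = sum_list la"
proof -
  have "{p \<in> diagram la. fst p < length la} = diagram la" by (auto simp: diagram_def)
  then show ?thesis using card_diagram_rows[of la "length la"] by simp
qed

text \<open>Among the points of a given column and side, at most \<open>min i (height of the column)\<close> have
  value below \<open>i\<close>; summing over columns counts twice the boxes in the first \<open>i\<close> rows.\<close>
lemma card_less_le_rows:
  fixes g :: labelling and u :: "nat \<Rightarrow> nat"
  assumes la: "sorted_wrt (\<ge>) la"
    and g: "inj_on g (pts k)" "g \<in> pts k \<rightarrow>\<^sub>E diagram la \<times> UNIV"
    and u: "\<And>x y. x \<in> pts k \<Longrightarrow> y \<in> pts k \<Longrightarrow> snd (fst (g x)) = snd (fst (g y)) \<Longrightarrow>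
      snd (g x) = snd (g y) \<Longrightarrow> u x = u y \<Longrightarrow> x = y"
  shows "card {x \<in> pts k. u x < i} \<le> 2 * sum_list (take i la)"
proof -
  let ?S = "{x \<in> pts k. u x < i}"
  let ?f = "\<lambda>x. (snd (fst (g x)), snd (g x))"
  \<comment> \<open>Every column index lies below \<open>sum_list la\<close>, which makes the pairs
    (column, side) a finite index set.\<close>
  let ?T = "{..<sum_list la} \<times> (UNIV :: bool set)"
  have gD: "fst (g x) \<in> diagram la" if "x \<in> pts k" for x
    using PiE_mem[OF g(2) that] by (simp add: mem_Times_iff)
  have cbound: "c < sum_list la" if "(r, c) \<in> diagram la" for r c
    using that elem_le_sum_list[of r la] by (auto simp: diagram_def)
  have fT: "?f ` ?S \<subseteq> ?T"
  proof (rule image_subsetI)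
    fix x assume "x \<in> ?S"
    then have "(fst (fst (g x)), snd (fst (g x))) \<in> diagram la" using gD by simp
    from cbound[OF this] show "?f x \<in> ?T" by simp
  qed
  have fib: "card {x\<in>?S. ?f x = cs} \<le> card {r. r < i \<and> (r, fst cs) \<in> diagram la}" for cs
  proof -
    let ?F = "{x\<in>?S. ?f x = cs}" and ?R = "{r. (r, fst cs) \<in> diagram la}"
    have finF: "finite ?F" by simp
    have "inj_on u ?F" using u by (intro inj_onI) auto
    then have 1: "card ?F \<le> i" using card_inj_on_le[of u ?F "{..<i}"] by auto
    have "inj_on (\<lambda>x. fst (fst (g x))) ?F"
      using g(1) by (intro inj_onI) (auto simp: inj_on_def prod_eq_iff)
    moreover have "(\<lambda>x. fst (fst (g x))) ` ?F \<subseteq> ?R" using gD by auto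
    moreover have finR: "finite ?R"
      by (rule finite_subset[of _ "{..<length la}"]) (auto simp: diagram_def)
    ultimately have 2: "card ?F \<le> card ?R" by (rule card_inj_on_le)
    show ?thesis
    \<comment> \<open>\<open>?R\<close> consists of the rows meeting the column. Either they are all
      among the first \<open>i\<close> rows and their number is the bound, or the column extends
      further, hence meets each of the first \<open>i\<close> rows because \<open>la\<close>
      decreases, and the bound is \<open>i\<close>.\<close>
    proof (cases "?R \<subseteq> {..<i}")
      case True
      then have "?R = {r. r < i \<and> (r, fst cs) \<in> diagram la}" by auto
      then show ?thesis using 2 by simp
    next
      case False
      then obtain r0 where "r0 \<in> ?R" "r0 \<notin> {..<i}" by blast
      then have r0: "i \<le> r0" "(r0, fst cs) \<in> diagram la" by simp_all
      have "(r, fst cs) \<in> diagram la" if "r < i" for r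
      proof -
        have "r < r0" "r0 < length la" "fst cs < la ! r0" using that r0 by (auto simp: diagram_def)
        then show ?thesis using sorted_wrt_nth_less[OF la, of r r0] by (auto simp: diagram_def)
      qed
      then have "{r. r < i \<and> (r, fst cs) \<in> diagram la} = {..<i}" by auto
      then show ?thesis using 1 by simp
    qed
  qed
  have "card ?S = (\<Sum>cs\<in>?T. card {x\<in>?S. ?f x = cs})"
    using sum.group[of ?S ?T ?f "\<lambda>_. 1::nat"] fT by simp
  also have "\<dots> \<le> (\<Sum>cs\<in>?T. card {r. r < i \<and> (r, fst cs) \<in> diagram la})"
    by (rule sum_mono) (rule fib)
  also have "\<dots> = 2 * (\<Sum>c<sum_list la. card {r. r < i \<and> (r, c) \<in> diagram la})"
    by (simp add: sum.cartesian_product' UNIV_bool sum_distrib_left mult_2 sum.distrib)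
  also have "(\<Sum>c<sum_list la. card {r. r < i \<and> (r, c) \<in> diagram la}) = card {p \<in> diagram la. fst p < i}"
  proof -
    let ?P = "{p \<in> diagram la. fst p < i}"
    have "card {p\<in>?P. snd p = c} = card {r. r < i \<and> (r, c) \<in> diagram la}" for c
      by (rule bij_betw_same_card[of fst]) (force intro!: bij_betwI[where g = "\<lambda>r. (r, c)"])
    moreover have "snd ` ?P \<subseteq> {..<sum_list la}" using cbound by auto
    ultimately show ?thesis
      using sum.group[of ?P "{..<sum_list la}" snd "\<lambda>_. 1::nat"] finite_diagram[of la] by simp
  qed
  also have "\<dots> = sum_list (take i la)" by (rule card_diagram_rows)
  finally show ?thesis .
qed

subsection \<open>Conjugation invariance\<close>

definition conj_by :: "('a \<Rightarrow> 'a) \<Rightarrow> ('a \<Rightarrow> 'a) \<Rightarrow> 'a \<Rightarrow> 'a" where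
  "conj_by p S = p \<circ> S \<circ> inv p"

definition relabel :: "nat \<Rightarrow> (nat \<Rightarrow> nat) \<Rightarrow> labelling \<Rightarrow> labelling" where
  "relabel k p g = restrict (g \<circ> inv p) (pts k)"

lemma conj_by_inv: "bij p \<Longrightarrow> conj_by (inv p) (conj_by p S) = S" "bij p \<Longrightarrow> conj_by p (conj_by (inv p) S) = S"
  by (auto simp: conj_by_def fun_eq_iff inv_inv_eq bij_is_inj bij_is_surj surj_f_inv_f)

lemma conj_by_apply: "bij p \<Longrightarrow> conj_by p S (p x) = p (S x)"
  by (simp add: conj_by_def bij_is_inj)

lemma permutes_preimageE:
  assumes "p permutes X" "y \<in> X"
  obtains x where "y = p x" "x \<in> X"
  using that[of "inv p y"] assms permutes_inverses(1)[OF assms(1)] permutes_in_image[OF permutes_inv[OF assms(1)]]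
  by simp

lemma conj_by_pair_partitions:
  assumes "p permutes (pts k)" "S \<in> pair_partitions k"
  shows "conj_by p S \<in> pair_partitions k"
proof (rule pair_partitionsI)
  have bij: "bij p" using assms(1) by (rule permutes_bij)
  have "conj_by p S y \<in> pts k \<and> conj_by p S y \<noteq> y \<and> conj_by p S (conj_by p S y) = y" if yk: "y \<in> pts k" for y
  proof -
    obtain x where x: "y = p x" "x \<in> pts k"
      by (rule permutes_preimageE[OF assms(1) yk])
    note m = matching_onD[OF pair_partitions_matching[OF assms(2)] x(2)]
    have "p (S x) \<noteq> p x" using m(2) bij by (metis bij_is_inj injD)
    then show ?thesis using m permutes_in_image[OF assms(1)] by (simp add: x(1) conj_by_apply[OF bij])
  qed
  then show "matching_on (pts k) (conj_by p S)" by (simp add: matching_on_def)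
  fix y assume y: "y \<notin> pts k"
  then have "inv p y = y" "p y = y" "S y = y"
    using permutes_not_in[OF assms(1)] permutes_not_in[OF permutes_inv[OF assms(1)]]
      pair_partitions_outside[OF assms(2)] by auto
  then show "conj_by p S y = y" by (simp add: conj_by_def)
qed

lemma restrict_in_isos:
  assumes "p permutes X" "matching_on X A" "matching_on X B"
  shows "restrict p X \<in> isos X A B X (conj_by p A) (conj_by p B)"
proof -
  have "bij_betw (restrict p X) X X"
    using permutes_imp_bij[OF assms(1)] by (subst bij_betw_cong[of _ _ p]) auto
  moreover have "restrict p X \<in> X \<rightarrow>\<^sub>E X" using permutes_in_image[OF assms(1)] by auto
  ultimately show ?thesis
    unfolding isos_def using matching_onD(1)[OF assms(2)] matching_onD(1)[OF assms(3)]
    by (auto simp: conj_by_apply[OF permutes_bij[OF assms(1)]])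
qed

lemma loop_type_conj_by:
  assumes "p permutes (pts k)" "A \<in> pair_partitions k" "B \<in> pair_partitions k"
  shows "loop_type (pts k) (conj_by p A) (conj_by p B) = loop_type (pts k) A B"
  by (rule isos_loop_type[OF _ _ restrict_in_isos])
    (use assms in \<open>auto intro: two_matchings_pts conj_by_pair_partitions pair_partitions_matching\<close>)

lemma size_loop_type: "size (loop_type X A B) = card (loops_on X A B)"
  by (simp add: loop_type_def)

lemma loop_sign_conj_by:
  assumes "p permutes (pts k)" "A \<in> pair_partitions k" "B \<in> pair_partitions k"
  shows "loop_sign k (conj_by p A) (conj_by p B) = loop_sign k A B"
  using loop_type_conj_by[OF assms] size_loop_type unfolding loop_sign_def loops_pts by metis

lemma relabel_apply:
  assumes "p permutes (pts k)" "x \<in> pts k"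
  shows "relabel k p g (p x) = g x"
  using assms permutes_in_image[OF assms(1)] permutes_inverses(2)[OF assms(1)] by (simp add: relabel_def)

lemma compat_relabel:
  assumes p: "p permutes (pts k)" and S: "S \<in> pair_partitions k"
  shows "box_compat k S g \<Longrightarrow> box_compat k (conj_by p S) (relabel k p g)"
    and "col_compat k S g \<Longrightarrow> col_compat k (conj_by p S) (relabel k p g)"
    and "row_compat k S g \<Longrightarrow> row_compat k (conj_by p S) (relabel k p g)"
proof -
  have all: "(\<forall>y\<in>pts k. P y) \<longleftrightarrow> (\<forall>x\<in>pts k. P (p x))" for P
    using permutes_in_image[OF p] by (blast elim: permutes_preimageE[OF p])
  note simps = all conj_by_apply[OF permutes_bij[OF p]] relabel_apply[OF p]
    matching_onD(1)[OF pair_partitions_matching[OF S]]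
  show "box_compat k S g \<Longrightarrow> box_compat k (conj_by p S) (relabel k p g)"
    unfolding box_compat_def by (subst all) (simp add: simps(2-))
  show "col_compat k S g \<Longrightarrow> col_compat k (conj_by p S) (relabel k p g)"
    unfolding col_compat_def by (subst all) (simp add: simps(2-))
  show "row_compat k S g \<Longrightarrow> row_compat k (conj_by p S) (relabel k p g)"
    unfolding row_compat_def by (subst all) (simp add: simps(2-))
qed

lemma relabel_labellings:
  assumes p: "p permutes (pts k)" and S: "S1 \<in> pair_partitions k" "S2 \<in> pair_partitions k"
    and g: "g \<in> labellings k D S1 S2"
  shows "relabel k p g \<in> labellings k D (conj_by p S1) (conj_by p S2)"
proof -
  have "relabel k p g \<in> pts k \<rightarrow>\<^sub>E D \<times> UNIV"
  proof (rule PiE_I)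
    have gP: "g \<in> pts k \<rightarrow>\<^sub>E D \<times> UNIV" using g by (simp add: labellings_def)
    fix x assume x: "x \<in> pts k"
    then have "inv p x \<in> pts k" using permutes_in_image[OF permutes_inv[OF p]] by simp
    from PiE_mem[OF gP this] show "relabel k p g x \<in> D \<times> UNIV" using x by (simp add: relabel_def)
  qed (simp add: relabel_def)
  then show ?thesis using g compat_relabel[OF p] S by (simp add: labellings_def)
qed

lemma relabel_inv:
  assumes "p permutes (pts k)" "g \<in> labellings k D S1 S2"
  shows "relabel k (inv p) (relabel k p g) = g"
proof
  fix x
  have g: "g \<in> pts k \<rightarrow>\<^sub>E D \<times> UNIV" using assms(2) by (simp add: labellings_def)
  show "relabel k (inv p) (relabel k p g) x = g x"
  proof (cases "x \<in> pts k")
    case True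
    then show ?thesis
      using relabel_apply[OF assms(1) True] by (simp add: relabel_def[of k "inv p"] permutes_inv_inv[OF assms(1)])
  next
    case False
    then show ?thesis using PiE_arb[OF g] by (simp add: relabel_def)
  qed
qed

text \<open>Transport of structure: a permutation of the points moves labellings and box pairings
  along and preserves the sign.\<close>

lemma signed_count_conj_by:
  assumes D: "finite D" and p: "p permutes (pts k)"
    and S: "S1 \<in> pair_partitions k" "S2 \<in> pair_partitions k"
  shows "signed_count k D (conj_by p S1) (conj_by p S2) = signed_count k D S1 S2"
proof -
  have q: "inv p permutes (pts k)" using p by (rule permutes_inv)
  have bij: "bij p" using p by (rule permutes_bij)
  note C = conj_by_pair_partitions[OF p]
  have canc1: "conj_by (inv p) (conj_by p A) = A" for A using conj_by_inv(1)[OF bij] .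
  have canc2: "conj_by p (conj_by (inv p) A) = A" for A using conj_by_inv(2)[OF bij] .
  have pp: "inv (inv p) = p" using permutes_inv_inv[OF p] .
  show ?thesis
    unfolding signed_count_def
  proof (subst (1 2) sum.Sigma, goal_cases)
    case 5
    show ?case
    proof (rule sum.reindex_bij_witness[where
          i = "\<lambda>(g, S0). (relabel k p g, conj_by p S0)" and
          j = "\<lambda>(g, S0). (relabel k (inv p) g, conj_by (inv p) S0)"], goal_cases)
      case (1 a)
      then show ?case
        using relabel_inv[OF q, of "fst a"] by (auto simp: pp canc2)
    next
      case (2 a)
      then obtain g S0 where a: "a = (g, S0)" "g \<in> labellings k D (conj_by p S1) (conj_by p S2)"
        "S0 \<in> pair_partitions k" "box_compat k S0 g" by (auto simp: box_pairings_def)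
      have "relabel k (inv p) g \<in> labellings k D S1 S2"
        using relabel_labellings[OF q C[OF S(1)] C[OF S(2)] a(2)] by (simp add: canc1)
      then show ?case
        using a compat_relabel(1)[OF q a(3,4)] conj_by_pair_partitions[OF q a(3)] by (simp add: box_pairings_def)
    next
      case (3 b)
      then show ?case
        using relabel_inv[OF p, of "fst b"] by (auto simp: canc1)
    next
      case (4 b)
      then obtain g S0 where a: "b = (g, S0)" "g \<in> labellings k D S1 S2"
        "S0 \<in> pair_partitions k" "box_compat k S0 g" by (auto simp: box_pairings_def)
      then show ?case
        using relabel_labellings[OF p S a(2)] compat_relabel(1)[OF p a(3,4)] C[OF a(3)]
        by (simp add: box_pairings_def)
    next
      case (5 a)
      then obtain g S0 where a: "a = (g, S0)" "S0 \<in> pair_partitions k" by (auto simp: box_pairings_def)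
      have "loop_sign k (conj_by (inv p) S0) S1 = loop_sign k S0 (conj_by p S1)"
        using loop_sign_conj_by[OF p conj_by_pair_partitions[OF q a(2)] S(1)] by (simp add: canc2)
      then show ?case by (simp add: a(1))
    qed
  qed (use finite_labellings[OF D] finite_box_pairings in auto)
qed

text \<open>An isomorphism is undefined outside \<open>[2k]\<close>, a permutation is the identity
  there. Passing from one convention to the other turns isomorphisms into simultaneous
  conjugations.\<close>

lemma isos_conj_byE:
  assumes "\<pi> \<in> isos (pts k) A B (pts k) A' B'"
    and "A \<in> pair_partitions k" "B \<in> pair_partitions k" "A' \<in> pair_partitions k" "B' \<in> pair_partitions k"
  obtains p where "p permutes (pts k)" "restrict p (pts k) = \<pi>" "A' = conj_by p A" "B' = conj_by p B"
proof -
  define p where "p x = (if x \<in> pts k then \<pi> x else x)" for x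
  have \<pi>: "bij_betw \<pi> (pts k) (pts k)" "\<pi> \<in> pts k \<rightarrow>\<^sub>E pts k"
    and com: "\<And>x. x \<in> pts k \<Longrightarrow> \<pi> (A x) = A' (\<pi> x)" "\<And>x. x \<in> pts k \<Longrightarrow> \<pi> (B x) = B' (\<pi> x)"
    using assms(1) by (auto simp: isos_def)
  have "bij_betw p (pts k) (pts k)" using \<pi>(1) by (subst bij_betw_cong[of _ _ \<pi>]) (auto simp: p_def)
  then have p: "p permutes (pts k)" by (rule bij_imp_permutes) (simp add: p_def)
  have r: "restrict p (pts k) = \<pi>"
    using PiE_arb[OF \<pi>(2)] by (auto simp: p_def restrict_def)
  have "S' y = conj_by p S y"
    if "S \<in> pair_partitions k" "S' \<in> pair_partitions k" "\<And>x. x \<in> pts k \<Longrightarrow> \<pi> (S x) = S' (\<pi> x)" for S S' y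
  proof (cases "y \<in> pts k")
    case True
    then obtain x where x: "y = p x" "x \<in> pts k" by (rule permutes_preimageE[OF p])
    then have "p (S x) = S' (p x)"
      using that(3) matching_onD(1)[OF pair_partitions_matching[OF that(1)]] by (simp add: p_def)
    then show ?thesis using x by (simp add: conj_by_apply[OF permutes_bij[OF p]])
  next
    case False
    then show ?thesis
      using pair_partitions_outside[OF that(2)] pair_partitions_outside[OF conj_by_pair_partitions[OF p that(1)]]
      by simp
  qed
  then have "A' = conj_by p A" "B' = conj_by p B" using assms com by (auto simp: fun_eq_iff)
  with p r that show thesis by blast
qed

section \<open>Pairs of pair-partitions up to conjugation\<close>

lemma zmset_pos: "0 \<notin># M \<Longrightarrow> 0 < zmset M"
  unfolding zmset_def by (intro prod_pos) (auto simp: not_in_iff intro: gr0I)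

lemma loop_type_no_zero:
  assumes "two_matchings X A B" shows "0 \<notin># loop_type X A B"
  using two_matchings.card_loop_pos[OF assms] finite_loops_on[OF two_matchings.fin[OF assms]]
  by (force simp: loop_type_def)

text \<open>Pairs of equal type are conjugate: by \<open>card_isos\<close> the number of
  isomorphisms is positive, since no loop has half-length 0.\<close>

lemma signed_count_type:
  assumes "finite D" "A \<in> pair_partitions k" "B \<in> pair_partitions k" "A' \<in> pair_partitions k" "B' \<in> pair_partitions k"
    and type: "loop_type (pts k) A B = loop_type (pts k) A' B'"
  shows "signed_count k D A B = signed_count k D A' B'"
proof -
  have "card (isos (pts k) A B (pts k) A' B') =
      2 ^ size (loop_type (pts k) A B) * zmset (loop_type (pts k) A B)"
    by (rule card_isos) (use assms two_matchings_pts in auto)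
  moreover have "zmset (loop_type (pts k) A B) > 0"
    by (intro zmset_pos loop_type_no_zero two_matchings_pts assms)
  ultimately have "card (isos (pts k) A B (pts k) A' B') > 0" by simp
  then have "isos (pts k) A B (pts k) A' B' \<noteq> {}" by (metis card.empty less_irrefl)
  then obtain \<pi> where \<pi>: "\<pi> \<in> isos (pts k) A B (pts k) A' B'" by blast
  obtain p where "p permutes (pts k)" "A' = conj_by p A" "B' = conj_by p B"
    by (rule isos_conj_byE[OF \<pi> assms(2-5)])
  then show ?thesis using signed_count_conj_by assms by simp
qed

text \<open>Orbit and stabilizer for simultaneous conjugation: the permutations of
  \<open>[2k]\<close> are distributed over the pairs of type \<open>M\<close>, and each fibre is a
  set of isomorphisms.\<close>

lemma card_pairs_of_type:
  assumes "S1 \<in> pair_partitions k" "S2 \<in> pair_partitions k" "loop_type (pts k) S1 S2 = M"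
  shows "card {(A, B). A \<in> pair_partitions k \<and> B \<in> pair_partitions k \<and> loop_type (pts k) A B = M} *
    (2 ^ size M * zmset M) = fact (2 * k)"
proof -
  let ?P = "{(A, B). A \<in> pair_partitions k \<and> B \<in> pair_partitions k \<and> loop_type (pts k) A B = M}"
  let ?f = "\<lambda>p. (conj_by p S1, conj_by p S2)"
  have fP: "finite ?P"
    by (rule finite_subset[of _ "pair_partitions k \<times> pair_partitions k"]) (auto simp: finite_pair_partitions)
  have img: "?f ` {p. p permutes (pts k)} \<subseteq> ?P"
    using assms conj_by_pair_partitions loop_type_conj_by by auto
  have fib: "card {p. p permutes (pts k) \<and> ?f p = y} = 2 ^ size M * zmset M" if "y \<in> ?P" for y
  proof -
    obtain A B where AB: "y = (A, B)" by (cases y)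
    then have y: "y = (A, B)" "A \<in> pair_partitions k" "B \<in> pair_partitions k" "loop_type (pts k) A B = M"
      using that by auto
    have "bij_betw (\<lambda>p. restrict p (pts k)) {p. p permutes (pts k) \<and> ?f p = y} (isos (pts k) S1 S2 (pts k) A B)"
    proof (rule bij_betwI')
      fix p q assume "p \<in> {p. p permutes (pts k) \<and> ?f p = y}" "q \<in> {p. p permutes (pts k) \<and> ?f p = y}"
      then have pq: "p permutes (pts k)" "q permutes (pts k)" by auto
      show "restrict p (pts k) = restrict q (pts k) \<longleftrightarrow> p = q"
      proof
        assume eq: "restrict p (pts k) = restrict q (pts k)"
        show "p = q"
        proof
          fix x show "p x = q x"
            using fun_cong[OF eq, of x] permutes_not_in[OF pq(1), of x] permutes_not_in[OF pq(2), of x]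
            by (cases "x \<in> pts k") auto
        qed
      qed simp
    next
      fix p assume "p \<in> {p. p permutes (pts k) \<and> ?f p = y}"
      then show "restrict p (pts k) \<in> isos (pts k) S1 S2 (pts k) A B"
        using restrict_in_isos[of p "pts k" S1 S2] assms pair_partitions_matching y(1) by auto
    next
      fix \<pi> assume \<pi>: "\<pi> \<in> isos (pts k) S1 S2 (pts k) A B"
      obtain p where "p permutes (pts k)" "restrict p (pts k) = \<pi>" "A = conj_by p S1" "B = conj_by p S2"
        by (rule isos_conj_byE[OF \<pi> assms(1,2) y(2,3)])
      then show "\<exists>p\<in>{p. p permutes (pts k) \<and> ?f p = y}. \<pi> = restrict p (pts k)"
        using y(1) by auto
    qed
    then have "card {p. p permutes (pts k) \<and> ?f p = y} = card (isos (pts k) S1 S2 (pts k) A B)"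
      by (rule bij_betw_same_card)
    then show ?thesis
      using card_isos[of "pts k" S1 S2 "pts k" A B M] assms y two_matchings_pts by simp
  qed
  have "(\<Sum>y\<in>?P. card {p \<in> {p. p permutes (pts k)}. ?f p = y}) = card {p. p permutes (pts k)}"
    using sum.group[of "{p. p permutes (pts k)}" ?P ?f "\<lambda>_. 1::nat"] img fP finite_permutations[of "pts k"] by simp
  moreover have "(\<Sum>y\<in>?P. card {p \<in> {p. p permutes (pts k)}. ?f p = y}) = card ?P * (2 ^ size M * zmset M)"
    using fib by simp
  moreover have "card {p. p permutes (pts k)} = fact (2 * k)"
    by (rule card_permutations) auto
  ultimately show ?thesis by simp
qed

subsection \<open>Adjoining a common pair\<close>

definition extend :: "nat \<Rightarrow> (nat \<Rightarrow> nat) \<Rightarrow> nat \<Rightarrow> nat" where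
  "extend k S = S(2*k+1 := 2*k+2, 2*k+2 := 2*k+1)"

definition unextend :: "nat \<Rightarrow> (nat \<Rightarrow> nat) \<Rightarrow> nat \<Rightarrow> nat" where
  "unextend k S x = (if x \<in> pts k then S x else x)"

lemma pts_Suc: "pts (Suc k) = insert (2*k+1) (insert (2*k+2) (pts k))"
  by (auto simp: pts_def)

lemma new_pts: "2*k+1 \<notin> pts k" "2*k+2 \<notin> pts k"
  by (auto simp: pts_def)

lemma extend_simps:
  "extend k S (2*k+1) = 2*k+2" "extend k S (2*k+2) = 2*k+1"
  "x \<in> pts k \<Longrightarrow> extend k S x = S x"
  using new_pts[of k] by (auto simp: extend_def)

lemma extend_pair_partitions:
  assumes "S \<in> pair_partitions k"
  shows "extend k S \<in> pair_partitions (Suc k)"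
proof (rule pair_partitionsI)
  have "extend k S x \<in> pts (Suc k) \<and> extend k S x \<noteq> x \<and> extend k S (extend k S x) = x" if x: "x \<in> pts (Suc k)" for x
  proof -
    consider "x = 2*k+1" | "x = 2*k+2" | "x \<in> pts k" using x unfolding pts_Suc by blast
    then show ?thesis
    proof cases
      case 3
      with matching_onD[OF pair_partitions_matching[OF assms], of x] show ?thesis
        by (simp add: extend_simps(3) pts_Suc)
    qed (simp_all only: extend_simps, auto simp: pts_Suc)
  qed
  then show "matching_on (pts (Suc k)) (extend k S)" by (simp add: matching_on_def)
  fix x assume "x \<notin> pts (Suc k)"
  then show "extend k S x = x"
    using pair_partitions_outside[OF assms, of x] by (auto simp: extend_def pts_Suc)
qed

lemma loop_rel_cong: "(\<And>x. x \<in> X \<Longrightarrow> A x = A' x) \<Longrightarrow> (\<And>x. x \<in> X \<Longrightarrow> B x = B' x) \<Longrightarrow> loop_rel X A B = loop_rel X A' B'"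
  unfolding loop_rel_def by auto

lemma loop_extend:
  assumes "A \<in> pair_partitions k" "B \<in> pair_partitions k"
  shows "loop_of (pts (Suc k)) (extend k A) (extend k B) (2*k+1) = {2*k+1, 2*k+2}" (is "?L = _")
    and "pts (Suc k) - {2*k+1, 2*k+2} = pts k"
proof -
  interpret E: two_matchings "pts (Suc k)" "extend k A" "extend k B"
    by (intro two_matchings_pts extend_pair_partitions assms)
  have a: "2*k+1 \<in> pts (Suc k)" by (simp add: pts_Suc)
  show "?L = {2*k+1, 2*k+2}"
  proof
    show "?L \<subseteq> {2*k+1, 2*k+2}"
    proof
      fix y assume "y \<in> ?L"
      with a show "y \<in> {2*k+1, 2*k+2}"
        by (induction rule: E.loop_of_induct) (auto simp: extend_def)
    qed
    show "{2*k+1, 2*k+2} \<subseteq> ?L"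
      using E.loop_of_self[of "2*k+1"] E.loop_of_A[OF a E.loop_of_self] by (simp add: extend_def)
  qed
  show "pts (Suc k) - {2*k+1, 2*k+2} = pts k" using new_pts[of k] by (auto simp: pts_Suc)
qed

lemma loops_extend:
  assumes "A \<in> pair_partitions k" "B \<in> pair_partitions k"
  shows "loop_type (pts (Suc k)) (extend k A) (extend k B) = add_mset 1 (loop_type (pts k) A B)"
proof -
  interpret E: two_matchings "pts (Suc k)" "extend k A" "extend k B"
    by (intro two_matchings_pts extend_pair_partitions assms)
  have a: "2*k+1 \<in> pts (Suc k)" by (simp add: pts_Suc)
  have "loop_type (pts (Suc k)) (extend k A) (extend k B) =
      add_mset 1 (loop_type (pts k) (extend k A) (extend k B))"
    using E.loop_type_Diff[OF a] unfolding loop_extend[OF assms] by simp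
  moreover have "loop_rel (pts k) (extend k A) (extend k B) = loop_rel (pts k) A B"
    by (rule loop_rel_cong) (simp_all add: extend_simps)
  ultimately show ?thesis by (simp add: loop_type_def loops_on_def loop_of_def)
qed

text \<open>The number of pairs and the number of loops both grow by one.\<close>

lemma loop_sign_extend:
  assumes "A \<in> pair_partitions k" "B \<in> pair_partitions k"
  shows "loop_sign (Suc k) (extend k A) (extend k B) = loop_sign k A B"
proof -
  have "card (loops (Suc k) (extend k A) (extend k B)) = Suc (card (loops k A B))"
    unfolding loops_pts size_loop_type[symmetric] loops_extend[OF assms] by simp
  then show ?thesis by (simp add: loop_sign_def)
qed

text \<open>\<open>S0\<close> joins the two halves of a box, so an occupied half comes with the
  other one; \<open>2 * k\<close> distinct half-boxes then make \<open>k\<close> full boxes.\<close>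

lemma labelling_image_full:
  assumes "inj_on g (pts k)" "S0 \<in> box_pairings k g"
  shows "card ((fst \<circ> g) ` pts k) = k"
proof -
  let ?F = "(fst \<circ> g) ` pts k"
  have "g ` pts k = ?F \<times> UNIV"
  proof
    show "g ` pts k \<subseteq> ?F \<times> UNIV" by (rule image_subsetI) (simp add: mem_Times_iff)
    show "?F \<times> UNIV \<subseteq> g ` pts k"
    proof
      fix z assume "z \<in> ?F \<times> (UNIV :: bool set)"
      then obtain x where x: "x \<in> pts k" "fst z = fst (g x)" by auto
      show "z \<in> g ` pts k"
      proof (cases "snd z = snd (g x)")
        case True
        then have "z = g x" using x by (simp add: prod_eq_iff)
        then show ?thesis using x by blast
      next
        case False
        then have "z = g (S0 x)"
          using x assms(2) by (simp add: prod_eq_iff box_pairings_def box_compat_def)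
        moreover have "S0 x \<in> pts k"
          using assms(2) x matching_onD(1)[OF pair_partitions_matching] by (simp add: box_pairings_def)
        ultimately show ?thesis by blast
      qed
    qed
  qed
  then have "2 * k = card ?F * 2"
    using card_image[OF assms(1)] by (simp add: card_cartesian_product UNIV_bool)
  then show ?thesis by simp
qed

text \<open>An injective labelling would need \<open>2 * k\<close> half-boxes.\<close>

lemma signed_count_large:
  assumes "finite D" "S1 \<in> pair_partitions k" "card D < k"
  shows "signed_count k D S1 S2 = 0"
proof -
  have "\<not> inj_on g (pts k)" if "g \<in> labellings k D S1 S2" for g
  proof
    assume "inj_on g (pts k)"
    moreover have gP: "g \<in> pts k \<rightarrow>\<^sub>E D \<times> UNIV" using that by (simp add: labellings_def)
    have "g ` pts k \<subseteq> D \<times> UNIV" by (rule image_subsetI) (rule PiE_mem[OF gP])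
    moreover note this
    ultimately have "card (pts k) \<le> card (D \<times> (UNIV :: bool set))"
      using assms(1) by (intro card_inj_on_le[of g]) auto
    then show False using assms(3) by (simp add: card_cartesian_product UNIV_bool)
  qed
  then have none: "{g \<in> labellings k D S1 S2. inj_on g (pts k)} = {}" by blast
  show ?thesis unfolding signed_count_inj[OF assms(1,2)] none by simp
qed

lemma signed_count_0:
  assumes "S1 \<in> pair_partitions 0" "S2 \<in> pair_partitions 0"
  shows "signed_count 0 D S1 S2 = 1"
proof -
  have pts: "pts 0 = {}" by (simp add: pts_def)
  have "labellings 0 D S1 S2 = {\<lambda>_. undefined}"
    by (auto simp: labellings_def pts col_compat_def row_compat_def)
  moreover have "pair_partitions 0 = {id}" by (auto simp: pair_partitions_def fun_eq_iff)
  then have "box_pairings 0 g = {id}" for g by (auto simp: box_pairings_def box_compat_def pts)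
  ultimately show ?thesis
    by (simp add: signed_count_def loop_sign_def loops_pts pts loops_on_def)
qed

context
  fixes k :: nat and D :: "(nat \<times> nat) set" and S1 S2 :: "nat \<Rightarrow> nat"
  assumes D: "finite D" and S1: "S1 \<in> pair_partitions k" and S2: "S2 \<in> pair_partitions k"
begin

private definition extend_labelling :: "labelling \<Rightarrow> (nat \<times> nat) \<times> bool \<Rightarrow> labelling" where
  "extend_labelling g b = g(2*k+1 := b, 2*k+2 := (fst b, \<not> snd b))"

private lemma extend_labelling_simps:
  "extend_labelling g b (2*k+1) = b" "extend_labelling g b (2*k+2) = (fst b, \<not> snd b)"
  "x \<in> pts k \<Longrightarrow> extend_labelling g b x = g x"
  using new_pts[of k] by (auto simp: extend_labelling_def)

private lemma all_pts_Suc: "(\<forall>x\<in>pts (Suc k). P x) \<longleftrightarrow> P (2*k+1) \<and> P (2*k+2) \<and> (\<forall>x\<in>pts k. P x)"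
  unfolding pts_Suc by blast

private lemma extend_labelling_in:
  assumes g: "g \<in> labellings k D S1 S2" "inj_on g (pts k)" and S0: "S0 \<in> box_pairings k g"
    and b: "fst b \<in> D - (fst \<circ> g) ` pts k"
  shows "extend_labelling g b \<in> labellings (Suc k) D (extend k S1) (extend k S2)"
    and "inj_on (extend_labelling g b) (pts (Suc k))"
    and "extend k S0 \<in> box_pairings (Suc k) (extend_labelling g b)"
proof -
  let ?g = "extend_labelling g b"
  have gP: "g \<in> pts k \<rightarrow>\<^sub>E D \<times> UNIV" using g by (simp add: labellings_def)
  have b': "fst b \<in> D" "\<And>x. x \<in> pts k \<Longrightarrow> fst (g x) \<noteq> fst b"
    using b by (simp_all add: image_iff) metis
  have S0P: "S0 \<in> pair_partitions k" using S0 by (simp add: box_pairings_def)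
  note m = matching_onD(1)[OF pair_partitions_matching[OF S1]]
    matching_onD(1)[OF pair_partitions_matching[OF S2]] matching_onD(1)[OF pair_partitions_matching[OF S0P]]
  have "?g \<in> pts (Suc k) \<rightarrow>\<^sub>E D \<times> UNIV"
  proof (rule PiE_I)
    fix x assume "x \<in> pts (Suc k)"
    then consider "x = 2*k+1" | "x = 2*k+2" | "x \<in> pts k" unfolding pts_Suc by blast
    then show "?g x \<in> D \<times> UNIV"
    proof cases
      case 3 then show ?thesis using PiE_mem[OF gP 3] by (simp only: extend_labelling_simps)
    qed (simp_all only: extend_labelling_simps, simp_all add: b' mem_Times_iff)
  next
    fix x assume "x \<notin> pts (Suc k)"
    then show "?g x = undefined" using PiE_arb[OF gP] by (auto simp: extend_labelling_def pts_Suc)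
  qed
  moreover have "col_compat (Suc k) (extend k S1) ?g"
    using g(1) m unfolding labellings_def col_compat_def all_pts_Suc
    by (simp del: One_nat_def add_2_eq_Suc' Suc_eq_plus1[symmetric] add: extend_simps extend_labelling_simps)
  moreover have "row_compat (Suc k) (extend k S2) ?g"
    using g(1) m unfolding labellings_def row_compat_def all_pts_Suc
    by (simp del: One_nat_def add_2_eq_Suc' add: extend_simps extend_labelling_simps)
  ultimately show "?g \<in> labellings (Suc k) D (extend k S1) (extend k S2)" by (simp add: labellings_def)
  have "box_compat (Suc k) (extend k S0) ?g"
    using S0 m unfolding box_pairings_def box_compat_def all_pts_Suc
    by (simp del: One_nat_def add_2_eq_Suc' add: extend_simps extend_labelling_simps)
  then show "extend k S0 \<in> box_pairings (Suc k) ?g"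
    using extend_pair_partitions[OF S0P] by (simp add: box_pairings_def)
  have "inj_on ?g (pts k)" using g(2) extend_labelling_simps(3) by (metis (no_types, lifting) inj_on_cong)
  moreover have "b \<notin> ?g ` pts k" "(fst b, \<not> snd b) \<notin> ?g ` pts k"
  proof -
    have "fst (?g x) \<noteq> fst b" if "x \<in> pts k" for x using b'(2) that by (simp add: extend_labelling_simps(3))
    then show "b \<notin> ?g ` pts k" "(fst b, \<not> snd b) \<notin> ?g ` pts k" by (metis fst_conv imageE)+
  qed
  moreover have "b \<noteq> (fst b, \<not> snd b)" by (cases b) auto
  ultimately show "inj_on ?g (pts (Suc k))"
    unfolding pts_Suc inj_on_insert using new_pts[of k]
    by (simp del: One_nat_def add_2_eq_Suc' add: extend_labelling_simps)
qed

text \<open>A pair common to \<open>S1\<close> and \<open>S2\<close> lies in one column and one row,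
  on opposite sides, hence fills one box. Injectivity forces \<open>S0\<close> to contain the same
  pair and keeps all other points out of that box, so the pair can be removed from
  everything.\<close>

private lemma restrict_labelling_in:
  assumes g: "g \<in> labellings (Suc k) D (extend k S1) (extend k S2)" "inj_on g (pts (Suc k))"
    and S0: "S0 \<in> box_pairings (Suc k) g"
  shows "restrict g (pts k) \<in> labellings k D S1 S2" "inj_on (restrict g (pts k)) (pts k)"
    and "unextend k S0 \<in> box_pairings k (restrict g (pts k))"
    and "fst (g (2*k+1)) \<in> D - (fst \<circ> restrict g (pts k)) ` pts k"
    and "extend_labelling (restrict g (pts k)) (g (2*k+1)) = g"
    and "extend k (unextend k S0) = S0"
proof -
  let ?a = "2*k+1" and ?b = "2*k+2" and ?g = "restrict g (pts k)"
  have gP: "g \<in> pts (Suc k) \<rightarrow>\<^sub>E D \<times> UNIV" using g by (simp add: labellings_def)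
  have S0P: "S0 \<in> pair_partitions (Suc k)" using S0 by (simp add: box_pairings_def)
  note m0 = matching_onD[OF pair_partitions_matching[OF S0P]]
  note m1 = matching_onD(1)[OF pair_partitions_matching[OF S1]]
    matching_onD(1)[OF pair_partitions_matching[OF S2]]
  have ab: "?a \<in> pts (Suc k)" "?b \<in> pts (Suc k)" and sub: "\<And>x. x \<in> pts k \<Longrightarrow> x \<in> pts (Suc k)"
    unfolding pts_Suc by blast+
  have box: "fst (g (S0 x)) = fst (g x)" "snd (g (S0 x)) = (\<not> snd (g x))" if "x \<in> pts (Suc k)" for x
    using S0 that by (auto simp: box_pairings_def box_compat_def)
  have col: "snd (fst (g (extend k S1 x))) = snd (fst (g x))" "snd (g (extend k S1 x)) = (\<not> snd (g x))"
    if "x \<in> pts (Suc k)" for x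
    using g(1) that by (auto simp: labellings_def col_compat_def)
  have row: "fst (fst (g (extend k S2 x))) = fst (fst (g x))" if "x \<in> pts (Suc k)" for x
    using g(1) that by (auto simp: labellings_def row_compat_def)
  have gb: "fst (g ?b) = fst (g ?a)" "snd (g ?b) = (\<not> snd (g ?a))"
    using col[OF ab(1)] row[OF ab(1)] unfolding extend_simps by (auto simp: prod_eq_iff)
  have "g (S0 ?a) = g ?b" using box[OF ab(1)] gb by (simp only: prod_eq_iff simp_thms)
  then have S0a: "S0 ?a = ?b" using inj_onD[OF g(2)] m0(1)[OF ab(1)] ab(2) by blast
  then have S0b: "S0 ?b = ?a" using m0(3)[OF ab(1)] by simp
  have S0k: "S0 x \<in> pts k" if x: "x \<in> pts k" for x
  proof -
    have "S0 x \<noteq> ?a" "S0 x \<noteq> ?b"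
      using m0(3)[OF sub[OF x]] S0a S0b x new_pts[of k] by metis+
    then show ?thesis using m0(1)[OF sub[OF x]] unfolding pts_Suc by blast
  qed
  have "?g \<in> pts k \<rightarrow>\<^sub>E D \<times> UNIV"
    using PiE_mem[OF gP sub] by (intro PiE_I) (simp_all only: restrict_apply if_True if_False)
  moreover have "col_compat k S1 ?g"
    using col[OF sub] m1 unfolding col_compat_def by (simp add: extend_simps(3))
  moreover have "row_compat k S2 ?g"
    using row[OF sub] m1 unfolding row_compat_def by (simp add: extend_simps(3))
  ultimately show "?g \<in> labellings k D S1 S2" by (simp add: labellings_def)
  show "inj_on ?g (pts k)"
    using inj_on_subset[OF g(2), of "pts k"] sub by (auto simp: inj_on_def)
  have "unextend k S0 \<in> pair_partitions k"
    by (rule pair_partitionsI) (use S0k m0(2,3)[OF sub] in \<open>auto simp: matching_on_def unextend_def\<close>)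
  moreover have "box_compat k (unextend k S0) ?g"
    using box[OF sub] S0k by (simp add: box_compat_def unextend_def)
  ultimately show "unextend k S0 \<in> box_pairings k ?g" by (simp add: box_pairings_def)
  have ne: "fst (g x) \<noteq> fst (g ?a)" if x: "x \<in> pts k" for x
  proof
    assume eq: "fst (g x) = fst (g ?a)"
    have "g x = g ?a \<or> g x = g ?b" using eq gb by (auto simp: prod_eq_iff)
    then have "x = ?a \<or> x = ?b" using inj_onD[OF g(2)] ab sub[OF x] by blast
    then show False using x new_pts[of k] by blast
  qed
  have "fst (g ?a) \<in> D" using PiE_mem[OF gP ab(1)] by (simp only: mem_Times_iff)
  moreover have "fst (g ?a) \<notin> (fst \<circ> ?g) ` pts k"
  proof
    assume "fst (g ?a) \<in> (fst \<circ> ?g) ` pts k"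
    then obtain x where "x \<in> pts k" "fst (g ?a) = (fst \<circ> ?g) x" by blast
    then show False using ne[of x] by simp
  qed
  ultimately show "fst (g ?a) \<in> D - (fst \<circ> ?g) ` pts k" by blast
  show "extend_labelling ?g (g ?a) = g"
  proof
    fix x
    consider "x = ?a" | "x = ?b" | "x \<in> pts k" | "x \<notin> pts (Suc k)" unfolding pts_Suc by blast
    then show "extend_labelling ?g (g ?a) x = g x"
    proof cases
      case 1 then show ?thesis by (simp only: extend_labelling_simps)
    next
      case 2 then show ?thesis using gb by (simp only: extend_labelling_simps prod_eq_iff fst_conv snd_conv simp_thms)
    next
      case 3 then show ?thesis by (simp only: extend_labelling_simps restrict_apply if_True)
    next
      case 4
      then have "x \<notin> pts k" "x \<noteq> ?a" "x \<noteq> ?b" unfolding pts_Suc by blast+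
      then show ?thesis using PiE_arb[OF gP 4] by (simp add: extend_labelling_def)
    qed
  qed
  show "extend k (unextend k S0) = S0"
  proof
    fix x
    consider "x = ?a" | "x = ?b" | "x \<in> pts k" | "x \<notin> pts (Suc k)" unfolding pts_Suc by blast
    then show "extend k (unextend k S0) x = S0 x"
    proof cases
      case 1 then show ?thesis by (simp only: extend_simps S0a)
    next
      case 2 then show ?thesis by (simp only: extend_simps S0b)
    next
      case 3 then show ?thesis by (simp add: extend_simps(3) unextend_def)
    next
      case 4
      then have "x \<notin> pts k" "x \<noteq> ?a" "x \<noteq> ?b" unfolding pts_Suc by blast+
      then show ?thesis using pair_partitions_outside[OF S0P 4] by (simp add: extend_def unextend_def)
    qed
  qed
qed

private lemma unextend_extend: "S0 \<in> pair_partitions k \<Longrightarrow> unextend k (extend k S0) = S0"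
  using pair_partitions_outside[of S0 k] by (auto simp: unextend_def extend_simps(3) fun_eq_iff)

private lemma restrict_extend_labelling:
  "g \<in> labellings k D S1 S2 \<Longrightarrow> restrict (extend_labelling g b) (pts k) = g"
  using PiE_arb[of g "pts k" "\<lambda>_. D \<times> UNIV"]
  by (auto simp: labellings_def restrict_def extend_labelling_simps(3) fun_eq_iff)

text \<open>The new pair goes into any of the \<open>card D - k\<close> free boxes, in one of two
  orientations, and the sign does not depend on this choice.\<close>

lemma signed_count_extend:
  "signed_count (Suc k) D (extend k S1) (extend k S2) =
    2 * (real (card D) - real k) * signed_count k D S1 S2"
proof -
  let ?G = "{g \<in> labellings k D S1 S2. inj_on g (pts k)}"
  let ?G' = "{g \<in> labellings (Suc k) D (extend k S1) (extend k S2). inj_on g (pts (Suc k))}"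
  let ?B = "\<lambda>g::labelling. (D - (fst \<circ> g) ` pts k) \<times> (UNIV :: bool set)"
  \<comment> \<open>\<open>S0\<close> serves as a witness that \<open>g\<close> fills whole boxes,
    so that it uses exactly \<open>k\<close> of them.\<close>
  have card: "real (card (?B g)) = 2 * (real (card D) - real k)"
    if "g \<in> ?G" "S0 \<in> box_pairings k g" for g S0
  proof -
    have gP: "g \<in> pts k \<rightarrow>\<^sub>E D \<times> UNIV" using that by (simp add: labellings_def)
    have "(fst \<circ> g) ` pts k \<subseteq> D"
    proof (rule image_subsetI)
      fix x assume "x \<in> pts k"
      from PiE_mem[OF gP this] show "(fst \<circ> g) x \<in> D" by (simp add: mem_Times_iff)
    qed
    moreover have "card ((fst \<circ> g) ` pts k) = k" using labelling_image_full that by blast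
    ultimately have "card (D - (fst \<circ> g) ` pts k) = card D - k" "k \<le> card D"
      using D card_mono[OF D, of "(fst \<circ> g) ` pts k"] card_Diff_subset[of "(fst \<circ> g) ` pts k" D] by simp_all
    then show ?thesis by (simp add: card_cartesian_product UNIV_bool of_nat_diff)
  qed
  have fin: "finite ?G" "finite ?G'" using finite_labellings[OF D] by auto
  have "signed_count (Suc k) D (extend k S1) (extend k S2) =
      (\<Sum>(g, S0)\<in>Sigma ?G' (box_pairings (Suc k)). loop_sign (Suc k) S0 (extend k S1))"
    unfolding signed_count_inj[OF D extend_pair_partitions[OF S1]]
    by (rule sum.Sigma) (use fin finite_box_pairings in auto)
  also have "\<dots> = (\<Sum>((g, S0), b)\<in>Sigma (Sigma ?G (box_pairings k)) (\<lambda>(g, S0). ?B g). loop_sign k S0 S1)"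
  proof (rule sum.reindex_bij_witness[where
        i = "\<lambda>((g, S0), b). (extend_labelling g b, extend k S0)" and
        j = "\<lambda>(g, S0). ((restrict g (pts k), unextend k S0), g (2*k+1))"], goal_cases)
    case (1 a)
    then show ?case using restrict_labelling_in(5,6) by auto
  next
    case (2 a)
    then obtain g S0 where a: "a = (g, S0)" "g \<in> ?G'" "S0 \<in> box_pairings (Suc k) g" by auto
    then show ?case using restrict_labelling_in(1-4)[of g S0] by (simp add: mem_Times_iff)
  next
    case (3 b)
    then show ?case
      by (auto simp: restrict_extend_labelling unextend_extend box_pairings_def extend_labelling_simps(1)[simplified])
  next
    case (4 b)
    then obtain g S0 c where a: "b = ((g, S0), c)" "g \<in> ?G" "S0 \<in> box_pairings k g" "fst c \<in> D - (fst \<circ> g) ` pts k"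
      by (auto simp: mem_Times_iff)
    then show ?case using extend_labelling_in[of g S0 c] by simp
  next
    case (5 a)
    then obtain g S0 where a: "a = (g, S0)" "g \<in> ?G'" "S0 \<in> box_pairings (Suc k) g" by auto
    then have "unextend k S0 \<in> pair_partitions k" "extend k (unextend k S0) = S0"
      using restrict_labelling_in(3,6)[of g S0] by (auto simp: box_pairings_def)
    then show ?case using loop_sign_extend[OF _ S1, of "unextend k S0"] a(1) by simp
  qed
  also have "\<dots> = (\<Sum>(g, S0)\<in>Sigma ?G (box_pairings k). \<Sum>b\<in>?B g. loop_sign k S0 S1)"
    using D fin finite_box_pairings by (subst sum.Sigma[symmetric]) (auto simp: case_prod_unfold)
  also have "\<dots> = (\<Sum>(g, S0)\<in>Sigma ?G (box_pairings k). 2 * (real (card D) - real k) * loop_sign k S0 S1)"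
    using card by (intro sum.cong) auto
  also have "\<dots> = 2 * (real (card D) - real k) * (\<Sum>(g, S0)\<in>Sigma ?G (box_pairings k). loop_sign k S0 S1)"
    by (simp add: sum_distrib_left case_prod_unfold)
  also have "(\<Sum>(g, S0)\<in>Sigma ?G (box_pairings k). loop_sign k S0 S1) = signed_count k D S1 S2"
    unfolding signed_count_inj[OF D S1]
    by (rule sum.Sigma[symmetric]) (use fin finite_box_pairings in auto)
  finally show ?thesis .
qed

end

section \<open>Partitions and the characterization of Jack polynomials\<close>

lemma partitionsD:
  assumes "rho \<in> partitions n"
  shows "sorted_wrt (\<ge>) rho" "\<And>x. x \<in> set rho \<Longrightarrow> 0 < x" "sum_list rho = n"
  using assms by (auto simp: partitions_def)

lemma length_le_sum_list: "(\<And>x. x \<in> set xs \<Longrightarrow> 0 < x) \<Longrightarrow> length xs \<le> sum_list (xs :: nat list)"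
  by (induction xs) (auto simp: Suc_le_eq intro: add_le_mono[of 1, simplified] order.trans)

lemma finite_partitions: "finite (partitions n)"
proof (rule finite_subset)
  show "partitions n \<subseteq> {xs. set xs \<subseteq> {..n} \<and> length xs \<le> n}"
  proof
    fix xs assume xs: "xs \<in> partitions n"
    then have "length xs \<le> n" using length_le_sum_list[of xs] partitionsD[OF xs] by simp
    moreover have "x \<le> n" if "x \<in> set xs" for x
      using member_le_sum_list[OF that] partitionsD(3)[OF xs] by simp
    ultimately show "xs \<in> {xs. set xs \<subseteq> {..n} \<and> length xs \<le> n}" by auto
  qed
  show "finite {xs. set xs \<subseteq> {..n} \<and> length xs \<le> n}" by (rule finite_lists_length_le) simp
qed

lemma sorted_desc_eq_if_mset_eq:
  fixes xs ys :: "nat list"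
  assumes "sorted_wrt (\<ge>) xs" "sorted_wrt (\<ge>) ys" "mset xs = mset ys"
  shows "xs = ys"
proof -
  have "sorted (rev xs)" "sorted (rev ys)" using assms by (simp_all add: sorted_wrt_rev)
  then have "rev xs = rev ys" using assms(3) by (metis mset_rev properties_for_sort)
  then show ?thesis by simp
qed

lemma dominated_refl: "dominated la la"
  by (simp add: dominated_def)

lemma dominated_trans: "dominated la mu \<Longrightarrow> dominated mu nu \<Longrightarrow> dominated la nu"
  unfolding dominated_def by (metis order.trans)

text \<open>Equal partial sums give equal parts. Padding with zeros extends the comparison past the
  end of a list, and positivity of the parts then recovers the lengths.\<close>

lemma dominated_antisym:
  assumes "la \<in> partitions n" "mu \<in> partitions n" "dominated la mu" "dominated mu la"
  shows "la = mu"
proof -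
  define f where "f xs i = (if i < length xs then xs ! i else 0)" for xs :: "nat list" and i
  have f: "f xs i = sum_list (take (Suc i) xs) - sum_list (take i xs)" for xs i
    by (simp add: f_def take_Suc_conv_app_nth)
  have "sum_list (take i la) = sum_list (take i mu)" for i
    using assms(3,4) by (simp add: dominated_def order.antisym)
  then have eq: "f la i = f mu i" for i by (simp add: f)
  have pos: "0 < f xs i \<longleftrightarrow> i < length xs" if "xs \<in> partitions n" for xs i
    using partitionsD(2)[OF that] by (auto simp: f_def)
  have "i < length la \<longleftrightarrow> i < length mu" for i using pos[OF assms(1)] pos[OF assms(2)] eq by metis
  then have len: "length la = length mu" by (metis linorder_neqE_nat less_irrefl)
  then show ?thesis
    using eq by (intro nth_equalityI) (auto simp: f_def, metis)
qed

section \<open>Power sums expanded in monomials\<close>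

lemma finite_mono_coeff_set:
  "finite {f \<in> {..<length rho} \<rightarrow>\<^sub>E {..<length nu}.
      \<forall>i<length nu. (\<Sum>j\<in>{j. j < length rho \<and> f j = i}. rho ! j) = nu ! i}"
  by (rule finite_subset[of _ "{..<length rho} \<rightarrow>\<^sub>E {..<length nu}"]) (auto intro: finite_PiE)

text \<open>A monomial of a product of power sums arises by merging parts of \<open>rho\<close>, and
  every part of \<open>nu\<close>, being positive, receives at least one of them. For equal lengths
  nothing is merged, and two sorted lists with the same entries coincide.\<close>

lemma mono_coeff_nonzero:
  assumes rho: "rho \<in> partitions n" and nu: "nu \<in> partitions n" and "mono_coeff rho nu \<noteq> 0"
  shows "length nu \<le> length rho" and "length nu = length rho \<Longrightarrow> rho = nu"
proof -
  obtain f where f: "f \<in> {..<length rho} \<rightarrow>\<^sub>E {..<length nu}"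
    and sums: "\<And>i. i < length nu \<Longrightarrow> (\<Sum>j\<in>{j. j < length rho \<and> f j = i}. rho ! j) = nu ! i"
    using assms(3) finite_mono_coeff_set[of rho nu] unfolding mono_coeff_def by (auto simp: card_eq_0_iff)
  have surj: "f ` {..<length rho} = {..<length nu}"
  proof
    show "f ` {..<length rho} \<subseteq> {..<length nu}" using f by auto
    show "{..<length nu} \<subseteq> f ` {..<length rho}"
    proof
      fix i assume "i \<in> {..<length nu}"
      then have i: "i < length nu" by simp
      then have "0 < nu ! i" using partitionsD(2)[OF nu] by simp
      then have "{j. j < length rho \<and> f j = i} \<noteq> {}" using sums[OF i] by (metis less_irrefl sum.empty)
      then show "i \<in> f ` {..<length rho}" by blast
    qed
  qed
  show "length nu \<le> length rho" using card_image_le[of "{..<length rho}" f] surj by simp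
  assume len: "length nu = length rho"
  then have inj: "inj_on f {..<length rho}" using surj by (intro eq_card_imp_inj_on) auto
  have val: "rho ! j = nu ! f j" if "j < length rho" for j
  proof -
    have "{j'. j' < length rho \<and> f j' = f j} = {j}" using inj that by (auto simp: inj_on_def)
    moreover have "f j < length nu" using surj that by auto
    ultimately show ?thesis using sums[of "f j"] by simp
  qed
  have "mset rho = image_mset ((!) rho) (mset_set {..<length rho})"
    by (metis map_nth mset_map mset_upt atLeast0LessThan)
  also have "\<dots> = image_mset (\<lambda>j. nu ! f j) (mset_set {..<length rho})"
    using val by (intro image_mset_cong) auto
  also have "\<dots> = image_mset ((!) nu) (image_mset f (mset_set {..<length rho}))"
    by (simp add: multiset.map_comp comp_def)
  also have "image_mset f (mset_set {..<length rho}) = mset_set {..<length nu}"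
    using image_mset_mset_set[OF inj] surj by simp
  also have "image_mset ((!) nu) (mset_set {..<length nu}) = mset nu"
    by (metis map_nth mset_map mset_upt atLeast0LessThan)
  finally show "rho = nu" using partitionsD(1)[OF rho] partitionsD(1)[OF nu] sorted_desc_eq_if_mset_eq by blast
qed

lemma mono_coeff_self_pos: "mono_coeff rho rho > 0"
proof -
  have "{j. j < length rho \<and> restrict (\<lambda>j. j) {..<length rho} j = i} = {i}" if "i < length rho" for i
    using that by auto
  then have "restrict (\<lambda>j. j) {..<length rho} \<in> {f \<in> {..<length rho} \<rightarrow>\<^sub>E {..<length rho}.
      \<forall>i<length rho. (\<Sum>j\<in>{j. j < length rho \<and> f j = i}. rho ! j) = rho ! i}"
    by (auto simp del: restrict_apply)
  then show ?thesis unfolding mono_coeff_def using finite_mono_coeff_set[of rho rho] card_gt_0_iff by blast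
qed

text \<open>The squarefree monomial arises in the n-th power of the first power sum once for each
  bijection between factors and variables.\<close>

lemma mono_coeff_ones: "mono_coeff (replicate n 1) (replicate n 1) = fact n"
proof -
  have eq: "(\<forall>i<n. (\<Sum>j\<in>{j. j < n \<and> f j = i}. replicate n (1::nat) ! j) = replicate n 1 ! i) \<longleftrightarrow> inj_on f {..<n}"
    if f: "f \<in> {..<n} \<rightarrow>\<^sub>E {..<n}" for f
  proof -
    have s: "(\<Sum>j\<in>{j. j < n \<and> f j = i}. replicate n (1::nat) ! j) = card {j. j < n \<and> f j = i}" for i
      by simp
    have "(\<forall>i<n. card {j. j < n \<and> f j = i} = 1) \<longleftrightarrow> inj_on f {..<n}"
    proof
      assume c: "\<forall>i<n. card {j. j < n \<and> f j = i} = 1"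
      show "inj_on f {..<n}"
      proof (rule inj_onI)
        fix x y assume xy: "x \<in> {..<n}" "y \<in> {..<n}" "f x = f y"
        then have "f x < n" using f by auto
        then have "card {j. j < n \<and> f j = f x} = 1" using c by simp
        then obtain z where z: "{j. j < n \<and> f j = f x} = {z}" by (rule card_1_singletonE)
        have "x \<in> {j. j < n \<and> f j = f x}" "y \<in> {j. j < n \<and> f j = f x}" using xy by auto
        then show "x = y" unfolding z by simp
      qed
    next
      assume inj: "inj_on f {..<n}"
      have "f ` {..<n} = {..<n}" using f inj by (intro endo_inj_surj) auto
      then show "\<forall>i<n. card {j. j < n \<and> f j = i} = 1"
      proof (intro allI impI)
        fix i assume "i < n"
        then obtain j where j: "j < n" "i = f j" using \<open>f ` {..<n} = {..<n}\<close> by blast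
        then have "{j'. j' < n \<and> f j' = i} = {j}" using inj by (auto simp: inj_on_def)
        then show "card {j. j < n \<and> f j = i} = 1" by simp
      qed
    qed
    then show ?thesis unfolding s by simp
  qed
  have "mono_coeff (replicate n 1) (replicate n 1) = card {f \<in> {..<n} \<rightarrow>\<^sub>E {..<n}. inj_on f {..<n}}"
    unfolding mono_coeff_def length_replicate by (rule arg_cong[where f = card], rule Collect_cong) (metis eq)
  also have "\<dots> = fact n"
    using card_inj_on_subset_funcset[of "{..<n}" "{..<n}"] by (simp add: fact_prod_rev atLeast0LessThan)
  finally show ?thesis .
qed

definition supported :: "nat \<Rightarrow> (nat list \<Rightarrow> real) \<Rightarrow> bool" where
  "supported n c \<longleftrightarrow> (\<forall>rho. rho \<notin> partitions n \<longrightarrow> c rho = 0)"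

lemma mcoeff_diff_scale: "mcoeff n (\<lambda>rho. c rho - t * d rho) nu = mcoeff n c nu - t * mcoeff n d nu"
  by (simp add: mcoeff_def sum_subtractf sum_distrib_left algebra_simps)

text \<open>Independence of the power sums. The passage to monomials is triangular with respect to
  length: at a partition of maximal length in the support, only its own power sum
  contributes.\<close>

lemma mcoeff_injective:
  assumes "supported n d" and zero: "\<And>nu. nu \<in> partitions n \<Longrightarrow> mcoeff n d nu = 0"
  shows "d rho = 0"
proof (rule ccontr)
  assume "d rho \<noteq> 0"
  let ?S = "{rho \<in> partitions n. d rho \<noteq> 0}"
  have "rho \<in> ?S" using \<open>d rho \<noteq> 0\<close> assms(1) by (auto simp: supported_def)
  moreover have fin: "finite ?S" using finite_partitions by simp
  ultimately have "Max (length ` ?S) \<in> length ` ?S" by (intro Max_in) auto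
  then obtain nu where nu: "nu \<in> ?S" "length nu = Max (length ` ?S)" by auto
  have max: "length sigma \<le> length nu" if "sigma \<in> ?S" for sigma
    unfolding nu(2) using fin that by (intro Max_ge) auto
  have "mcoeff n d nu = (\<Sum>sigma\<in>{nu}. d sigma * real (mono_coeff sigma nu))"
    unfolding mcoeff_def
  proof (rule sum.mono_neutral_right)
    show "\<forall>sigma\<in>partitions n - {nu}. d sigma * real (mono_coeff sigma nu) = 0"
    proof
      fix sigma assume s: "sigma \<in> partitions n - {nu}"
      show "d sigma * real (mono_coeff sigma nu) = 0"
      proof (rule ccontr)
        assume "\<not> ?thesis"
        then have ne: "d sigma \<noteq> 0" "mono_coeff sigma nu \<noteq> 0" by auto
        have P: "sigma \<in> partitions n" "nu \<in> partitions n" using s nu(1) by auto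
        have "length nu = length sigma"
          using mono_coeff_nonzero(1)[OF P ne(2)] max[of sigma] P(1) ne(1) by simp
        then have "sigma = nu" by (rule mono_coeff_nonzero(2)[OF P ne(2)])
        then show False using s by simp
      qed
    qed
  qed (use nu finite_partitions in auto)
  then show False using zero[of nu] nu(1) mono_coeff_self_pos[of nu] by simp
qed

section \<open>The scalar product and orthogonal triangular families\<close>

lemma jack_inner_commute: "jack_inner \<alpha> n c d = jack_inner \<alpha> n d c"
  unfolding jack_inner_def by (rule sum.cong) auto

lemma jack_inner_sum_left:
  "jack_inner \<alpha> n (\<lambda>rho. \<Sum>i\<in>I. a i * f i rho) d = (\<Sum>i\<in>I. a i * jack_inner \<alpha> n (f i) d)"
proof -
  have "jack_inner \<alpha> n (\<lambda>rho. \<Sum>i\<in>I. a i * f i rho) d =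
      (\<Sum>rho\<in>partitions n. \<Sum>i\<in>I. a i * (f i rho * d rho * real (zee rho) * \<alpha> ^ length rho))"
    unfolding jack_inner_def by (simp add: sum_distrib_right sum_distrib_left mult_ac)
  also have "\<dots> = (\<Sum>i\<in>I. a i * jack_inner \<alpha> n (f i) d)"
    unfolding jack_inner_def by (subst sum.swap) (simp add: sum_distrib_left)
  finally show ?thesis .
qed

lemma zee_pos: "rho \<in> partitions n \<Longrightarrow> 0 < zee rho"
  unfolding zee_def using partitionsD(2)[of rho n] by (intro prod_pos) auto

lemma jack_inner_self_zero:
  assumes "0 < \<alpha>" "supported n c" "jack_inner \<alpha> n c c = 0"
  shows "c rho = 0"
proof (cases "rho \<in> partitions n")
  case True
  have "0 \<le> c sigma * c sigma * real (zee sigma) * \<alpha> ^ length sigma" for sigma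
    using assms(1) by simp
  then have "c rho * c rho * real (zee rho) * \<alpha> ^ length rho = 0"
    using assms(3) True finite_partitions unfolding jack_inner_def
    by (subst (asm) sum_nonneg_eq_0_iff) auto
  then show ?thesis using zee_pos[OF True] assms(1) by simp
qed (use assms(2) in \<open>simp add: supported_def\<close>)

text \<open>The properties verified for the signed counts. Orthogonality is asked only between
  members; nonzero leading coefficients and the orthogonality to all lower elements demanded by
  \<open>jack\<close> are consequences.\<close>

locale jack_family =
  fixes \<alpha> :: real and n :: nat and z :: "nat list \<Rightarrow> nat list \<Rightarrow> real"
  assumes \<alpha>: "0 < \<alpha>"
    and supp: "la \<in> partitions n \<Longrightarrow> supported n (z la)"
    and triang: "la \<in> partitions n \<Longrightarrow> nu \<in> partitions n \<Longrightarrow> mcoeff n (z la) nu \<noteq> 0 \<Longrightarrow> dominated nu la"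
    and normal: "la \<in> partitions n \<Longrightarrow> mcoeff n (z la) (replicate n 1) = fact n"
    and orth: "la \<in> partitions n \<Longrightarrow> mu \<in> partitions n \<Longrightarrow> la \<noteq> mu \<Longrightarrow> jack_inner \<alpha> n (z la) (z mu) = 0"
begin

text \<open>Down-sets of the dominance order are what the induction needs: without a maximal element
  \<open>la\<close> the set is still a down-set, and subtracting a multiple of \<open>z la\<close>
  removes the monomial of \<open>la\<close> while staying inside.\<close>

lemma span:
  assumes "\<D> \<subseteq> partitions n"
    and "\<And>mu nu. mu \<in> \<D> \<Longrightarrow> nu \<in> partitions n \<Longrightarrow> dominated nu mu \<Longrightarrow> nu \<in> \<D>"
    and "supported n d"
    and "\<And>nu. nu \<in> partitions n \<Longrightarrow> mcoeff n d nu \<noteq> 0 \<Longrightarrow> nu \<in> \<D>"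
  shows "\<exists>a. d = (\<lambda>rho. \<Sum>mu\<in>\<D>. a mu * z mu rho)"
proof -
  have "finite \<D>" using assms(1) finite_partitions by (rule finite_subset)
  then show ?thesis using assms
  proof (induction "card \<D>" arbitrary: \<D> d)
    case 0
    then have "\<D> = {}" by simp
    then have "d rho = 0" for rho using mcoeff_injective[OF 0(5)] 0(6) by blast
    then show ?case using \<open>\<D> = {}\<close> by auto
  next
    case (Suc m)
    note D = Suc.prems(2) and down = Suc.prems(3)
    have "\<exists>la\<in>\<D>. \<forall>mu\<in>\<D>. mu \<noteq> la \<longrightarrow> \<not> (dominated la mu \<and> la \<noteq> mu)"
    proof (rule Finite_Set.bex_max_element[where R = "\<lambda>x y. dominated x y \<and> x \<noteq> y"])
      show "finite \<D>" "\<D> \<noteq> {}" using Suc by auto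
      show "asymp_on \<D> (\<lambda>x y. dominated x y \<and> x \<noteq> y)"
        using dominated_antisym D by (intro asymp_onI) blast
      show "transp_on \<D> (\<lambda>x y. dominated x y \<and> x \<noteq> y)"
        using dominated_antisym dominated_trans D by (intro transp_onI) blast
    qed
    then obtain la where la: "la \<in> \<D>" and max: "\<And>mu. mu \<in> \<D> \<Longrightarrow> dominated la mu \<Longrightarrow> mu = la" by blast
    let ?E = "\<D> - {la}"
    have laP: "la \<in> partitions n" using la D by blast
    have E: "m = card ?E" "finite ?E" "?E \<subseteq> partitions n"
      using Suc la by (auto simp: card_Diff_singleton)
    have downE: "nu \<in> ?E" if "mu \<in> ?E" "nu \<in> partitions n" "dominated nu mu" for mu nu
      using down[of mu nu] max[of mu] that by auto
    have IH: "\<exists>a. d' = (\<lambda>rho. \<Sum>mu\<in>?E. a mu * z mu rho)"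
      if d': "supported n d'" "\<And>nu. nu \<in> partitions n \<Longrightarrow> mcoeff n d' nu \<noteq> 0 \<Longrightarrow> nu \<in> ?E" for d'
    proof (rule Suc.hyps(1)[OF E])
      show "nu \<in> ?E" if "mu \<in> ?E" "nu \<in> partitions n" "dominated nu mu" for mu nu
        using downE that .
      show "nu \<in> ?E" if "nu \<in> partitions n" "mcoeff n d' nu \<noteq> 0" for nu
        using d'(2) that .
    qed (rule d')
    \<comment> \<open>If the leading coefficient vanished, \<open>z la\<close> would by induction be
      a combination of the other members, hence orthogonal to itself and zero, against the
      coefficient \<open>fact n\<close>.\<close>
    have "mcoeff n (z la) la \<noteq> 0"
    proof
      assume 0: "mcoeff n (z la) la = 0"
      have "nu \<in> ?E" if "nu \<in> partitions n" "mcoeff n (z la) nu \<noteq> 0" for nu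
        using triang[OF laP that] down[OF la that(1)] that 0 by auto
      then obtain a where a: "z la = (\<lambda>rho. \<Sum>mu\<in>?E. a mu * z mu rho)"
        using IH[OF supp[OF laP]] by blast
      have "jack_inner \<alpha> n (z la) (z la) = (\<Sum>mu\<in>?E. a mu * jack_inner \<alpha> n (z mu) (z la))"
        by (subst a) (rule jack_inner_sum_left)
      also have "\<dots> = 0" using orth laP D by (intro sum.neutral) auto
      finally have "z la rho = 0" for rho using jack_inner_self_zero[OF \<alpha> supp[OF laP]] by blast
      then have "mcoeff n (z la) (replicate n 1) = 0" by (simp add: mcoeff_def)
      then show False using normal[OF laP] by simp
    qed
    define t where "t = mcoeff n d la / mcoeff n (z la) la"
    let ?d = "\<lambda>rho. d rho - t * z la rho"
    have "supported n ?d" using Suc.prems(4) supp[OF laP] by (simp add: supported_def)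
    moreover have "nu \<in> ?E" if nu: "nu \<in> partitions n" "mcoeff n ?d nu \<noteq> 0" for nu
    proof -
      have "mcoeff n ?d la = 0"
        unfolding mcoeff_diff_scale t_def using \<open>mcoeff n (z la) la \<noteq> 0\<close> by simp
      then have "nu \<noteq> la" using nu(2) by auto
      moreover have "mcoeff n d nu \<noteq> 0 \<or> mcoeff n (z la) nu \<noteq> 0"
        using nu(2) unfolding mcoeff_diff_scale by auto
      then have "nu \<in> \<D>" using Suc.prems(5) nu(1) triang[OF laP nu(1)] down[OF la nu(1)] by blast
      ultimately show ?thesis by blast
    qed
    ultimately obtain a where a: "?d = (\<lambda>rho. \<Sum>mu\<in>?E. a mu * z mu rho)" using IH by blast
    have "d rho = (\<Sum>mu\<in>\<D>. (a(la := t)) mu * z mu rho)" for rho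
    proof -
      have "d rho = t * z la rho + (\<Sum>mu\<in>?E. a mu * z mu rho)" using fun_cong[OF a, of rho] by simp
      also have "(\<Sum>mu\<in>?E. a mu * z mu rho) = (\<Sum>mu\<in>?E. (a(la := t)) mu * z mu rho)"
        by (rule sum.cong) auto
      finally show ?thesis using Suc.prems(1) la by (simp add: sum.remove)
    qed
    then show ?case by blast
  qed
qed

text \<open>Existence: what lies strictly below \<open>la\<close> is spanned by lower members, all
  orthogonal to \<open>z la\<close>. Uniqueness: a competitor is expanded in the members up to
  \<open>la\<close>; testing it against each lower member kills that coefficient, and the
  normalization fixes the last one.\<close>

lemma jack_eq:
  assumes la: "la \<in> partitions n"
  shows "jack \<alpha> la = z la"
proof -
  have n: "sum_list la = n" using la by (rule partitionsD)
  let ?D = "{nu \<in> partitions n. dominated nu la}"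
  have down: "nu \<in> ?D" if "mu \<in> ?D" "nu \<in> partitions n" "dominated nu mu" for mu nu
    using that dominated_trans by blast
  have downE: "nu \<in> ?D - {la}" if "mu \<in> ?D - {la}" "nu \<in> partitions n" "dominated nu mu" for mu nu
    using that dominated_trans dominated_antisym[OF la] by blast
  have lower: "jack_inner \<alpha> n (z la) d = 0"
    if d: "supported n d" "\<And>nu. nu \<in> partitions n \<Longrightarrow> mcoeff n d nu \<noteq> 0 \<Longrightarrow> dominated nu la \<and> nu \<noteq> la" for d
  proof -
    obtain a where a: "d = (\<lambda>rho. \<Sum>mu\<in>?D - {la}. a mu * z mu rho)"
      using span[of "?D - {la}" d] downE d by blast
    have "jack_inner \<alpha> n d (z la) = (\<Sum>mu\<in>?D - {la}. a mu * jack_inner \<alpha> n (z mu) (z la))"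
      unfolding a by (rule jack_inner_sum_left)
    also have "\<dots> = 0" using orth la by (intro sum.neutral) auto
    finally show ?thesis by (simp add: jack_inner_commute)
  qed
  show ?thesis
    unfolding jack_def Let_def n
  proof (rule the_equality, goal_cases)
    case 1
    show ?case
      using supp[OF la] triang[OF la] normal[OF la] lower by (auto simp: supported_def)
  next
    case (2 c)
    then have c: "supported n c" "\<And>nu. nu \<in> partitions n \<Longrightarrow> mcoeff n c nu \<noteq> 0 \<Longrightarrow> dominated nu la"
      "mcoeff n c (replicate n 1) = fact n"
      and orthc: "\<And>d. supported n d \<Longrightarrow>
        (\<And>nu. nu \<in> partitions n \<Longrightarrow> mcoeff n d nu \<noteq> 0 \<Longrightarrow> dominated nu la \<and> nu \<noteq> la) \<Longrightarrow> jack_inner \<alpha> n c d = 0"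
      by (auto simp: supported_def)
    obtain a where a: "c = (\<lambda>rho. \<Sum>mu\<in>?D. a mu * z mu rho)"
      using span[of ?D c] down c by blast
    have fin: "finite ?D" using finite_partitions by simp
    have "a mu = 0" if mu: "mu \<in> ?D" "mu \<noteq> la" for mu
    proof -
      have muP: "mu \<in> partitions n" using mu by blast
      have "dominated nu la \<and> nu \<noteq> la" if "nu \<in> partitions n" "mcoeff n (z mu) nu \<noteq> 0" for nu
        using triang[OF muP that] mu dominated_trans dominated_antisym[OF la muP] by blast
      then have "0 = jack_inner \<alpha> n c (z mu)" using orthc[OF supp[OF muP]] by simp
      also have "\<dots> = (\<Sum>nu\<in>?D. a nu * jack_inner \<alpha> n (z nu) (z mu))"
        unfolding a by (rule jack_inner_sum_left)
      also have "\<dots> = (\<Sum>nu\<in>{mu}. a nu * jack_inner \<alpha> n (z nu) (z mu))"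
        by (rule sum.mono_neutral_right) (use fin mu orth in auto)
      finally have "a mu * jack_inner \<alpha> n (z mu) (z mu) = 0" by simp
      moreover have "jack_inner \<alpha> n (z mu) (z mu) \<noteq> 0"
      proof
        assume "jack_inner \<alpha> n (z mu) (z mu) = 0"
        then have "z mu rho = 0" for rho using jack_inner_self_zero[OF \<alpha> supp[OF muP]] by blast
        then have "mcoeff n (z mu) (replicate n 1) = 0" by (simp add: mcoeff_def)
        then show False using normal[OF muP] by simp
      qed
      ultimately show ?thesis by simp
    qed
    then have c_eq: "c rho = a la * z la rho" for rho
      unfolding a using fin la dominated_refl
      by (subst sum.mono_neutral_right[of _ "{la}"]) auto
    then have "mcoeff n c (replicate n 1) = a la * mcoeff n (z la) (replicate n 1)"
      by (simp add: mcoeff_def sum_distrib_left mult_ac)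
    then have "a la = 1" using c(3) normal[OF la] by simp
    then show ?case using c_eq by auto
  qed
qed

end

section \<open>Zonal polynomials from signed labellings\<close>

definition pairs_of_type :: "nat \<Rightarrow> nat list \<Rightarrow> ((nat \<Rightarrow> nat) \<times> (nat \<Rightarrow> nat)) set" where
  "pairs_of_type n rho = {(A, B). A \<in> pair_partitions n \<and> B \<in> pair_partitions n \<and> loop_type (pts n) A B = mset rho}"

text \<open>Averaging over all pairs of type \<open>rho\<close> avoids having to exhibit one.\<close>
definition zonal :: "nat \<Rightarrow> nat list \<Rightarrow> nat list \<Rightarrow> real" where
  "zonal n la rho = (if rho \<in> partitions n then
     (\<Sum>(A, B)\<in>pairs_of_type n rho. signed_count n (diagram la) A B) / fact (2 * n) else 0)"

text \<open>The signed count is constant on each type, and the size of the class turns the average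
  into a division by \<open>2 ^ length rho * zee rho\<close>.\<close>

lemma zonal_eq_signed_count:
  assumes rho: "rho \<in> partitions n" and S: "S1 \<in> pair_partitions n" "S2 \<in> pair_partitions n"
    and type: "loop_type (pts n) S1 S2 = mset rho"
  shows "zonal n la rho * (2 ^ length rho * real (zee rho)) = signed_count n (diagram la) S1 S2"
proof -
  have "(\<Sum>(A, B)\<in>pairs_of_type n rho. signed_count n (diagram la) A B) =
      (\<Sum>(A, B)\<in>pairs_of_type n rho. signed_count n (diagram la) S1 S2)"
    using signed_count_type[OF finite_diagram _ _ S] type
    by (intro sum.cong) (auto simp: pairs_of_type_def)
  also have "\<dots> = real (card (pairs_of_type n rho)) * signed_count n (diagram la) S1 S2" by simp
  finally have sum: "zonal n la rho =
      real (card (pairs_of_type n rho)) * signed_count n (diagram la) S1 S2 / fact (2 * n)"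
    using rho by (simp add: zonal_def)
  have "card (pairs_of_type n rho) * (2 ^ length rho * zee rho) = fact (2 * n)"
    using card_pairs_of_type[OF S type] by (simp add: pairs_of_type_def zee_eq_zmset)
  then have "real (card (pairs_of_type n rho)) * (2 ^ length rho * real (zee rho)) = fact (2 * n)"
    by (metis of_nat_fact of_nat_mult of_nat_numeral of_nat_power)
  then have "zonal n la rho * (2 ^ length rho * real (zee rho)) =
      signed_count n (diagram la) S1 S2 * (fact (2 * n) / fact (2 * n))"
    unfolding sum by (simp add: field_simps)
  then show ?thesis by simp
qed

definition type_list :: "nat \<Rightarrow> (nat \<Rightarrow> nat) \<Rightarrow> (nat \<Rightarrow> nat) \<Rightarrow> nat list" where
  "type_list n A B = rev (sorted_list_of_multiset (loop_type (pts n) A B))"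

lemma sum_mset_loop_type:
  assumes "two_matchings X A B"
  shows "2 * sum_mset (loop_type X A B) = card X"
proof -
  interpret two_matchings X A B by fact
  have "2 * sum_mset (loop_type X A B) = (\<Sum>l\<in>loops_on X A B. 2 * (card l div 2))"
    by (simp add: loop_type_def sum_unfold_sum_mset sum_mset_distrib_left multiset.map_comp comp_def)
  also have "\<dots> = (\<Sum>l\<in>loops_on X A B. card l)" using even_card_loop by (intro sum.cong) auto
  also have "\<dots> = card (\<Union>(loops_on X A B))"
    using disjoint_loops_on loops_on_subset finite_subset[OF _ fin]
    by (intro card_Union_disjoint[symmetric]) (auto simp: pairwise_def disjnt_def)
  finally show ?thesis by (simp add: Union_loops_on)
qed

lemma type_list:
  assumes "A \<in> pair_partitions n" "B \<in> pair_partitions n"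
  shows "mset (type_list n A B) = loop_type (pts n) A B" "type_list n A B \<in> partitions n"
proof -
  show m: "mset (type_list n A B) = loop_type (pts n) A B" by (simp add: type_list_def)
  have tm: "two_matchings (pts n) A B" using assms by (rule two_matchings_pts)
  have "sorted_wrt (\<ge>) (type_list n A B)"
    using sorted_sorted_list_of_multiset by (simp add: type_list_def sorted_wrt_rev)
  moreover have "0 < x" if "x \<in> set (type_list n A B)" for x
    using that loop_type_no_zero[OF tm] by (metis gr0I m set_mset_mset)
  moreover have "sum_list (type_list n A B) = n"
    using sum_mset_loop_type[OF tm] by (simp add: m[symmetric] sum_mset_sum_list)
  ultimately show "type_list n A B \<in> partitions n" by (simp add: partitions_def)
qed

text \<open>A sum over types becomes a sum over all pairs \<open>(A, B)\<close>, in which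
  \<open>A\<close> can vary while \<open>B\<close> is fixed. The cancellations apply in this
  form.\<close>

lemma sum_zonal:
  "(\<Sum>rho\<in>partitions n. zonal n la rho * F rho) =
    (\<Sum>A\<in>pair_partitions n. \<Sum>B\<in>pair_partitions n.
       signed_count n (diagram la) A B * F (type_list n A B)) / fact (2 * n)"
proof -
  let ?P = "pair_partitions n \<times> pair_partitions n"
  let ?h = "\<lambda>(A, B). signed_count n (diagram la) A B * F (type_list n A B)"
  have pairs: "{p \<in> ?P. type_list n (fst p) (snd p) = rho} = pairs_of_type n rho" if "rho \<in> partitions n" for rho
  proof -
    have "type_list n A B = rho \<longleftrightarrow> loop_type (pts n) A B = mset rho"
      if "A \<in> pair_partitions n" "B \<in> pair_partitions n" for A B
      using type_list[OF that] partitionsD(1) \<open>rho \<in> partitions n\<close> sorted_desc_eq_if_mset_eq by metis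
    then show ?thesis by (auto simp: pairs_of_type_def type_list(1))
  qed
  have "(\<Sum>rho\<in>partitions n. zonal n la rho * F rho) =
      (\<Sum>rho\<in>partitions n. (\<Sum>p\<in>{p \<in> ?P. type_list n (fst p) (snd p) = rho}. ?h p) / fact (2 * n))"
  proof (rule sum.cong[OF refl])
    fix rho assume rho: "rho \<in> partitions n"
    have "(\<Sum>p\<in>{p \<in> ?P. type_list n (fst p) (snd p) = rho}. ?h p) =
        (\<Sum>p\<in>{p \<in> ?P. type_list n (fst p) (snd p) = rho}. (\<lambda>(A, B). signed_count n (diagram la) A B) p * F rho)"
      by (rule sum.cong) auto
    also have "\<dots> = (\<Sum>(A, B)\<in>pairs_of_type n rho. signed_count n (diagram la) A B) * F rho"
      unfolding pairs[OF rho] by (simp add: sum_distrib_right)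
    finally show "zonal n la rho * F rho =
        (\<Sum>p\<in>{p \<in> ?P. type_list n (fst p) (snd p) = rho}. ?h p) / fact (2 * n)"
      using rho by (simp add: zonal_def)
  qed
  also have "\<dots> = (\<Sum>rho\<in>partitions n. \<Sum>p\<in>{p \<in> ?P. type_list n (fst p) (snd p) = rho}. ?h p) / fact (2 * n)"
    by (simp add: sum_divide_distrib)
  also have "(\<Sum>rho\<in>partitions n. \<Sum>p\<in>{p \<in> ?P. type_list n (fst p) (snd p) = rho}. ?h p) = sum ?h ?P"
    by (rule sum.group) (use finite_pair_partitions finite_partitions type_list(2) in auto)
  also have "sum ?h ?P = (\<Sum>A\<in>pair_partitions n. \<Sum>B\<in>pair_partitions n.
       signed_count n (diagram la) A B * F (type_list n A B))"
    by (simp add: sum.cartesian_product)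
  finally show ?thesis .
qed

text \<open>The common cancellation behind triangularity and orthogonality.\<close>
lemma signed_count_weighted_zero:
  fixes u :: "'i \<Rightarrow> nat \<Rightarrow> nat" and w :: "'i \<Rightarrow> real"
  assumes la: "sorted_wrt (\<ge>) la" and B: "B \<in> pair_partitions n"
    and big: "\<And>i. i \<in> I \<Longrightarrow> w i \<noteq> 0 \<Longrightarrow> \<exists>j. 2 * sum_list (take j la) < card {x \<in> pts n. u i x < j}"
  shows "(\<Sum>A\<in>pair_partitions n. signed_count n (diagram la) A B *
    (\<Sum>i\<in>I. of_bool (\<forall>x\<in>pts n. u i (A x) = u i x) * w i)) = 0"
proof -
  \<comment> \<open>The dependence on \<open>A\<close> leaves the index set:
    \<open>row_compat\<close> refers to \<open>B\<close> alone, and the column condition becomes an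
    indicator. The sum over \<open>A\<close> can then be taken innermost.\<close>
  let ?G = "{g \<in> pts n \<rightarrow>\<^sub>E diagram la \<times> UNIV. row_compat n B g \<and> inj_on g (pts n)}"
  let ?inv = "\<lambda>i A. \<forall>x\<in>pts n. u i (A x) = u i x"
  have finG: "finite ?G"
    by (rule finite_subset[of _ "pts n \<rightarrow>\<^sub>E diagram la \<times> UNIV"])
      (use finite_diagram in \<open>auto intro!: finite_PiE\<close>)
  have sc: "signed_count n (diagram la) A B =
      (\<Sum>g\<in>?G. of_bool (col_compat n A g) * (\<Sum>S0\<in>box_pairings n g. loop_sign n S0 A))"
    if "A \<in> pair_partitions n" for A
    unfolding signed_count_inj[OF finite_diagram that]
    by (rule sum.mono_neutral_cong_left) (use finG in \<open>auto simp: labellings_def\<close>)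
  have inner: "w i * (\<Sum>A\<in>pair_partitions n. of_bool (col_compat n A g) * of_bool (?inv i A) * loop_sign n S0 A) = 0"
    if "i \<in> I" "g \<in> ?G" "S0 \<in> box_pairings n g" for i g S0
  proof (cases "w i = 0")
    case False
    then obtain j where j: "2 * sum_list (take j la) < card {x \<in> pts n. u i x < j}"
      using big \<open>i \<in> I\<close> by blast
    \<comment> \<open>Pigeonhole: without such a pair, \<open>card_less_le_rows\<close> would bound
      the points of the first \<open>j\<close> colours by twice the first \<open>j\<close> rows of
      \<open>la\<close>.\<close>
    have "\<exists>x\<in>pts n. \<exists>y\<in>pts n. x \<noteq> y \<and> snd (fst (g x)) = snd (fst (g y)) \<and> snd (g x) = snd (g y) \<and> u i x = u i y"
    proof (rule ccontr)
      assume "\<not> ?thesis"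
      then have "card {x \<in> pts n. u i x < j} \<le> 2 * sum_list (take j la)"
        using that by (intro card_less_le_rows[OF la, of g]) auto
      then show False using j by simp
    qed
    then obtain x y where xy: "x \<in> pts n" "y \<in> pts n" "x \<noteq> y" "snd (fst (g x)) = snd (fst (g y))"
      "snd (g x) = snd (g y)" "u i x = u i y" by blast
    have "(\<Sum>A\<in>pair_partitions n. of_bool (col_compat n A g) * of_bool (?inv i A) * loop_sign n S0 A) =
        (\<Sum>A\<in>{A \<in> pair_partitions n. col_compat n A g \<and> ?inv i A}. loop_sign n S0 A)"
      by (rule sum.mono_neutral_cong_right) (use finite_pair_partitions in auto)
    also have "\<dots> = 0" by (rule sum_column_pairings_zero[OF that(3) xy])
    finally show ?thesis by simp
  qed simp
  have "(\<Sum>A\<in>pair_partitions n. signed_count n (diagram la) A B * (\<Sum>i\<in>I. of_bool (?inv i A) * w i)) =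
      (\<Sum>A\<in>pair_partitions n. \<Sum>g\<in>?G. \<Sum>i\<in>I. \<Sum>S0\<in>box_pairings n g.
         w i * (of_bool (col_compat n A g) * of_bool (?inv i A) * loop_sign n S0 A))"
    by (rule sum.cong[OF refl]) (simp only: sc sum_distrib_left sum_distrib_right mult_ac)
  also have "\<dots> = (\<Sum>g\<in>?G. \<Sum>i\<in>I. \<Sum>S0\<in>box_pairings n g. \<Sum>A\<in>pair_partitions n.
         w i * (of_bool (col_compat n A g) * of_bool (?inv i A) * loop_sign n S0 A))"
    by (subst sum.swap, rule sum.cong[OF refl], subst sum.swap, rule sum.cong[OF refl], rule sum.swap)
  also have "\<dots> = 0"
    by (rule sum.neutral, rule ballI, rule sum.neutral, rule ballI, rule sum.neutral, rule ballI)
      (simp only: sum_distrib_left[symmetric] inner)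
  finally show ?thesis .
qed

subsection \<open>Invariant colourings\<close>

text \<open>The factor 2 is there because a loop of half-length m has 2m points: colourings constant
  on loops have content twice the exponent of a monomial.\<close>

definition colourings :: "nat \<Rightarrow> nat list \<Rightarrow> (nat \<Rightarrow> nat) set" where
  "colourings n nu = {u \<in> pts n \<rightarrow>\<^sub>E {..<length nu}. \<forall>i<length nu. card {x \<in> pts n. u x = i} = 2 * nu ! i}"

lemma finite_colourings: "finite (colourings n nu)"
  by (rule finite_subset[of _ "pts n \<rightarrow>\<^sub>E {..<length nu}"]) (auto simp: colourings_def intro: finite_PiE)

lemma card_colouring_less:
  assumes "u \<in> colourings n nu"
  shows "card {x \<in> pts n. u x < j} = 2 * sum_list (take j nu)"
proof -
  have u: "u x < length nu" if "x \<in> pts n" for x using assms that by (auto simp: colourings_def)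
  have "u ` {x \<in> pts n. u x < j} \<subseteq> {..<min j (length nu)}" using u by auto
  from sum.group[OF _ _ this, of "\<lambda>_. 1::nat"]
  have "card {x \<in> pts n. u x < j} = (\<Sum>i<min j (length nu). card {x\<in>{x \<in> pts n. u x < j}. u x = i})"
    by simp
  also have "\<dots> = (\<Sum>i<min j (length nu). 2 * nu ! i)"
  proof (rule sum.cong[OF refl])
    fix i assume i: "i \<in> {..<min j (length nu)}"
    then have "{x\<in>{x \<in> pts n. u x < j}. u x = i} = {x \<in> pts n. u x = i}" by auto
    then show "card {x\<in>{x \<in> pts n. u x < j}. u x = i} = 2 * nu ! i"
      using assms i by (simp add: colourings_def)
  qed
  also have "\<dots> = 2 * sum_list (take j nu)"
    by (simp add: sum_list_sum_nth sum_distrib_left atLeast0LessThan min.commute)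
  finally show ?thesis .
qed

text \<open>Allows the loops to be listed in the order of a prescribed list of their
  half-lengths.\<close>

lemma exists_map_eq_if_mset_map_eq:
  assumes "mset (map f xs) = mset ys"
  obtains xs' where "mset xs' = mset xs" "map f xs' = ys"
proof -
  obtain p where p: "p permutes {..<length (map f xs)}" "permute_list p (map f xs) = ys"
    using assms by (metis mset_eq_permutation)
  then have "map f (permute_list p xs) = ys" by (simp add: permute_list_map)
  moreover have "mset (permute_list p xs) = mset xs" using p(1) by simp
  ultimately show thesis using that by blast
qed

text \<open>Expanding a product of power sums chooses one variable for each part. Choosing it for
  the corresponding loop gives a colouring invariant under both matchings, and every such colouring
  arises once.\<close>

lemma mono_coeff_eq_colourings:
  assumes S: "A \<in> pair_partitions n" "B \<in> pair_partitions n" and rho: "mset rho = loop_type (pts n) A B"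
  shows "mono_coeff rho nu = card {u \<in> colourings n nu. \<forall>x\<in>pts n. u (A x) = u x \<and> u (B x) = u x}"
proof -
  interpret two_matchings "pts n" A B using S by (rule two_matchings_pts)
  obtain ls0 where ls0: "set ls0 = loops_on (pts n) A B" "distinct ls0"
    using finite_distinct_list[OF finite_loops_on[OF fin]] by blast
  have "mset (map (\<lambda>l. card l div 2) ls0) = mset rho"
    using ls0 rho by (simp add: loop_type_def mset_set_set[symmetric])
  then obtain ls where "mset ls = mset ls0" and map: "map (\<lambda>l. card l div 2) ls = rho"
    by (rule exists_map_eq_if_mset_map_eq)
  then have ls: "set ls = loops_on (pts n) A B" "distinct ls"
    using ls0 by (metis set_mset_mset, metis mset_eq_imp_distinct_iff)
  let ?m = "length rho"
  have m: "length ls = ?m" using map by auto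
  have lsj: "ls ! j \<in> loops_on (pts n) A B" if "j < ?m" for j using that ls m by (metis nth_mem)
  have card_ls: "card (ls ! j) = 2 * rho ! j" if "j < ?m" for j
  proof -
    have "map (\<lambda>l. card l div 2) ls ! j = card (ls ! j) div 2" using that m by simp
    then show ?thesis using even_card_loop[OF lsj[OF that]] unfolding map by simp
  qed
  have "\<exists>j<?m. x \<in> ls ! j" if x: "x \<in> pts n" for x
  proof -
    have "x \<in> \<Union>(set ls)" using x Union_loops_on ls by simp
    then show ?thesis using m by (auto simp: in_set_conv_nth)
  qed
  then obtain idx where idx: "\<And>x. x \<in> pts n \<Longrightarrow> idx x < ?m \<and> x \<in> ls ! idx x" by metis
  have idx_eq: "idx x = j" if "j < ?m" "x \<in> ls ! j" for x j
  proof -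
    have "x \<in> pts n" using that lsj loops_on_subset by blast
    then have "ls ! idx x = ls ! j"
      using disjoint_loops_on[OF lsj lsj, of "idx x" j] that idx by blast
    then show ?thesis using nth_eq_iff_index_eq[OF ls(2)] that m idx[OF \<open>x \<in> pts n\<close>] by simp
  qed
  have "\<exists>x. x \<in> ls ! j" if "j < ?m" for j using loops_on_nonempty[OF lsj[OF that]] by blast
  then obtain rep where rep: "\<And>j. j < ?m \<Longrightarrow> rep j \<in> ls ! j" by metis
  have rep_pts: "rep j \<in> pts n" if "j < ?m" for j using rep[OF that] lsj[OF that] loops_on_subset by blast
  have idx_inv: "idx (A x) = idx x" "idx (B x) = idx x" if x: "x \<in> pts n" for x
  proof -
    have l: "ls ! idx x = loop_of (pts n) A B x" using loops_onE(1)[OF lsj] idx[OF x] by blast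
    have "A x \<in> ls ! idx x" "B x \<in> ls ! idx x"
      unfolding l using loop_of_A[OF x loop_of_self] loop_of_B[OF x loop_of_self] by auto
    then show "idx (A x) = idx x" "idx (B x) = idx x" using idx_eq idx[OF x] by auto
  qed
  let ?F = "{f \<in> {..<length rho} \<rightarrow>\<^sub>E {..<length nu}.
      \<forall>i<length nu. (\<Sum>j\<in>{j. j < length rho \<and> f j = i}. rho ! j) = nu ! i}"
  let ?U = "{u \<in> colourings n nu. \<forall>x\<in>pts n. u (A x) = u x \<and> u (B x) = u x}"
  have const: "u x = u (rep (idx x))" if "\<forall>x\<in>pts n. u (A x) = u x \<and> u (B x) = u x" "x \<in> pts n" for u :: "nat \<Rightarrow> nat" and x
  proof (rule loop_of_const[of "rep (idx x)" x u])
    have "ls ! idx x = loop_of (pts n) A B (rep (idx x))"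
      using loops_onE(1)[OF lsj] idx[OF that(2)] rep by blast
    then show "x \<in> loop_of (pts n) A B (rep (idx x))" using idx[OF that(2)] by simp
  qed (use that idx rep_pts in auto)
  have fibre: "card {x \<in> pts n. f (idx x) = i} = 2 * (\<Sum>j\<in>{j. j < ?m \<and> f j = i}. rho ! j)" for f i
  proof -
    let ?J = "{j. j < ?m \<and> f j = i}"
    have eq: "{x \<in> pts n. f (idx x) = i} = (\<Union>j\<in>?J. ls ! j)"
    proof (intro equalityI subsetI)
      fix x assume "x \<in> {x \<in> pts n. f (idx x) = i}"
      then show "x \<in> (\<Union>j\<in>?J. ls ! j)" using idx[of x] by blast
    next
      fix x assume "x \<in> (\<Union>j\<in>?J. ls ! j)"
      then obtain j where "j < ?m" "f j = i" "x \<in> ls ! j" by blast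
      then show "x \<in> {x \<in> pts n. f (idx x) = i}" using idx_eq[of j x] lsj loops_on_subset by blast
    qed
    have "card (\<Union>j\<in>?J. ls ! j) = (\<Sum>j\<in>?J. card (ls ! j))"
    proof (rule card_UN_disjoint)
      show "\<forall>j\<in>?J. finite (ls ! j)" using lsj loops_on_subset finite_subset[OF _ fin] by blast
      show "\<forall>i\<in>?J. \<forall>j\<in>?J. i \<noteq> j \<longrightarrow> ls ! i \<inter> ls ! j = {}"
        using idx_eq by blast
    qed simp
    also have "\<dots> = (\<Sum>j\<in>?J. 2 * rho ! j)" using card_ls by (intro sum.cong) auto
    finally show ?thesis unfolding eq by (simp add: sum_distrib_left)
  qed
  have "bij_betw (\<lambda>f. restrict (\<lambda>x. f (idx x)) (pts n)) ?F ?U"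
  proof (rule bij_betwI[where g = "\<lambda>u. restrict (\<lambda>j. u (rep j)) {..<?m}"])
    show "(\<lambda>f. restrict (\<lambda>x. f (idx x)) (pts n)) \<in> ?F \<rightarrow> ?U"
    proof
      fix f assume f: "f \<in> ?F"
      let ?u = "restrict (\<lambda>x. f (idx x)) (pts n)"
      have "card {x \<in> pts n. ?u x = i} = 2 * nu ! i" if "i < length nu" for i
      proof -
        have "{x \<in> pts n. ?u x = i} = {x \<in> pts n. f (idx x) = i}" by auto
        moreover have "(\<Sum>j\<in>{j. j < ?m \<and> f j = i}. rho ! j) = nu ! i" using f that by blast
        ultimately show ?thesis by (simp only: fibre)
      qed
      moreover have "?u \<in> pts n \<rightarrow>\<^sub>E {..<length nu}" using f idx by auto
      moreover have "?u (A x) = ?u x \<and> ?u (B x) = ?u x" if "x \<in> pts n" for x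
        using that idx_inv matching_onD(1)[OF matA] matching_onD(1)[OF matB] by simp
      ultimately show "?u \<in> ?U" by (simp add: colourings_def)
    qed
    show "(\<lambda>u. restrict (\<lambda>j. u (rep j)) {..<?m}) \<in> ?U \<rightarrow> ?F"
    proof
      fix u assume u: "u \<in> ?U"
      let ?f = "restrict (\<lambda>j. u (rep j)) {..<?m}"
      have "u x = ?f (idx x)" if "x \<in> pts n" for x using const[of u x] u that idx[OF that] by simp
      then have "{x \<in> pts n. ?f (idx x) = i} = {x \<in> pts n. u x = i}" for i by auto
      then have "2 * (\<Sum>j\<in>{j. j < ?m \<and> ?f j = i}. rho ! j) = 2 * nu ! i" if "i < length nu" for i
        using u that unfolding fibre[of ?f i, symmetric] by (simp add: colourings_def)
      then have "\<forall>i<length nu. (\<Sum>j\<in>{j. j < ?m \<and> ?f j = i}. rho ! j) = nu ! i" by simp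
      moreover have "?f \<in> {..<?m} \<rightarrow>\<^sub>E {..<length nu}"
        using u rep_pts by (auto simp: colourings_def)
      ultimately show "?f \<in> ?F" by blast
    qed
    show "restrict (\<lambda>j. restrict (\<lambda>x. f (idx x)) (pts n) (rep j)) {..<?m} = f" if "f \<in> ?F" for f
    proof
      fix j
      have fP: "f \<in> {..<?m} \<rightarrow>\<^sub>E {..<length nu}" using that by blast
      show "restrict (\<lambda>j. restrict (\<lambda>x. f (idx x)) (pts n) (rep j)) {..<?m} j = f j"
        using rep_pts[of j] rep[of j] idx_eq[of j "rep j"] PiE_arb[OF fP, of j] by (cases "j < ?m") auto
    qed
    show "restrict (\<lambda>x. restrict (\<lambda>j. u (rep j)) {..<?m} (idx x)) (pts n) = u" if "u \<in> ?U" for u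
    proof
      fix x
      have uP: "u \<in> pts n \<rightarrow>\<^sub>E {..<length nu}" using that by (simp add: colourings_def)
      show "restrict (\<lambda>x. restrict (\<lambda>j. u (rep j)) {..<?m} (idx x)) (pts n) x = u x"
        using const[of u x] that idx[of x] PiE_arb[OF uP, of x] by (cases "x \<in> pts n") auto
    qed
  qed
  then show ?thesis unfolding mono_coeff_def by (rule bij_betw_same_card)
qed

subsection \<open>The zonal polynomials as Jack polynomials\<close>

text \<open>With \<open>n\<close> boxes and \<open>2 * n\<close> points an injective labelling fills
  every half-box, so each row receives exactly twice its length.\<close>

lemma card_rows_less:
  assumes g: "inj_on g (pts n)" "g \<in> pts n \<rightarrow>\<^sub>E diagram mu \<times> (UNIV :: bool set)" and n: "sum_list mu = n"
  shows "card {x \<in> pts n. fst (fst (g x)) < j} = 2 * sum_list (take j mu)"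
proof -
  have sub: "g ` pts n \<subseteq> diagram mu \<times> UNIV" by (rule image_subsetI) (rule PiE_mem[OF g(2)])
  have "card (g ` pts n) = card (diagram mu \<times> (UNIV :: bool set))"
    using card_image[OF g(1)] n by (simp add: card_diagram card_cartesian_product UNIV_bool)
  then have img: "g ` pts n = diagram mu \<times> UNIV"
    using card_subset_eq[OF _ sub] finite_diagram[of mu] by simp
  let ?S = "{x \<in> pts n. fst (fst (g x)) < j}"
  have "g ` ?S = {p \<in> g ` pts n. fst (fst p) < j}" by auto
  also have "\<dots> = {p \<in> diagram mu. fst p < j} \<times> UNIV" unfolding img by auto
  finally have "card (g ` ?S) = 2 * sum_list (take j mu)"
    by (simp add: card_cartesian_product card_diagram_rows UNIV_bool)
  moreover have "inj_on g ?S" using g(1) by (rule inj_on_subset) auto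
  ultimately show ?thesis by (simp add: card_image)
qed

lemma not_dominatedE:
  assumes "nu \<in> partitions n" "la \<in> partitions n" "\<not> dominated nu la"
  obtains j where "sum_list (take j la) < sum_list (take j nu)"
  using assms partitionsD(3)[OF assms(1)] partitionsD(3)[OF assms(2)] by (auto simp: dominated_def not_le)

text \<open>With \<open>B\<close> fixed, the weight of a colouring of content \<open>nu\<close> is
  the indicator of its invariance under \<open>B\<close>. Failure of dominance at \<open>j\<close>
  gives every such colouring too many points of the first \<open>j\<close> colours.\<close>

lemma mcoeff_zonal_dominated:
  assumes la: "la \<in> partitions n" and nu: "nu \<in> partitions n" and "mcoeff n (zonal n la) nu \<noteq> 0"
  shows "dominated nu la"
proof (rule ccontr)
  assume "\<not> dominated nu la"
  then obtain j where j: "sum_list (take j la) < sum_list (take j nu)"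
    by (rule not_dominatedE[OF nu la])
  let ?P = "pair_partitions n"
  let ?inv = "\<lambda>u A. \<forall>x\<in>pts n. u (A x) = (u x :: nat)"
  have "real (mono_coeff (type_list n A B) nu) =
      (\<Sum>u\<in>colourings n nu. of_bool (?inv u A) * of_bool (?inv u B))"
    if "A \<in> ?P" "B \<in> ?P" for A B
  proof -
    have "{u \<in> colourings n nu. \<forall>x\<in>pts n. u (A x) = u x \<and> u (B x) = u x} =
        {u \<in> colourings n nu. ?inv u A \<and> ?inv u B}" by auto
    then have "real (mono_coeff (type_list n A B) nu) = (\<Sum>u\<in>{u \<in> colourings n nu. ?inv u A \<and> ?inv u B}. 1)"
      using mono_coeff_eq_colourings[OF that type_list(1)[OF that]] by simp
    also have "\<dots> = (\<Sum>u\<in>colourings n nu. of_bool (?inv u A) * of_bool (?inv u B))"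
      by (rule sum.mono_neutral_cong_left) (use finite_colourings in auto)
    finally show ?thesis .
  qed
  then have "mcoeff n (zonal n la) nu = (\<Sum>A\<in>?P. \<Sum>B\<in>?P. signed_count n (diagram la) A B *
      (\<Sum>u\<in>colourings n nu. of_bool (?inv u A) * of_bool (?inv u B))) / fact (2 * n)"
    unfolding mcoeff_def sum_zonal by simp
  also have "(\<Sum>A\<in>?P. \<Sum>B\<in>?P. signed_count n (diagram la) A B *
      (\<Sum>u\<in>colourings n nu. of_bool (?inv u A) * of_bool (?inv u B))) =
      (\<Sum>B\<in>?P. \<Sum>A\<in>?P. signed_count n (diagram la) A B *
      (\<Sum>u\<in>colourings n nu. of_bool (?inv u A) * of_bool (?inv u B)))"
    by (rule sum.swap)
  also have "\<dots> = 0"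
  proof (rule sum.neutral, rule ballI)
    fix B assume B: "B \<in> ?P"
    show "(\<Sum>A\<in>?P. signed_count n (diagram la) A B *
      (\<Sum>u\<in>colourings n nu. of_bool (?inv u A) * of_bool (?inv u B))) = 0"
    proof (rule signed_count_weighted_zero[OF partitionsD(1)[OF la] B])
      fix u assume "u \<in> colourings n nu"
      then have "2 * sum_list (take j la) < card {x \<in> pts n. u x < j}"
        using j card_colouring_less by simp
      then show "\<exists>j. 2 * sum_list (take j la) < card {x \<in> pts n. u x < j}" ..
    qed
  qed
  finally show False using assms(3) by simp
qed

text \<open>At parameter 2 the factor \<open>zee rho * 2 ^ length rho\<close> of the scalar product
  turns one of the two coefficients back into a signed count. The other then cancels as in
  \<open>mcoeff_zonal_dominated\<close>, with row maps of labellings by \<open>mu\<close> as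
  colourings.\<close>

lemma jack_inner_zonal_not_dominated:
  assumes la: "la \<in> partitions n" and mu: "mu \<in> partitions n" and "\<not> dominated mu la"
  shows "jack_inner 2 n (zonal n la) (zonal n mu) = 0"
proof -
  let ?P = "pair_partitions n"
  obtain j where j: "sum_list (take j la) < sum_list (take j mu)"
    by (rule not_dominatedE[OF mu la assms(3)])
  let ?F = "\<lambda>rho. zonal n mu rho * (2 ^ length rho * real (zee rho))"
  let ?I = "\<lambda>B. {g \<in> pts n \<rightarrow>\<^sub>E diagram mu \<times> UNIV. col_compat n B g \<and> inj_on g (pts n)}"
  let ?w = "\<lambda>B g. \<Sum>S0\<in>box_pairings n g. loop_sign n S0 B"
  let ?inv = "\<lambda>g A. \<forall>x\<in>pts n. fst (fst (g (A x))) = fst (fst (g x))"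
  have F: "?F (type_list n A B) = (\<Sum>g\<in>?I B. of_bool (?inv g A) * ?w B g)"
    if AB: "A \<in> ?P" "B \<in> ?P" for A B
  proof -
    have "?F (type_list n A B) = signed_count n (diagram mu) A B"
      by (rule zonal_eq_signed_count) (use AB type_list in auto)
    \<comment> \<open>The exchange puts \<open>A\<close> in the position governing rows: invariance
      of the row map under \<open>A\<close> becomes an indicator, and the remaining weight depends
      on \<open>B\<close> only.\<close>
    also have "\<dots> = signed_count n (diagram mu) B A"
      by (rule signed_count_type) (use AB finite_diagram loop_type_commute in auto)
    also have "\<dots> = (\<Sum>g\<in>?I B. of_bool (?inv g A) * ?w B g)"
      unfolding signed_count_inj[OF finite_diagram AB(2)]
    proof (rule sum.mono_neutral_cong_left)
      show "finite (?I B)"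
        by (rule finite_subset[of _ "pts n \<rightarrow>\<^sub>E diagram mu \<times> UNIV"])
          (use finite_diagram in \<open>auto intro!: finite_PiE\<close>)
    qed (auto simp: labellings_def row_compat_def)
    finally show ?thesis .
  qed
  have "jack_inner 2 n (zonal n la) (zonal n mu) = (\<Sum>rho\<in>partitions n. zonal n la rho * ?F rho)"
    unfolding jack_inner_def by (rule sum.cong) auto
  also have "\<dots> = (\<Sum>A\<in>?P. \<Sum>B\<in>?P. signed_count n (diagram la) A B *
      (\<Sum>g\<in>?I B. of_bool (?inv g A) * ?w B g)) / fact (2 * n)"
    unfolding sum_zonal using F by simp
  also have "(\<Sum>A\<in>?P. \<Sum>B\<in>?P. signed_count n (diagram la) A B *
      (\<Sum>g\<in>?I B. of_bool (?inv g A) * ?w B g)) =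
      (\<Sum>B\<in>?P. \<Sum>A\<in>?P. signed_count n (diagram la) A B *
      (\<Sum>g\<in>?I B. of_bool (?inv g A) * ?w B g))"
    by (rule sum.swap)
  also have "\<dots> = 0"
  proof (rule sum.neutral, rule ballI)
    fix B assume B: "B \<in> ?P"
    show "(\<Sum>A\<in>?P. signed_count n (diagram la) A B * (\<Sum>g\<in>?I B. of_bool (?inv g A) * ?w B g)) = 0"
    proof (rule signed_count_weighted_zero[OF partitionsD(1)[OF la] B])
      fix g assume "g \<in> ?I B"
      then have "card {x \<in> pts n. fst (fst (g x)) < j} = 2 * sum_list (take j mu)"
        using partitionsD(3)[OF mu] by (intro card_rows_less) auto
      then have "2 * sum_list (take j la) < card {x \<in> pts n. fst (fst (g x)) < j}" using j by simp
      then show "\<exists>j. 2 * sum_list (take j la) < card {x \<in> pts n. fst (fst (g x)) < j}" ..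
    qed
  qed
  finally show ?thesis by simp
qed

text \<open>Factorials on both sides express the product of the factors from
  \<open>signed_count_extend\<close> without a division.\<close>

lemma signed_count_extend_many:
  assumes D: "finite D" and S: "S1 \<in> pair_partitions k" "S2 \<in> pair_partitions k" and "k + j \<le> card D"
  shows "\<exists>A\<in>pair_partitions (k + j). \<exists>B\<in>pair_partitions (k + j).
    loop_type (pts (k + j)) A B = replicate_mset j 1 + loop_type (pts k) S1 S2 \<and>
    signed_count (k + j) D A B * fact (card D - k - j) = 2 ^ j * fact (card D - k) * signed_count k D S1 S2"
  using assms(4)
proof (induction j)
  case 0
  then show ?case using S by auto
next
  case (Suc j)
  then obtain A B where AB: "A \<in> pair_partitions (k + j)" "B \<in> pair_partitions (k + j)"
    "loop_type (pts (k + j)) A B = replicate_mset j 1 + loop_type (pts k) S1 S2"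
    "signed_count (k + j) D A B * fact (card D - k - j) = 2 ^ j * fact (card D - k) * signed_count k D S1 S2"
    by auto
  let ?A = "extend (k + j) A" and ?B = "extend (k + j) B"
  have le: "Suc (k + j) \<le> card D" using Suc.prems by simp
  then have f: "(fact (card D - k - j) :: real) = (real (card D) - real (k + j)) * fact (card D - k - Suc j)"
    by (subst fact_reduce) (auto simp: of_nat_diff)
  have "signed_count (Suc (k + j)) D ?A ?B * fact (card D - k - Suc j) =
      2 * (signed_count (k + j) D A B * fact (card D - k - j))"
    unfolding signed_count_extend[OF D AB(1,2)] f by simp
  also have "\<dots> = 2 ^ Suc j * fact (card D - k) * signed_count k D S1 S2" unfolding AB(4) by simp
  finally have "signed_count (Suc (k + j)) D ?A ?B * fact (card D - k - Suc j) =
      2 ^ Suc j * fact (card D - k) * signed_count k D S1 S2" .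
  then show ?case
    using extend_pair_partitions[OF AB(1)] extend_pair_partitions[OF AB(2)] loops_extend[OF AB(1,2)] AB(3)
    by (intro bexI[of _ ?A] bexI[of _ ?B]) simp_all
qed

text \<open>Only the multiplicity of 1 changes. The quotient of the two factorials yields the
  binomial coefficient in \<open>Sigma2\<close>.\<close>

lemma zmset_replicate_one:
  "zmset (replicate_mset j 1 + M) * fact (count M 1) = zmset M * fact (count M 1 + j)"
proof (induction j)
  case (Suc j)
  have "zmset (replicate_mset (Suc j) 1 + M) * fact (count M 1) =
      Suc (count M 1 + j) * (zmset (replicate_mset j 1 + M) * fact (count M 1))"
    by (simp add: zmset_add_mset algebra_simps)
  also have "\<dots> = zmset M * fact (count M 1 + Suc j)" unfolding Suc.IH by (simp add: distrib_left mult.left_commute)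
  finally show ?case .
qed simp

lemma ones_partition: "replicate n 1 \<in> partitions n"
  by (auto simp: partitions_def sorted_wrt_iff_nth_less sum_list_replicate)

text \<open>Starting from the empty pair, \<open>n\<close> extensions produce the signed count
  \<open>2 ^ n * fact n\<close>, which is exactly the normalizing factor of this type.\<close>

lemma zonal_ones:
  assumes "la \<in> partitions n"
  shows "zonal n la (replicate n 1) = 1"
proof -
  have card: "card (diagram la) = n" using partitionsD(3)[OF assms] by (simp add: card_diagram)
  have id: "id \<in> pair_partitions 0" by (simp add: pair_partitions_def)
  have lt: "loop_type (pts 0) id id = {#}" by (simp add: loop_type_def loops_on_def pts_def)
  obtain A B where AB: "A \<in> pair_partitions n" "B \<in> pair_partitions n"
    "loop_type (pts n) A B = replicate_mset n 1"
    "signed_count n (diagram la) A B = 2 ^ n * fact n"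
    using signed_count_extend_many[OF finite_diagram id id, of n la] card lt signed_count_0[OF id id] by auto
  have z: "zee (replicate n 1) = fact n"
    using zmset_replicate_one[of n "{#}"] by (simp add: zee_eq_zmset zmset_def[of "{#}"])
  have "zonal n la (replicate n 1) * (2 ^ length (replicate n (1::nat)) * real (zee (replicate n 1))) =
      signed_count n (diagram la) A B"
    by (rule zonal_eq_signed_count[OF ones_partition AB(1,2)]) (simp add: AB(3))
  then show ?thesis unfolding AB(4) z by simp
qed

text \<open>Merging shortens a partition, so the squarefree monomial occurs in no other power sum
  product than the one of \<open>n\<close> ones.\<close>

lemma mcoeff_zonal_ones:
  assumes "la \<in> partitions n"
  shows "mcoeff n (zonal n la) (replicate n 1) = fact n"
proof -
  have "mcoeff n (zonal n la) (replicate n 1) =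
      (\<Sum>rho\<in>{replicate n 1}. zonal n la rho * real (mono_coeff rho (replicate n 1)))"
    unfolding mcoeff_def
  proof (rule sum.mono_neutral_right[OF finite_partitions])
    show "\<forall>rho\<in>partitions n - {replicate n 1}. zonal n la rho * real (mono_coeff rho (replicate n 1)) = 0"
    proof
      fix rho assume rho: "rho \<in> partitions n - {replicate n 1}"
      then have P: "rho \<in> partitions n" by simp
      have len: "length rho \<le> n"
        using length_le_sum_list[of rho] partitionsD(2,3)[OF P] by simp
      have "mono_coeff rho (replicate n 1) = 0"
      proof (rule ccontr)
        assume ne: "mono_coeff rho (replicate n 1) \<noteq> 0"
        have "length (replicate n (1::nat)) = length rho"
          using mono_coeff_nonzero(1)[OF P ones_partition ne] len by simp
        then have "rho = replicate n 1" by (rule mono_coeff_nonzero(2)[OF P ones_partition ne])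
        then show False using rho by simp
      qed
      then show "zonal n la rho * real (mono_coeff rho (replicate n 1)) = 0" by simp
    qed
  qed (use ones_partition[of n] in simp)
  then show ?thesis using zonal_ones[OF assms] mono_coeff_ones[of n] by simp
qed

lemma jack_family_zonal: "jack_family 2 n (zonal n)"
proof
  show "(0::real) < 2" by simp
  show "supported n (zonal n la)" for la by (simp add: supported_def zonal_def)
  show "dominated nu la" if "la \<in> partitions n" "nu \<in> partitions n" "mcoeff n (zonal n la) nu \<noteq> 0" for la nu
    using mcoeff_zonal_dominated that .
  show "mcoeff n (zonal n la) (replicate n 1) = fact n" if "la \<in> partitions n" for la
    using mcoeff_zonal_ones that .
  show "jack_inner 2 n (zonal n la) (zonal n mu) = 0"
    if "la \<in> partitions n" "mu \<in> partitions n" "la \<noteq> mu" for la mu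
  proof (cases "dominated mu la")
    case True
    \<comment> \<open>Vanishing is known when one particular dominance fails. By antisymmetry one of
      the two fails, and the scalar product is symmetric.\<close>
    then have "\<not> dominated la mu" using dominated_antisym that by blast
    then show ?thesis
      using jack_inner_zonal_not_dominated[OF that(2,1)] by (simp add: jack_inner_commute)
  qed (use jack_inner_zonal_not_dominated that in blast)
qed

theorem theta2_eq_zonal: "la \<in> partitions n \<Longrightarrow> theta2 rho la = zonal n la rho"
  using jack_family.jack_eq[OF jack_family_zonal] by (simp add: theta2_def)

text \<open>Adjoining \<open>n - k\<close> common pairs multiplies the signed count by
  \<open>2 ^ (n - k) * fact (n - k)\<close>. The power of 2 accounts for the added parts in
  \<open>2 ^ length\<close>, and the factorial times the binomial coefficient for the change of z,
  so the normalization of \<open>Sigma2\<close> cancels exactly.\<close>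

theorem Sigma2_eq_signed_count:
  assumes mu: "mu \<in> partitions k" and la: "la \<in> partitions n"
    and S: "S1 \<in> pair_partitions k" "S2 \<in> pair_partitions k" and type: "loop_type (pts k) S1 S2 = mset mu"
  shows "Sigma2 mu la = signed_count k (diagram la) S1 S2 / 2 ^ length mu"
proof (cases "k \<le> n")
  case False
  \<comment> \<open>There are too few boxes for an injective labelling, in agreement with the value
    0 in the definition of \<open>Sigma2\<close>.\<close>
  then have "signed_count k (diagram la) S1 S2 = 0"
    using signed_count_large[OF finite_diagram S(1)] partitionsD(3)[OF la] by (simp add: card_diagram)
  then show ?thesis using False partitionsD(3)[OF mu] partitionsD(3)[OF la] by (simp add: Sigma2_def)
next
  case True
  let ?j = "n - k" and ?m = "count_list mu 1"
  let ?rho = "mu @ replicate (n - k) 1"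
  have card: "card (diagram la) = n" using partitionsD(3)[OF la] by (simp add: card_diagram)
  have rho: "?rho \<in> partitions n"
    using True partitionsD[OF mu] partitionsD(1)[OF ones_partition]
    by (auto simp: partitions_def sorted_wrt_append sum_list_replicate Suc_le_eq)
  obtain A B where AB: "A \<in> pair_partitions n" "B \<in> pair_partitions n"
    "loop_type (pts n) A B = replicate_mset ?j 1 + mset mu"
    "signed_count n (diagram la) A B = 2 ^ ?j * fact ?j * signed_count k (diagram la) S1 S2"
    using signed_count_extend_many[OF finite_diagram S, of ?j la] card True type by auto
  have "zonal n la ?rho * (2 ^ length ?rho * real (zee ?rho)) = signed_count n (diagram la) A B"
    by (rule zonal_eq_signed_count[OF rho AB(1,2)]) (simp add: AB(3))
  then have 1: "zonal n la ?rho * real (zee ?rho) * 2 ^ length mu =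
      fact ?j * signed_count k (diagram la) S1 S2"
    unfolding AB(4) by (simp add: power_add mult_ac)
  have cm: "count (mset mu) 1 = ?m" by (simp add: count_mset)
  have "zee ?rho * fact ?m = zee mu * fact (?m + ?j)"
    using zmset_replicate_one[of ?j "mset mu"] unfolding cm by (simp add: zee_eq_zmset add.commute)
  then have "real (zee ?rho) * fact ?m = real (zee mu) * fact (?m + ?j)"
    by (metis of_nat_fact of_nat_mult)
  moreover have "(fact (?m + ?j) :: real) = real ((?j + ?m) choose ?m) * fact ?m * fact ?j"
    using binomial_fact[of ?m "?j + ?m", where 'a = real] by (simp add: field_simps add.commute)
  ultimately have "real (zee ?rho) * fact ?m = (real (zee mu) * real ((?j + ?m) choose ?m) * fact ?j) * fact ?m"
    by simp
  then have z: "real (zee ?rho) = real (zee mu) * real ((?j + ?m) choose ?m) * fact ?j"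
    by (subst (asm) mult_right_cancel) auto
  have "Sigma2 mu la = real ((?j + ?m) choose ?m) * real (zee mu) * zonal n la ?rho"
    using True partitionsD(3)[OF mu] partitionsD(3)[OF la] theta2_eq_zonal[OF la] by (simp add: Sigma2_def)
  then have "fact ?j * Sigma2 mu la * 2 ^ length mu = zonal n la ?rho * real (zee ?rho) * 2 ^ length mu"
    unfolding z by simp
  then have "fact ?j * (Sigma2 mu la * 2 ^ length mu) = fact ?j * signed_count k (diagram la) S1 S2"
    unfolding 1 by simp
  then have "Sigma2 mu la * 2 ^ length mu = signed_count k (diagram la) S1 S2"
    by (subst (asm) mult_left_cancel) auto
  then show ?thesis by (simp add: field_simps)
qed

section \<open>Counting labellings in Stanley coordinates\<close>

context two_matchings
begin

text \<open>A base point is chosen in every loop, and \<open>h\<close> holds on its orbit under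
  \<open>B \<circ> A\<close>. The other half of the loop is disjoint from this orbit, and each
  matching exchanges the two halves.\<close>

lemma ex_alternating: "\<exists>h. alternating X A h \<and> alternating X B h"
proof -
  have "\<exists>r. \<forall>l\<in>loops_on X A B. r l \<in> l" using loops_on_nonempty by (intro bchoice) blast
  then obtain r where r: "\<And>l. l \<in> loops_on X A B \<Longrightarrow> r l \<in> l" by blast
  define s where "s x = r (loop_of X A B x)" for x
  define h where "h x \<longleftrightarrow> (\<exists>j. x = ((B \<circ> A) ^^ j) (s x))" for x
  have s: "s x \<in> X" "x \<in> loop_of X A B (s x)" if x: "x \<in> X" for x
  proof -
    have 1: "s x \<in> loop_of X A B x" using r[OF loop_of_in[OF x]] by (simp add: s_def)
    then show "s x \<in> X" using loop_of_subset[OF x] by blast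
    show "x \<in> loop_of X A B (s x)" using loop_of_eqI[OF 1] loop_of_self by simp
  qed
  have sA: "s (A x) = s x" and sB: "s (B x) = s x" if x: "x \<in> X" for x
    using loop_of_eqI[OF loop_of_A[OF x loop_of_self]] loop_of_eqI[OF loop_of_B[OF x loop_of_self]]
    by (simp_all add: s_def)
  have hA: "h (A x) = (\<not> h x)" if x: "x \<in> X" for x
  proof -
    from s(2)[OF x] loop_of_eq[OF s(1)[OF x]]
    consider j where "x = ((B \<circ> A) ^^ j) (s x)" | j where "x = A (((B \<circ> A) ^^ j) (s x))" by blast
    then show ?thesis
    proof cases
      case 1
      then have "A x \<noteq> ((B \<circ> A) ^^ i) (s x)" for i
        using loop_of_disjoint_halves[OF s(1)[OF x], of j i] by metis
      then show ?thesis using 1 unfolding h_def sA[OF x] by blast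
    next
      case 2
      then have "A x = A (A (((B \<circ> A) ^^ j) (s x)))" by (rule arg_cong)
      also have "\<dots> = ((B \<circ> A) ^^ j) (s x)"
        by (rule matching_onD(3)[OF matA funpow_in[OF s(1)[OF x]]])
      finally have "A x = ((B \<circ> A) ^^ j) (s x)" .
      moreover have "x \<noteq> ((B \<circ> A) ^^ i) (s x)" for i
        using loop_of_disjoint_halves[OF s(1)[OF x], of j i] 2 by metis
      ultimately show ?thesis unfolding h_def sA[OF x] by blast
    qed
  qed
  have step: "h (B (A x)) = h x" if x: "x \<in> X" "h x" for x
  proof -
    obtain j where "x = ((B \<circ> A) ^^ j) (s x)" using x(2) unfolding h_def by blast
    then have "B (A x) = ((B \<circ> A) ^^ Suc j) (s x)" by (metis comp_apply funpow.simps(2))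
    moreover have "s (B (A x)) = s x" using sA sB x(1) matching_onD(1)[OF matA] by simp
    ultimately show ?thesis using x(2) unfolding h_def by metis
  qed
  have hB: "h (B x) = (\<not> h x)" if x: "x \<in> X" for x
  proof (cases "h x")
    case False
    then show ?thesis
      using step[of "A x"] hA[OF x] x matching_onD(1,3)[OF matA x] by simp
  next
    case True
    have "\<not> h (B x)"
    proof
      assume "h (B x)"
      obtain j where j: "x = ((B \<circ> A) ^^ j) (s x)" using True unfolding h_def by blast
      obtain p where p: "p > 0" "\<And>i j. ((B \<circ> A) ^^ i) (s x) = ((B \<circ> A) ^^ j) (s x) \<longleftrightarrow> i mod p = j mod p"
        using period[OF s(1)[OF x]] by blast
      obtain i where i: "j + p = Suc i" using p(1) by (metis Suc_pred add_gr_0)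
      have "x = ((B \<circ> A) ^^ Suc i) (s x)" unfolding i[symmetric] using j p(2)[of j "j + p"] by simp
      then have "B x = B (((B \<circ> A) ^^ Suc i) (s x))" by (rule arg_cong)
      also have "\<dots> = A (((B \<circ> A) ^^ i) (s x))" by (rule B_funpow_Suc[OF s(1)[OF x]])
      finally have "B x = A (((B \<circ> A) ^^ i) (s x))" .
      moreover obtain i' where "B x = ((B \<circ> A) ^^ i') (s x)"
        using \<open>h (B x)\<close> unfolding h_def sB[OF x] by blast
      ultimately show False using loop_of_disjoint_halves[OF s(1)[OF x], of i i'] by metis
    qed
    then show ?thesis using True by simp
  qed
  show ?thesis using hA hB by (auto simp: alternating_def)
qed

end

text \<open>Rows and columns are coupled only by the condition that boxes lie in the diagram: the
  column on \<open>l'\<close> must be smaller than the length of every row assigned to a loop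
  meeting \<open>l'\<close>, whence the minimum.\<close>

lemma card_labellings:
  assumes S0: "S0 \<in> pair_partitions k" and S1: "S1 \<in> pair_partitions k" and S2: "S2 \<in> pair_partitions k"
  shows "card {g \<in> labellings k (diagram la) S1 S2. box_compat k S0 g} =
    (\<Sum>R\<in>loops k S0 S2 \<rightarrow>\<^sub>E {..<length la}. 2 ^ card (loops k S0 S1) *
      (\<Prod>l'\<in>loops k S0 S1. Min {la ! R l | l. l \<in> loops k S0 S2 \<and> l \<inter> l' \<noteq> {}}))"
proof -
  let ?X = "pts k"
  interpret L1: two_matchings ?X S0 S1 using S0 S1 by (rule two_matchings_pts)
  interpret L2: two_matchings ?X S0 S2 using S0 S2 by (rule two_matchings_pts)
  define \<Lambda>1 where "\<Lambda>1 = loops k S0 S1"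
  define \<Lambda>2 where "\<Lambda>2 = loops k S0 S2"
  define c where "c = loop_of ?X S0 S1"
  define r where "r = loop_of ?X S0 S2"
  have fin: "finite \<Lambda>1" "finite \<Lambda>2"
    unfolding \<Lambda>1_def \<Lambda>2_def loops_pts by (simp_all add: finite_loops_on)
  \<comment> \<open>A reference choice of sides. Both \<open>h\<close> and the side of a labelling
    flip along \<open>S0\<close> and \<open>S1\<close>, so their agreement is constant on each loop;
    one bit per loop gives the power of 2.\<close>
  obtain h where h: "alternating ?X S0 h" "alternating ?X S1 h" using L1.ex_alternating by blast
  have X: "S0 x \<in> ?X" "S1 x \<in> ?X" "S2 x \<in> ?X" if "x \<in> ?X" for x
    using that matching_onD(1)[OF L1.matA] matching_onD(1)[OF L1.matB] matching_onD(1)[OF L2.matB] by auto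
  have c: "c x \<in> \<Lambda>1" "x \<in> c x" "c (S0 x) = c x" "c (S1 x) = c x" if "x \<in> ?X" for x
    using that L1.loop_of_in L1.loop_of_self L1.loop_of_eqI[OF L1.loop_of_A] L1.loop_of_eqI[OF L1.loop_of_B]
    by (auto simp: c_def \<Lambda>1_def loops_pts)
  have r: "r x \<in> \<Lambda>2" "x \<in> r x" "r (S0 x) = r x" "r (S2 x) = r x" if "x \<in> ?X" for x
    using that L2.loop_of_in L2.loop_of_self L2.loop_of_eqI[OF L2.loop_of_A] L2.loop_of_eqI[OF L2.loop_of_B]
    by (auto simp: r_def \<Lambda>2_def loops_pts)
  have mem1: "x \<in> ?X \<and> c x = l" if "l \<in> \<Lambda>1" "x \<in> l" for l x
    using L1.loops_onE[of l x] that by (simp add: \<Lambda>1_def c_def loops_pts)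
  have mem2: "x \<in> ?X \<and> r x = l" if "l \<in> \<Lambda>2" "x \<in> l" for l x
    using L2.loops_onE[of l x] that by (simp add: \<Lambda>2_def r_def loops_pts)
  define rep :: "nat set \<Rightarrow> nat" where "rep l = (SOME x. x \<in> l)" for l
  have rep1: "rep l \<in> ?X" "c (rep l) = l" if "l \<in> \<Lambda>1" for l
    using mem1[OF that, of "rep l"] L1.loops_on_nonempty[of l] that
    by (auto simp: rep_def \<Lambda>1_def loops_pts some_in_eq)
  have rep2: "rep l \<in> ?X" "r (rep l) = l" if "l \<in> \<Lambda>2" for l
    using mem2[OF that, of "rep l"] L2.loops_on_nonempty[of l] that
    by (auto simp: rep_def \<Lambda>2_def loops_pts some_in_eq)
  have rep_c: "c (rep (c x)) = c x" "rep (c x) \<in> ?X" if "x \<in> ?X" for x using rep1 c(1)[OF that] by auto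
  have rep_r: "r (rep (r x)) = r x" "rep (r x) \<in> ?X" if "x \<in> ?X" for x using rep2 r(1)[OF that] by auto
  have in_c: "x \<in> loop_of ?X S0 S1 (rep (c x))" if "x \<in> ?X" for x
    using c(2)[OF that] rep_c(1)[OF that] by (simp add: c_def)
  have in_r: "x \<in> loop_of ?X S0 S2 (rep (r x))" if "x \<in> ?X" for x
    using r(2)[OF that] rep_r(1)[OF that] by (simp add: r_def)
  define M where "M R l' = Min {la ! R l | l. l \<in> \<Lambda>2 \<and> l \<inter> l' \<noteq> {}}" for R :: "nat set \<Rightarrow> nat" and l'
  have M_less: "n < M R l' \<longleftrightarrow> (\<forall>x\<in>l'. n < la ! R (r x))" if "l' \<in> \<Lambda>1" for R l' n
  proof -
    have eq: "{la ! R l | l. l \<in> \<Lambda>2 \<and> l \<inter> l' \<noteq> {}} = (\<lambda>x. la ! R (r x)) ` l'"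
    proof (intro equalityI subsetI)
      fix v assume "v \<in> {la ! R l | l. l \<in> \<Lambda>2 \<and> l \<inter> l' \<noteq> {}}"
      then obtain l x where "v = la ! R l" "l \<in> \<Lambda>2" "x \<in> l" "x \<in> l'" by blast
      then show "v \<in> (\<lambda>x. la ! R (r x)) ` l'" using mem2[of l x] by blast
    next
      fix v assume "v \<in> (\<lambda>x. la ! R (r x)) ` l'"
      then obtain x where x: "x \<in> l'" "v = la ! R (r x)" by blast
      then have "x \<in> ?X" using mem1[OF that] by blast
      then have "r x \<in> \<Lambda>2 \<and> r x \<inter> l' \<noteq> {}" using r x by blast
      then show "v \<in> {la ! R l | l. l \<in> \<Lambda>2 \<and> l \<inter> l' \<noteq> {}}" using x(2) by blast
    qed
    have "l' \<subseteq> ?X" using mem1[OF that] by blast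
    then have "finite l'" by (rule finite_subset) simp
    moreover have "l' \<noteq> {}" using L1.loops_on_nonempty that by (simp add: \<Lambda>1_def loops_pts)
    ultimately show ?thesis unfolding M_def eq by (subst Min_gr_iff) auto
  qed
  let ?G = "{g \<in> labellings k (diagram la) S1 S2. box_compat k S0 g}"
  let ?T = "Sigma (\<Lambda>2 \<rightarrow>\<^sub>E {..<length la}) (\<lambda>R. (\<Pi>\<^sub>E l'\<in>\<Lambda>1. {..<M R l'}) \<times> (\<Lambda>1 \<rightarrow>\<^sub>E (UNIV :: bool set)))"
  let ?to = "\<lambda>g::labelling. (restrict (\<lambda>l. fst (fst (g (rep l)))) \<Lambda>2,
      restrict (\<lambda>l. snd (fst (g (rep l)))) \<Lambda>1, restrict (\<lambda>l. snd (g (rep l)) = h (rep l)) \<Lambda>1)"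
  let ?from = "\<lambda>(R, C, H). restrict (\<lambda>x. ((R (r x), C (c x)), H (c x) = h x)) ?X"
  have GD: "g x \<in> diagram la \<times> UNIV" if "g \<in> ?G" "x \<in> ?X" for g x
    using that by (auto simp: labellings_def simp del: mem_Times_iff dest: PiE_mem)
  have Gcompat: "fst (g (S0 x)) = fst (g x)" "snd (g (S0 x)) = (\<not> snd (g x))"
    "snd (fst (g (S1 x))) = snd (fst (g x))" "snd (g (S1 x)) = (\<not> snd (g x))"
    "fst (fst (g (S2 x))) = fst (fst (g x))" if "g \<in> ?G" "x \<in> ?X" for g x
    using that by (auto simp: labellings_def box_compat_def col_compat_def row_compat_def)
  have Grow: "fst (fst (g x)) = fst (fst (g (rep (r x))))" if "g \<in> ?G" "x \<in> ?X" for g x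
    by (rule L2.loop_of_const[OF rep_r(2)[OF that(2)] in_r[OF that(2)], of "\<lambda>x. fst (fst (g x))"])
      (simp_all add: Gcompat[OF that(1)])
  have Gcol: "snd (fst (g x)) = snd (fst (g (rep (c x))))" if "g \<in> ?G" "x \<in> ?X" for g x
    by (rule L1.loop_of_const[OF rep_c(2)[OF that(2)] in_c[OF that(2)], of "\<lambda>x. snd (fst (g x))"])
      (simp_all add: Gcompat[OF that(1)])
  have Gside: "(snd (g x) = h x) = (snd (g (rep (c x))) = h (rep (c x)))" if "g \<in> ?G" "x \<in> ?X" for g x
    by (rule L1.loop_of_const[OF rep_c(2)[OF that(2)] in_c[OF that(2)], of "\<lambda>x. snd (g x) = h x"])
      (use h in \<open>auto simp: Gcompat[OF that(1)] alternating_def\<close>)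
  have bij: "bij_betw ?to ?G ?T"
  proof (rule bij_betwI[where g = ?from])
    show "?to \<in> ?G \<rightarrow> ?T"
    proof
      fix g assume g: "g \<in> ?G"
      let ?R = "restrict (\<lambda>l. fst (fst (g (rep l)))) \<Lambda>2"
      have in_diag: "fst (fst (g x)) < length la" "snd (fst (g x)) < la ! fst (fst (g x))" if "x \<in> ?X" for x
        using GD[OF g that] by (simp_all add: mem_Times_iff diagram_def case_prod_unfold)
      have "?R \<in> \<Lambda>2 \<rightarrow>\<^sub>E {..<length la}"
        using in_diag(1)[OF rep2(1)] by (intro PiE_I) auto
      moreover have "snd (fst (g (rep l'))) < M ?R l'" if l': "l' \<in> \<Lambda>1" for l'
        unfolding M_less[OF l']
      proof
        fix x assume "x \<in> l'"
        then have x: "x \<in> ?X" "c x = l'" using mem1[OF l'] by auto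
        have "snd (fst (g x)) < la ! fst (fst (g x))" by (rule in_diag(2)[OF x(1)])
        then show "snd (fst (g (rep l'))) < la ! ?R (r x)"
          using Grow[OF g x(1)] Gcol[OF g x(1)] x(2) r(1)[OF x(1)] by simp
      qed
      ultimately show "?to g \<in> ?T" by auto
    qed
    show "?from \<in> ?T \<rightarrow> ?G"
    proof
      fix t assume "t \<in> ?T"
      then obtain R C H where t: "t = (R, C, H)" "R \<in> \<Lambda>2 \<rightarrow>\<^sub>E {..<length la}"
        "C \<in> (\<Pi>\<^sub>E l'\<in>\<Lambda>1. {..<M R l'})" by auto
      let ?g = "restrict (\<lambda>x. ((R (r x), C (c x)), H (c x) = h x)) ?X"
      have "?g \<in> ?X \<rightarrow>\<^sub>E diagram la \<times> UNIV"
      proof (rule PiE_I)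
        fix x assume x: "x \<in> ?X"
        have "R (r x) < length la" using PiE_mem[OF t(2) r(1)[OF x]] by simp
        moreover have "C (c x) < M R (c x)" using PiE_mem[OF t(3) c(1)[OF x]] by simp
        then have "C (c x) < la ! R (r x)" using M_less[OF c(1)[OF x]] c(2)[OF x] by blast
        ultimately show "?g x \<in> diagram la \<times> UNIV" using x by (simp add: diagram_def)
      qed simp
      moreover have "box_compat k S0 ?g"
        using h(1) by (auto simp: box_compat_def X c r alternating_def)
      moreover have "col_compat k S1 ?g"
        using h(2) by (auto simp: col_compat_def X c alternating_def)
      moreover have "row_compat k S2 ?g" by (auto simp: row_compat_def X r)
      ultimately show "?from t \<in> ?G" by (simp add: t(1) labellings_def)
    qed
    show "?from (?to g) = g" if g: "g \<in> ?G" for g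
    proof
      fix x
      have gP: "g \<in> ?X \<rightarrow>\<^sub>E diagram la \<times> UNIV" using g by (simp add: labellings_def)
      show "?from (?to g) x = g x"
      proof (cases "x \<in> ?X")
        case True
        then show ?thesis
          using Grow[OF g True] Gcol[OF g True] Gside[OF g True] r(1)[OF True] c(1)[OF True]
          by (auto simp: prod_eq_iff)
      next
        case False
        then show ?thesis using PiE_arb[OF gP False] by simp
      qed
    qed
    show "?to (?from t) = t" if t: "t \<in> ?T" for t
    proof -
      obtain R C H where t: "t = (R, C, H)" "R \<in> \<Lambda>2 \<rightarrow>\<^sub>E {..<length la}"
        "C \<in> (\<Pi>\<^sub>E l'\<in>\<Lambda>1. {..<M R l'})" "H \<in> \<Lambda>1 \<rightarrow>\<^sub>E UNIV" using t by auto
      let ?g = "restrict (\<lambda>x. ((R (r x), C (c x)), H (c x) = h x)) ?X"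
      have "restrict (\<lambda>l. fst (fst (?g (rep l)))) \<Lambda>2 = R"
        by (rule extensionalityI[of _ \<Lambda>2]) (use t(2) rep2 in \<open>auto simp: PiE_def\<close>)
      moreover have "restrict (\<lambda>l. snd (fst (?g (rep l)))) \<Lambda>1 = C"
        by (rule extensionalityI[of _ \<Lambda>1]) (use t(3) rep1 in \<open>auto simp: PiE_def\<close>)
      moreover have "restrict (\<lambda>l. snd (?g (rep l)) = h (rep l)) \<Lambda>1 = H"
        by (rule extensionalityI[of _ \<Lambda>1]) (use t(4) rep1 in \<open>auto simp: PiE_def\<close>)
      ultimately show ?thesis by (simp add: t(1))
    qed
  qed
  have "card ?G = card ?T" using bij by (rule bij_betw_same_card)
  also have "\<dots> = (\<Sum>R\<in>\<Lambda>2 \<rightarrow>\<^sub>E {..<length la}. card ((\<Pi>\<^sub>E l'\<in>\<Lambda>1. {..<M R l'}) \<times> (\<Lambda>1 \<rightarrow>\<^sub>E (UNIV :: bool set))))"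
    using fin by (subst card_SigmaI) (auto intro!: finite_PiE)
  also have "\<dots> = (\<Sum>R\<in>\<Lambda>2 \<rightarrow>\<^sub>E {..<length la}. 2 ^ card \<Lambda>1 * (\<Prod>l'\<in>\<Lambda>1. M R l'))"
    using fin by (simp add: card_cartesian_product card_PiE card_UNIV_bool mult.commute)
  finally show ?thesis by (simp only: M_def \<Lambda>1_def \<Lambda>2_def)
qed

section \<open>From the signed count to the sum over \<open>p\<close> and \<open>q\<close>\<close>

lemma signed_count_eq_sum_pairings:
  assumes "S1 \<in> pair_partitions k" "finite D"
  shows "signed_count k D S1 S2 =
    (\<Sum>S0\<in>pair_partitions k. loop_sign k S0 S1 * real (card {g \<in> labellings k D S1 S2. box_compat k S0 g}))"
proof -
  have "signed_count k D S1 S2 =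
      (\<Sum>g\<in>labellings k D S1 S2. \<Sum>S0\<in>pair_partitions k. if box_compat k S0 g then loop_sign k S0 S1 else 0)"
    unfolding signed_count_def box_pairings_def
    by (intro sum.cong refl sum.inter_filter finite_pair_partitions)
  also have "\<dots> = (\<Sum>S0\<in>pair_partitions k. \<Sum>g\<in>labellings k D S1 S2. if box_compat k S0 g then loop_sign k S0 S1 else 0)"
    by (rule sum.swap)
  also have "\<dots> = (\<Sum>S0\<in>pair_partitions k. \<Sum>g\<in>{g \<in> labellings k D S1 S2. box_compat k S0 g}. loop_sign k S0 S1)"
    by (intro sum.cong refl sum.inter_filter[symmetric] finite_labellings assms)
  finally show ?thesis by (simp add: mult.commute)
qed

text \<open>\<open>\<beta>\<close> gives the block containing a row, with blocks numbered from 1 as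
  in \<open>seqv\<close>. Distinct blocks may have the same row length, so the length of a row does
  not determine its block.\<close>

lemma ptimesq_coordinates:
  assumes "length ps = length qs"
  obtains \<beta> where "\<And>i. i < length (ptimesq ps qs) \<Longrightarrow> \<beta> i \<in> {1..length qs}"
    and "\<And>i. i < length (ptimesq ps qs) \<Longrightarrow> ptimesq ps qs ! i = seqv qs (\<beta> i)"
    and "\<And>j. j \<in> {1..length qs} \<Longrightarrow> card {i. i < length (ptimesq ps qs) \<and> \<beta> i = j} = seqv ps j"
proof -
  define bs where "bs = concat (map (\<lambda>i. replicate (ps ! i) (Suc i)) [0..<length qs])"
  have "zip ps qs = map (\<lambda>i. (ps ! i, qs ! i)) [0..<length qs]"
    by (rule nth_equalityI) (use assms in auto)
  then have eq: "ptimesq ps qs = map (seqv qs) bs"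
    unfolding ptimesq_def bs_def map_concat
    by (auto simp: comp_def seqv_def intro!: arg_cong[where f = concat])
  have sub: "set bs \<subseteq> {1..length qs}" by (auto simp: bs_def)
  have card: "card {i. i < length bs \<and> bs ! i = j} = seqv ps j" if "j \<in> {1..length qs}" for j
  proof -
    have "count (mset bs) j = (\<Sum>i<length qs. if j = Suc i then ps ! i else 0)"
      unfolding bs_def
      by (simp add: mset_concat sum_list_sum_nth atLeast0LessThan count_sum sum_list_distinct_conv_sum_set comp_def)
    also have "\<dots> = (\<Sum>i<length qs. if i = j - 1 then ps ! i else 0)"
      by (rule sum.cong) (use that in auto)
    also have "\<dots> = seqv ps j" using that assms by (auto simp: seqv_def)
    finally show ?thesis by (simp add: count_mset length_filter_conv_card count_list_eq_length_filter eq_commute)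
  qed
  show thesis
  proof (rule that[of "(!) bs"])
    show "bs ! i \<in> {1..length qs}" if "i < length (ptimesq ps qs)" for i
      using that unfolding eq by (intro subsetD[OF sub] nth_mem) simp
    show "ptimesq ps qs ! i = seqv qs (bs ! i)" if "i < length (ptimesq ps qs)" for i
      using that unfolding eq by simp
    show "card {i. i < length (ptimesq ps qs) \<and> bs ! i = j} = seqv ps j" if "j \<in> {1..length qs}" for j
      using card[OF that] unfolding eq by simp
  qed
qed

lemma ptimesq_partition:
  assumes "length ps = length qs" "\<forall>x\<in>set qs. 0 < x" "sorted_wrt (\<ge>) qs"
  shows "ptimesq ps qs \<in> partitions (sum_list (ptimesq ps qs))"
proof -
  have "(\<forall>x\<in>set (ptimesq ps qs). x \<in> set qs) \<and> sorted_wrt (\<ge>) (ptimesq ps qs)"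
    using assms(1,3)
  proof (induction ps qs rule: list_induct2)
    case (Cons p ps q qs)
    have "ptimesq (p # ps) (q # qs) = replicate p q @ ptimesq ps qs" by (simp add: ptimesq_def)
    moreover have "sorted_wrt (\<ge>) (replicate p q)" by (simp add: sorted_wrt_iff_nth_less)
    ultimately show ?case using Cons by (auto simp: sorted_wrt_append)
  qed (simp add: ptimesq_def)
  then show ?thesis using assms(2) by (simp add: partitions_def)
qed

theorem theorem1p8:
  fixes mu ps qs :: "nat list" and k :: nat and S1 S2 :: "nat \<Rightarrow> nat"
  assumes "mu \<in> partitions k"
    and "S1 \<in> pair_partitions k" and "S2 \<in> pair_partitions k"
    and "pp_type k S1 S2 = mset mu"
    and "length ps = length qs"
    and "\<forall>x\<in>set ps. 0 < x" and "\<forall>x\<in>set qs. 0 < x"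
    and "sorted_wrt (\<ge>) qs"
  shows "Sigma2 mu (ptimesq ps qs) =
    (-1) ^ k / 2 ^ length mu *
    (\<Sum>S0\<in>pair_partitions k.
       infsum (\<lambda>phi. (\<Prod>l\<in>loops k S0 S2. real (seqv ps (phi l))) *
                     (\<Prod>l'\<in>loops k S0 S1. - 2 * real (seqv qs (psi k S0 S2 S1 phi l'))))
              (loops k S0 S2 \<rightarrow>\<^sub>E {1..}))"
proof -
  define la where "la = ptimesq ps qs"
  let ?m = "length qs"
  obtain \<beta> where \<beta>: "\<And>i. i < length la \<Longrightarrow> \<beta> i \<in> {1..?m}" "\<And>i. i < length la \<Longrightarrow> la ! i = seqv qs (\<beta> i)"
    and card_\<beta>: "\<And>j. j \<in> {1..?m} \<Longrightarrow> card {i. i < length la \<and> \<beta> i = j} = seqv ps j"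
    using ptimesq_coordinates[OF assms(5)] unfolding la_def by blast
  \<comment> \<open>A larger block index means rows that are no longer; this trades the minimum of
    row lengths for the maximum of block indices in \<open>psi\<close>.\<close>
  have anti: "seqv qs j \<le> seqv qs i" if "i \<in> {1..?m}" "j \<in> {1..?m}" "i \<le> j" for i j
    using sorted_wrt_nth_less[OF assms(8), of "i - 1" "j - 1"] that
    by (cases "i = j") (auto simp: seqv_def)
  have key: "loop_sign k S0 S1 * real (card {g \<in> labellings k (diagram la) S1 S2. box_compat k S0 g}) =
      (-1) ^ k * infsum (\<lambda>phi. (\<Prod>l\<in>loops k S0 S2. real (seqv ps (phi l))) *
                     (\<Prod>l'\<in>loops k S0 S1. - 2 * real (seqv qs (psi k S0 S2 S1 phi l'))))
              (loops k S0 S2 \<rightarrow>\<^sub>E {1..})" if S0: "S0 \<in> pair_partitions k" for S0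
  proof -
    let ?L1 = "loops k S0 S1" and ?L2 = "loops k S0 S2"
    interpret L1: two_matchings "pts k" S0 S1 using S0 assms by (intro two_matchings_pts)
    interpret L2: two_matchings "pts k" S0 S2 using S0 assms by (intro two_matchings_pts)
    have fin: "finite ?L1" "finite ?L2" unfolding loops_pts by (simp_all add: finite_loops_on)
    let ?W = "\<lambda>phi. \<Prod>l'\<in>?L1. real (seqv qs (psi k S0 S2 S1 phi l'))"
    \<comment> \<open>Forgetting the position of a row inside its block turns \<open>R\<close> into
      a map \<open>phi\<close> as in the theorem; by \<open>fib\<close> each \<open>phi\<close>
      arises from a product of values of \<open>p\<close> many \<open>R\<close>.\<close>
    let ?b = "\<lambda>R. restrict (\<lambda>l. \<beta> (R l)) ?L2"
    let ?Rs = "?L2 \<rightarrow>\<^sub>E {..<length la}" and ?\<Phi> = "?L2 \<rightarrow>\<^sub>E {1..?m}"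
    have Min: "Min {la ! R l | l. l \<in> ?L2 \<and> l \<inter> l' \<noteq> {}} = seqv qs (psi k S0 S2 S1 (?b R) l')"
      if R: "R \<in> ?Rs" and l': "l' \<in> ?L1" for R l'
    proof -
      let ?I = "{l \<in> ?L2. l \<inter> l' \<noteq> {}}"
      \<comment> \<open>Both families of loops cover \<open>[2k]\<close>, so some loop meets
        \<open>l'\<close> and the \<open>Max\<close> and \<open>Min\<close> are taken over nonempty
        sets.\<close>
      have "l' \<noteq> {}" "l' \<subseteq> pts k" using L1.loops_on_nonempty L1.loops_on_subset l' by (auto simp: loops_pts)
      then obtain x where "x \<in> l'" "x \<in> pts k" by blast
      then have ne: "?I \<noteq> {}"
        using L2.loop_of_in L2.loop_of_self[of x] unfolding loops_pts by blast
      have finI: "finite ?I" using fin by simp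
      have Rl: "R l < length la" if "l \<in> ?I" for l using R that by auto
      have "psi k S0 S2 S1 (?b R) l' = Max {?b R l | l. l \<in> ?I}" by (simp add: psi_def)
      also have "{?b R l | l. l \<in> ?I} = (\<lambda>l. \<beta> (R l)) ` ?I" by auto
      finally have psi: "psi k S0 S2 S1 (?b R) l' = Max ((\<lambda>l. \<beta> (R l)) ` ?I)" .
      have "Max ((\<lambda>l. \<beta> (R l)) ` ?I) \<in> (\<lambda>l. \<beta> (R l)) ` ?I" using finI ne by (intro Max_in) auto
      then obtain l0 where l0: "l0 \<in> ?I" "Max ((\<lambda>l. \<beta> (R l)) ` ?I) = \<beta> (R l0)" by blast
      have le: "\<beta> (R l) \<le> \<beta> (R l0)" if "l \<in> ?I" for l
        unfolding l0(2)[symmetric] using finI that by (intro Max_ge) auto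
      have "Min ((\<lambda>l. la ! R l) ` ?I) = la ! R l0"
      proof (rule Min_eqI)
        fix y assume "y \<in> (\<lambda>l. la ! R l) ` ?I"
        then obtain l where l: "l \<in> ?I" "y = la ! R l" by blast
        show "la ! R l0 \<le> y"
          using anti[OF \<beta>(1)[OF Rl[OF l(1)]] \<beta>(1)[OF Rl[OF l0(1)]] le[OF l(1)]]
          by (simp only: l(2) \<beta>(2)[OF Rl[OF l(1)]] \<beta>(2)[OF Rl[OF l0(1)]])
      qed (use finI l0 in auto)
      moreover have "{la ! R l | l. l \<in> ?L2 \<and> l \<inter> l' \<noteq> {}} = (\<lambda>l. la ! R l) ` ?I" by auto
      ultimately show ?thesis unfolding psi l0(2) using \<beta>(2)[OF Rl[OF l0(1)]] by simp
    qed
    have fib: "card {R \<in> ?Rs. ?b R = phi} = (\<Prod>l\<in>?L2. seqv ps (phi l))" if phi: "phi \<in> ?\<Phi>" for phi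
    proof -
      have "{R \<in> ?Rs. ?b R = phi} = (\<Pi>\<^sub>E l\<in>?L2. {i. i < length la \<and> \<beta> i = phi l})"
      proof (intro equalityI subsetI)
        fix R assume R: "R \<in> {R \<in> ?Rs. ?b R = phi}"
        have "\<beta> (R l) = phi l" if "l \<in> ?L2" for l
        proof -
          have "?b R l = phi l" using R by simp
          then show ?thesis using that by simp
        qed
        then show "R \<in> (\<Pi>\<^sub>E l\<in>?L2. {i. i < length la \<and> \<beta> i = phi l})"
          using R by (auto simp: PiE_iff)
      next
        fix R assume R: "R \<in> (\<Pi>\<^sub>E l\<in>?L2. {i. i < length la \<and> \<beta> i = phi l})"
        have "?b R = phi"
          by (rule extensionalityI[of _ ?L2]) (use R phi in \<open>auto simp: PiE_iff\<close>)
        then show "R \<in> {R \<in> ?Rs. ?b R = phi}" using R by (auto simp: PiE_iff)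
      qed
      then have "card {R \<in> ?Rs. ?b R = phi} = (\<Prod>l\<in>?L2. card {i. i < length la \<and> \<beta> i = phi l})"
        using fin by (simp add: card_PiE)
      also have "\<dots> = (\<Prod>l\<in>?L2. seqv ps (phi l))"
        by (rule prod.cong[OF refl], rule card_\<beta>) (use phi in auto)
      finally show ?thesis .
    qed
    have finR: "finite ?Rs" "finite ?\<Phi>" using fin by (auto intro!: finite_PiE)
    have img: "?b ` ?Rs \<subseteq> ?\<Phi>"
    proof (rule image_subsetI)
      fix R assume "R \<in> ?Rs"
      then have "\<beta> (R l) \<in> {1..?m}" if "l \<in> ?L2" for l using that by (intro \<beta>(1)) auto
      then show "?b R \<in> ?\<Phi>" by simp
    qed
    have "real (card {g \<in> labellings k (diagram la) S1 S2. box_compat k S0 g}) =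
        (\<Sum>R\<in>?Rs. 2 ^ card ?L1 * ?W (?b R))"
      unfolding card_labellings[OF S0 assms(2,3)] of_nat_sum
      by (rule sum.cong[OF refl]) (simp add: Min)
    also have "\<dots> = (\<Sum>phi\<in>?\<Phi>. \<Sum>R\<in>{R \<in> ?Rs. ?b R = phi}. 2 ^ card ?L1 * ?W (?b R))"
      by (rule sum.group[symmetric, OF finR img])
    also have "\<dots> = (\<Sum>phi\<in>?\<Phi>. 2 ^ card ?L1 * ((\<Prod>l\<in>?L2. real (seqv ps (phi l))) * ?W phi))"
    proof (rule sum.cong[OF refl])
      fix phi assume phi: "phi \<in> ?\<Phi>"
      have "(\<Sum>R\<in>{R \<in> ?Rs. ?b R = phi}. 2 ^ card ?L1 * ?W (?b R)) =
          (\<Sum>R\<in>{R \<in> ?Rs. ?b R = phi}. 2 ^ card ?L1 * ?W phi)" by (rule sum.cong) auto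
      also have "\<dots> = 2 ^ card ?L1 * ((\<Prod>l\<in>?L2. real (seqv ps (phi l))) * ?W phi)"
        by (simp add: fib[OF phi])
      finally show "(\<Sum>R\<in>{R \<in> ?Rs. ?b R = phi}. 2 ^ card ?L1 * ?W (?b R)) =
          2 ^ card ?L1 * ((\<Prod>l\<in>?L2. real (seqv ps (phi l))) * ?W phi)" .
    qed
    finally have count: "real (card {g \<in> labellings k (diagram la) S1 S2. box_compat k S0 g}) =
        (\<Sum>phi\<in>?\<Phi>. 2 ^ card ?L1 * ((\<Prod>l\<in>?L2. real (seqv ps (phi l))) * ?W phi))" .
    let ?f = "\<lambda>phi. (\<Prod>l\<in>?L2. real (seqv ps (phi l))) *
        (\<Prod>l'\<in>?L1. - 2 * real (seqv qs (psi k S0 S2 S1 phi l')))"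
    \<comment> \<open>Each factor \<open>-2\<close> combines the contribution of one loop to the
      sign with its two choices of sides.\<close>
    have f: "?f phi = (-1) ^ card ?L1 * (2 ^ card ?L1 * ((\<Prod>l\<in>?L2. real (seqv ps (phi l))) * ?W phi))" for phi
    proof -
      have "(\<Prod>l'\<in>?L1. - 2 * real (seqv qs (psi k S0 S2 S1 phi l'))) = (- 2) ^ card ?L1 * ?W phi"
        by (simp only: prod.distrib prod_constant)
      also have "(- 2 :: real) ^ card ?L1 = (-1) ^ card ?L1 * 2 ^ card ?L1"
        by (simp add: power_mult_distrib[symmetric])
      finally show ?thesis by simp
    qed
    \<comment> \<open>\<open>seqv ps\<close> is 0 beyond the length of \<open>ps\<close>, so any
      \<open>phi\<close> with a value there contributes 0 and the sum is finite.\<close>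
    have "infsum ?f (?L2 \<rightarrow>\<^sub>E {1..}) = infsum ?f ?\<Phi>"
    proof (rule infsum_cong_neutral)
      fix phi assume phi: "phi \<in> (?L2 \<rightarrow>\<^sub>E {1..}) - ?\<Phi>"
      then obtain l where l: "l \<in> ?L2" "phi l \<notin> {1..?m}" by (auto simp: PiE_iff)
      then have "seqv ps (phi l) = 0" using assms(5) by (auto simp: seqv_def)
      then have "(\<Prod>l\<in>?L2. real (seqv ps (phi l))) = 0" using l(1) fin by (auto simp: prod_zero_iff)
      then show "?f phi = 0" by simp
    qed (auto simp: PiE_iff)
    also have "\<dots> = sum ?f ?\<Phi>" using finR by simp
    also have "\<dots> = (-1) ^ card ?L1 * real (card {g \<in> labellings k (diagram la) S1 S2. box_compat k S0 g})"
      unfolding f count by (rule sum_distrib_left[symmetric])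
    finally show ?thesis by (simp add: loop_sign_def power_add)
  qed
  have "Sigma2 mu la = signed_count k (diagram la) S1 S2 / 2 ^ length mu"
    using ptimesq_partition[OF assms(5,7,8)] assms unfolding la_def pp_type_pts
    by (intro Sigma2_eq_signed_count)
  also have "\<dots> = (\<Sum>S0\<in>pair_partitions k. (-1) ^ k *
      infsum (\<lambda>phi. (\<Prod>l\<in>loops k S0 S2. real (seqv ps (phi l))) *
                     (\<Prod>l'\<in>loops k S0 S1. - 2 * real (seqv qs (psi k S0 S2 S1 phi l'))))
              (loops k S0 S2 \<rightarrow>\<^sub>E {1..})) / 2 ^ length mu"
    unfolding signed_count_eq_sum_pairings[OF assms(2) finite_diagram]
    by (rule arg_cong[where f = "\<lambda>x. x / 2 ^ length mu"], rule sum.cong[OF refl], rule key)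
  finally show ?thesis by (simp add: la_def sum_distrib_left[symmetric])
qed

end
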